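(* Let $\Omega\subset\mathbb{R}$ be a bounded domain. Then minimising $I_L(Q)$ over $$\mathcal{A}:=\left\{ Q\in W^{1,2}(\Omega,\mathbb{R}^{3\times3}) \;:\; Q^T=Q,\ \operatorname{Tr}Q=0\right\}$$ is equivalent to minimising $I_{BE}(n,m,s_1,s_2)$ over the set $\mathcal{B}$ of all $(n,m,s_1,s_2)$ such that $$s_1\in W^{1,2}(\Omega,[0,\infty)),\quad n\in W^{1,2}_{loc}(\Omega\setminus\{s_1=0\},\mathbb{S}^2),\quad s_2\in W^{1,2}(\Omega,(-\infty,0]),\quad m\in W^{1,2}_{loc}(\Omega\setminus\{s_2=0\},\mathbb{S}^2),$$ $$\int_\Omega s_1^2|\nabla n|^2+s_2^2|\nabla m|^2\,dx<\infty .$$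
   Context: "Equivalent" means that the admissible sets $\mathcal{A}$ and $\mathcal{B}$ correspond to each other through $Q=s_1(n\otimes n-\frac13I)+s_2(m\otimes m-\frac13I)$, with $I_L(Q)=I_{BE}(n,m,s_1,s_2)$ for corresponding functions, so that a minimiser of one problem yields a minimiser of the other and vice versa. Fix $t\in\mathbb{R}$ and real constants $\overline a<0$, $\overline b$, $\overline c>0$. The Landau-de Gennes energy is $$I_L(Q)=\int_\Omega |\nabla Q|^2+4t\,Q\cdot\nabla\times Q+3t^2|Q|^2+\psi_B(Q)\,dx,\qquad \psi_B(Q)=\tfrac{\overline a}{2}\operatorname{Tr}(Q^2)+\tfrac{\overline b}{3}\operatorname{Tr}(Q^3)+\tfrac{\overline c}{4}(\operatorname{Tr}(Q^2))^2,$$ with $(\nabla\times Q)_{ij}=\sum_{a,b}\epsilon_{jab}\,\partial_aQ_{ib}$ and the Frobenius inner product and norm. The biaxial Ericksen energy, for $s_1\geqslant0$, $s_2\leqslant0$ and $n,m\in\mathbb{S}^2$, is $$\begin{aligned} I_{BE}(n,m,s_1,s_2)=\int_\Omega\; & 2s_1^2\left(|\nabla n|^2+2t\,n\cdot\nabla\times n+t^2\right)+2s_2^2\left(|\nabla m|^2+2t\,m\cdot\nabla\times m+t^2\right)+\tilde\sigma(s_1,s_2)\\ &-2s_1s_2\left(|m^T\nabla n-t\,n\times m|^2+|n^T\nabla m-t\,m\times n|^2-t^2\right)\\ &+\tfrac13|\nabla(s_1-s_2)|^2+\tfrac13\left(|\nabla s_1|^2+|\nabla s_2|^2\right)dx,\end{aligned}$$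 where $(\nabla n)_{ij}=\partial_jn_i$, $(m^T\nabla n)_j=\sum_i m_i\partial_jn_i$, and $\tilde\sigma(s_1,s_2)$ is the bulk energy $\psi_B$ expressed through the scalar order parameters, i.e. $\psi_B$ of the symmetric traceless matrix with eigenvalues $\frac{2s_1-s_2}{3},\frac{2s_2-s_1}{3},-\frac{s_1+s_2}{3}$. Functions on $\Omega\subset\mathbb{R}$ are regarded as functions of one of the three Cartesian coordinates, derivatives in the other two being zero. Sobolev functions are identified with their precise (here continuous) representatives. Terms carrying a factor $s_1$ (resp. $s_2$) are read as $0$ where $s_1=0$ (resp. $s_2=0$).
   Formalization: The set B additionally requires n·m=0 wherever s1 and s2 are both nonzero; without this the claim fails: for n=m constant, s1=1, s2=-1 one gets Q=0 with I_L=0 but I_BE=|Ω|(2t²+a+c), which is nonzero in general. *)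

theory Defs
  imports "HOL-Analysis.Analysis"
begin

definition test_functions :: "real set \<Rightarrow> (real \<Rightarrow> real) set" where
  "test_functions U = {\<phi>. (\<forall>j x. ((deriv ^^ j) \<phi>) field_differentiable (at x)) \<and>
     compact (closure {x. \<phi> x \<noteq> 0}) \<and> closure {x. \<phi> x \<noteq> 0} \<subseteq> U}"

definition locally_integrable_on :: "(real \<Rightarrow> 'b::euclidean_space) \<Rightarrow> real set \<Rightarrow> bool" where
  "locally_integrable_on f U \<longleftrightarrow> (\<forall>K. compact K \<and> K \<subseteq> U \<longrightarrow> integrable (lebesgue_on K) f)"

definition weak_derivative :: "real set \<Rightarrow> (real \<Rightarrow> 'b::euclidean_space) \<Rightarrow> (real \<Rightarrow> 'b) \<Rightarrow> bool" where
  "weak_derivative U f g \<longleftrightarrow> locally_integrable_on f U \<and> locally_integrable_on g U \<and>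
     (\<forall>\<phi>\<in>test_functions U.
        (\<integral>x. deriv \<phi> x *\<^sub>R f x \<partial>lebesgue_on U) = - (\<integral>x. \<phi> x *\<^sub>R g x \<partial>lebesgue_on U))"

text \<open>A version of the weak derivative.  It is unique up to null sets in \<open>U\<close>, and is only
  used below under integral signs, so the choice is immaterial; off \<open>U\<close> it is arbitrary.\<close>

definition wderiv :: "real set \<Rightarrow> (real \<Rightarrow> 'b::euclidean_space) \<Rightarrow> real \<Rightarrow> 'b" where
  "wderiv U f = (SOME g. weak_derivative U f g)"

definition L2_on :: "real set \<Rightarrow> (real \<Rightarrow> 'b::euclidean_space) \<Rightarrow> bool" where
  "L2_on U f \<longleftrightarrow> f \<in> borel_measurable (lebesgue_on U) \<and> integrable (lebesgue_on U) (\<lambda>x. (norm (f x))\<^sup>2)"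

text \<open>Sobolev functions are identified with their continuous representatives, hence the
  continuity conditions.  Values outside \<open>U\<close> play no role.\<close>

definition W12 :: "real set \<Rightarrow> (real \<Rightarrow> 'b::euclidean_space) set" where
  "W12 U = {f. continuous_on U f \<and> L2_on U f \<and> (\<exists>g. weak_derivative U f g \<and> L2_on U g)}"

definition W12_loc :: "real set \<Rightarrow> (real \<Rightarrow> 'b::euclidean_space) set" where
  "W12_loc U = {f. continuous_on U f \<and> (\<exists>g. weak_derivative U f g \<and>
     (\<forall>K. compact K \<and> K \<subseteq> U \<longrightarrow> L2_on K f \<and> L2_on K g))}"

text \<open>A function on a subset of the line is regarded as a function on three-space depending on
  the coordinate number \<open>k\<close> only; \<open>pd k U j f\<close> is its partial derivative in direction \<open>j\<close>.\<close>

definition pd :: "3 \<Rightarrow> real set \<Rightarrow> 3 \<Rightarrow> (real \<Rightarrow> 'b::euclidean_space) \<Rightarrow> real \<Rightarrow> 'b" where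
  "pd k U j f x = (if j = k then wderiv U f x else 0)"

definition levi_civita :: "3 \<Rightarrow> 3 \<Rightarrow> 3 \<Rightarrow> real" where
  "levi_civita i j l =
     (if (i, j, l) \<in> {(1, 2, 3), (2, 3, 1), (3, 1, 2)} then 1
      else if (i, j, l) \<in> {(1, 3, 2), (3, 2, 1), (2, 1, 3)} then -1 else 0)"

definition sgrad :: "3 \<Rightarrow> real set \<Rightarrow> (real \<Rightarrow> real) \<Rightarrow> real \<Rightarrow> real^3" where
  "sgrad k U s x = (\<chi> j. pd k U j s x)"

definition vgrad :: "3 \<Rightarrow> real set \<Rightarrow> (real \<Rightarrow> real^3) \<Rightarrow> real \<Rightarrow> real^3^3" where
  "vgrad k U n x = (\<chi> i j. pd k U j n x $ i)"

definition vcurl :: "3 \<Rightarrow> real set \<Rightarrow> (real \<Rightarrow> real^3) \<Rightarrow> real \<Rightarrow> real^3" where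
  "vcurl k U n x = (\<chi> j. \<Sum>a\<in>UNIV. \<Sum>b\<in>UNIV. levi_civita j a b * pd k U a n x $ b)"

definition mcurl :: "3 \<Rightarrow> real set \<Rightarrow> (real \<Rightarrow> real^3^3) \<Rightarrow> real \<Rightarrow> real^3^3" where
  "mcurl k U Q x =
     (\<chi> i j. \<Sum>a\<in>UNIV. \<Sum>b\<in>UNIV. levi_civita j a b * pd k U a Q x $ i $ b)"

text \<open>The library's \<open>norm\<close> and inner product on \<open>real^3^3\<close> are the Frobenius ones.
  The integrands of \<open>I_L\<close> and \<open>I_BE\<close> are integrable for all admissible functions on a bounded
  interval, so the value \<open>0\<close> of the Bochner integral of a non-integrable function never occurs.\<close>

definition bulk :: "real \<Rightarrow> real \<Rightarrow> real \<Rightarrow> real^3^3 \<Rightarrow> real" where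
  "bulk a b c Q = a / 2 * trace (Q ** Q) + b / 3 * trace (Q ** Q ** Q) + c / 4 * (trace (Q ** Q))\<^sup>2"

definition I_L :: "real \<Rightarrow> real \<Rightarrow> real \<Rightarrow> real \<Rightarrow> 3 \<Rightarrow> real set \<Rightarrow> (real \<Rightarrow> real^3^3) \<Rightarrow> real" where
  "I_L t a b c k \<Omega> Q =
     (\<integral>x. (\<Sum>j\<in>UNIV. (norm (pd k \<Omega> j Q x))\<^sup>2) + 4 * t * (Q x \<bullet> mcurl k \<Omega> Q x)
          + 3 * t\<^sup>2 * (norm (Q x))\<^sup>2 + bulk a b c (Q x) \<partial>lebesgue_on \<Omega>)"

definition LdG_admissible :: "real set \<Rightarrow> (real \<Rightarrow> real^3^3) set" where
  "LdG_admissible \<Omega> = {Q \<in> W12 \<Omega>. \<forall>x\<in>\<Omega>. transpose (Q x) = Q x \<and> trace (Q x) = 0}"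

definition bulk_scalar :: "real \<Rightarrow> real \<Rightarrow> real \<Rightarrow> real \<Rightarrow> real \<Rightarrow> real" where
  "bulk_scalar a b c s1 s2 =
     (let ev = (vector [(2 * s1 - s2) / 3, (2 * s2 - s1) / 3, - (s1 + s2) / 3] :: real^3)
      in bulk a b c (\<chi> i j. if i = j then ev $ i else 0))"

type_synonym biaxial = "(real \<Rightarrow> real^3) \<times> (real \<Rightarrow> real^3) \<times> (real \<Rightarrow> real) \<times> (real \<Rightarrow> real)"

text \<open>The derivatives of \<open>n\<close> and \<open>m\<close> are weak derivatives on the open sets where the respective
  scalar order parameter does not vanish.  Elsewhere their values, and those of \<open>n\<close> and \<open>m\<close>,
  are arbitrary, but they only occur multiplied by \<open>s1 = 0\<close> or \<open>s2 = 0\<close>, respectively.\<close>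

definition I_BE :: "real \<Rightarrow> real \<Rightarrow> real \<Rightarrow> real \<Rightarrow> 3 \<Rightarrow> real set \<Rightarrow> biaxial \<Rightarrow> real" where
  "I_BE t a b c k \<Omega> = (\<lambda>(n, m, s1, s2).
     let \<Omega>1 = \<Omega> - {x. s1 x = 0}; \<Omega>2 = \<Omega> - {x. s2 x = 0} in
     (\<integral>x. 2 * (s1 x)\<^sup>2 * ((norm (vgrad k \<Omega>1 n x))\<^sup>2 + 2 * t * (n x \<bullet> vcurl k \<Omega>1 n x) + t\<^sup>2)
        + 2 * (s2 x)\<^sup>2 * ((norm (vgrad k \<Omega>2 m x))\<^sup>2 + 2 * t * (m x \<bullet> vcurl k \<Omega>2 m x) + t\<^sup>2)
        + bulk_scalar a b c (s1 x) (s2 x)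
        - 2 * s1 x * s2 x *
            ((norm (m x v* vgrad k \<Omega>1 n x - t *\<^sub>R cross3 (n x) (m x)))\<^sup>2
             + (norm (n x v* vgrad k \<Omega>2 m x - t *\<^sub>R cross3 (m x) (n x)))\<^sup>2 - t\<^sup>2)
        + 1 / 3 * (norm (sgrad k \<Omega> (\<lambda>y. s1 y - s2 y) x))\<^sup>2
        + 1 / 3 * ((norm (sgrad k \<Omega> s1 x))\<^sup>2 + (norm (sgrad k \<Omega> s2 x))\<^sup>2)
      \<partial>lebesgue_on \<Omega>))"

text \<open>\<open>n\<close> and \<open>m\<close> are eigenvectors of one symmetric matrix, hence orthogonal wherever both are
  defined.  This standing convention of the biaxial model is needed for the matrix \<open>Q\<close> to have
  the eigenvalues entering \<open>bulk_scalar\<close>: for \<open>n = m\<close>, \<open>s1 = 1\<close>, \<open>s2 = -1\<close> one would get \<open>Q = 0\<close>.\<close>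

definition BE_admissible :: "3 \<Rightarrow> real set \<Rightarrow> biaxial set" where
  "BE_admissible k \<Omega> = {(n, m, s1, s2).
     s1 \<in> W12 \<Omega> \<and> (\<forall>x\<in>\<Omega>. s1 x \<ge> 0) \<and>
     n \<in> W12_loc (\<Omega> - {x. s1 x = 0}) \<and> (\<forall>x\<in>\<Omega> - {x. s1 x = 0}. n x \<in> sphere 0 1) \<and>
     s2 \<in> W12 \<Omega> \<and> (\<forall>x\<in>\<Omega>. s2 x \<le> 0) \<and>
     m \<in> W12_loc (\<Omega> - {x. s2 x = 0}) \<and> (\<forall>x\<in>\<Omega> - {x. s2 x = 0}. m x \<in> sphere 0 1) \<and>
     (\<forall>x\<in>\<Omega> - {x. s1 x = 0} - {x. s2 x = 0}. n x \<bullet> m x = 0) \<and>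
     (\<integral>\<^sup>+x. ennreal ((s1 x)\<^sup>2 * (norm (vgrad k (\<Omega> - {x. s1 x = 0}) n x))\<^sup>2
          + (s2 x)\<^sup>2 * (norm (vgrad k (\<Omega> - {x. s2 x = 0}) m x))\<^sup>2) \<partial>lebesgue_on \<Omega>) < \<infinity>}"

definition tensor :: "real^3 \<Rightarrow> real^3 \<Rightarrow> real^3^3" where
  "tensor u v = (\<chi> i j. u $ i * v $ j)"

definition corresponding :: "real set \<Rightarrow> (real \<Rightarrow> real^3^3) \<Rightarrow> biaxial \<Rightarrow> bool" where
  "corresponding \<Omega> Q = (\<lambda>(n, m, s1, s2). \<forall>x\<in>\<Omega>.
     Q x = s1 x *\<^sub>R (tensor (n x) (n x) - (1/3) *\<^sub>R mat 1)
         + s2 x *\<^sub>R (tensor (m x) (m x) - (1/3) *\<^sub>R mat 1))"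

end

theory Submission
  imports Defs "HOL-Computational_Algebra.Polynomial"
begin

text \<open>
  On the line, weak differentiability is local absolute continuity, and absolutely continuous
  functions are differentiable almost everywhere with the weak derivative as derivative (by the
  Vitali covering theorem), so the identity between the energies is checked pointwise.  Where
  \<open>s1\<close> vanishes it is minimal, hence \<open>s1'\<close> and the derivative of
  \<open>s1 (n \<otimes> n - 1/3)\<close> vanish there too, and \<open>n\<close> can be replaced by any unit vector orthogonal
  to \<open>m\<close>; similarly for \<open>s2\<close>.  The remaining identity is algebra for an orthonormal pair \<open>(n, m)\<close>.

  From \<open>Q\<close> with eigenvalues \<open>\<lambda>1 \<ge> \<lambda>2 \<ge> \<lambda>3\<close> one takes \<open>s1 = \<lambda>1 - \<lambda>2\<close> and \<open>s2 = \<lambda>3 - \<lambda>2\<close>, which are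
  Lipschitz functions of \<open>Q\<close>, and unit eigenvectors \<open>n\<close>, \<open>m\<close> for \<open>\<lambda>1\<close>, \<open>\<lambda>3\<close>.  The projection
  \<open>n \<otimes> n\<close> is locally Lipschitz in \<open>Q\<close> with constant \<open>2 / s1\<close>, and on an open subset of the line
  the signs can be chosen such that \<open>n\<close> is continuous; this gives \<open>s1 |n'| \<le> 2 |Q'|\<close>.
  Conversely, \<open>s1 (n \<otimes> n - 1/3)\<close> has increments bounded by the integral of
  \<open>2 |s1'| + 2 s1 |n'|\<close>, also across zeros of \<open>s1\<close>, and the Radon-Nikodym theorem turns such a
  bound into absolute continuity.
\<close>

section \<open>Lebesgue differentiation\<close>

text \<open>The working notion is \<open>antideriv_on\<close>, the fundamental theorem of calculus
  on compact subintervals: it restricts and glues freely, whereas a weak derivative belongs to one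
  open set and is picked by \<open>SOME\<close>. Its local form \<open>ac_at\<close> asks only for
  an integrable bound on increments, so that Lipschitz images, products and directors can be treated
  before any derivative is known. The obstacle is the zero set of an order parameter s. It may be
  any relatively closed set, n need not have limits there, and no product rule is available across
  it. What survives is that the norm of s (n \<otimes> n - 1/3) is at most 2 s: an interval meeting
  a zero is estimated through that zero instead of through n. Directors are first chosen pointwise
  without any regularity. Only the projections n \<otimes> n, insensitive to sign, are regular;
  choosing signs is a lifting problem from lines to unit vectors, solvable because components of an
  open subset of the line are intervals. Since signs, and values at zeros of s, remain free, the
  correspondence is not one-to-one, and minimisers are compared through equal energies.\<close>

lemmas HK_combine = Henstock_Kurzweil_Integration.integral_combine
  and HK_reflect_real = Henstock_Kurzweil_Integration.integral_reflect_real
  and HK_Un = Henstock_Kurzweil_Integration.integral_Un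
  and HK_add = Henstock_Kurzweil_Integration.integral_add
  and HK_cong = Henstock_Kurzweil_Integration.integral_cong
  and HK_diff = Henstock_Kurzweil_Integration.integral_diff
  and HK_restrict_Int = Henstock_Kurzweil_Integration.integral_restrict_Int
  and HK_sum = Henstock_Kurzweil_Integration.integral_sum


text \<open>Truncation of |w| at height N: the excess above N has integral below e/2 by dominated
  convergence, and the truncated part contributes at most N times the measure of A.\<close>

lemma absolutely_integrable_small_sets:
  fixes w :: "'a::euclidean_space \<Rightarrow> real"
  assumes w: "w absolutely_integrable_on S" and e: "e > 0"
  obtains d where "d > 0" "\<And>A. \<lbrakk>A \<subseteq> S; A \<in> lmeasurable; measure lebesgue A < d\<rbrakk> \<Longrightarrow> integral A (\<lambda>x. \<bar>w x\<bar>) < e"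
proof -
  define v where "v x = (if x \<in> S then \<bar>w x\<bar> else 0)" for x
  have v: "integrable lebesgue v"
  proof -
    have "integrable lebesgue (\<lambda>x. norm (indicator S x *\<^sub>R w x))"
      using w unfolding set_integrable_def by (rule integrable_norm)
    moreover have "(\<lambda>x. norm (indicator S x *\<^sub>R w x)) = v"
      by (auto simp: v_def fun_eq_iff indicator_def)
    ultimately show ?thesis by simp
  qed
  have v_nn: "v x \<ge> 0" for x by (simp add: v_def)
  have vm: "v \<in> borel_measurable lebesgue" using v by auto
  have "(\<lambda>n. \<integral>x. (v x - min (v x) (real n)) \<partial>lebesgue) \<longlonglongrightarrow> (\<integral>x. 0 \<partial>(lebesgue :: 'a measure))"
  proof (rule integral_dominated_convergence[where w=v])
    show "AE x in lebesgue. (\<lambda>n. v x - min (v x) (real n)) \<longlonglongrightarrow> 0"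
    proof (rule AE_I2, rule tendsto_eventually)
      fix x
      show "\<forall>\<^sub>F n in sequentially. v x - min (v x) (real n) = 0"
        using eventually_ge_at_top[of "nat \<lceil>v x\<rceil>"]
        by eventually_elim (metis diff_self min.absorb1 nat_ceiling_le_eq)
    qed
  qed (use v vm v_nn in auto)
  then have "(\<lambda>n. \<integral>x. (v x - min (v x) (real n)) \<partial>lebesgue) \<longlonglongrightarrow> 0" by simp
  then have "\<forall>\<^sub>F n in sequentially. (\<integral>x. (v x - min (v x) (real n)) \<partial>lebesgue) < e/2"
    by (rule order_tendstoD) (use e in auto)
  then obtain N :: nat where N: "(\<integral>x. (v x - min (v x) (real N)) \<partial>lebesgue) < e/2"
    using eventually_happens by fastforce
  show thesis
  proof
    \<comment> \<open>Half of e is left for the truncated part; N + 1 keeps the denominator positive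
      when N is 0.\<close>
    show "e / (2 * (real N + 1)) > 0" using e by simp
  next
    fix A assume A: "A \<subseteq> S" "A \<in> lmeasurable" "measure lebesgue A < e / (2 * (real N + 1))"
    have i1: "integrable lebesgue (\<lambda>x. v x - min (v x) (real N))"
    proof (rule Bochner_Integration.integrable_bound[OF v])
      show "AE x in lebesgue. norm (v x - min (v x) (real N)) \<le> norm (v x)"
        using v_nn by (auto simp: min_def)
    qed (use vm in auto)
    have i2: "integrable lebesgue (\<lambda>x. real N * indicator A x)"
      using A(2) by (auto simp: lmeasurable_iff_integrable)
    have iA: "integrable lebesgue (\<lambda>x. indicator A x * v x)"
      using integrable_mult_indicator[OF _ v, of A] A(2) by auto
    have "integral A (\<lambda>x. \<bar>w x\<bar>) = (LINT x:A|lebesgue. v x)"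
      using iA A(1) by (subst set_lebesgue_integral_eq_integral)
        (auto simp: set_integrable_def v_def intro!: HK_cong)
    also have "\<dots> = (\<integral>x. indicator A x * v x \<partial>lebesgue)" by (simp add: set_lebesgue_integral_def)
    also have "\<dots> \<le> (\<integral>x. (v x - min (v x) (real N)) + real N * indicator A x \<partial>lebesgue)"
    proof (rule integral_mono[OF iA])
      show "indicator A x * v x \<le> (v x - min (v x) (real N)) + real N * indicator A x" for x
        by (auto simp: indicator_def v_def min_def)
    qed (use i1 i2 in auto)
    also have "\<dots> = (\<integral>x. (v x - min (v x) (real N)) \<partial>lebesgue) + real N * measure lebesgue A"
      using i1 i2 by (subst Bochner_Integration.integral_add) auto
    also have "real N * measure lebesgue A \<le> (real N+1) * (e / (2 * (real N + 1)))"
      using A(3) by (intro mult_mono) auto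
    also have "\<dots> = e/2" by (simp add: field_simps)
    finally show "integral A (\<lambda>x. \<bar>w x\<bar>) < e" using N by linarith
  qed
qed

text \<open>By Vitali, disjoint short intervals with mean value above q cover almost all of the set
  and lie in an open U barely larger than G, the set where g is below p. Over a finite union N of
  them the integral of g - q is nonnegative. Its part over G is at most -\<eta> times the measure,
  and its part over N - G is below e \<eta> by absolute continuity of the integral. So N \<inter> G
  has measure at most e.\<close>

lemma upper_density_negligible:
  fixes g :: "real \<Rightarrow> real"
  assumes g: "g absolutely_integrable_on {a..b}" and pq: "p < q"
  shows "negligible {x\<in>{a<..<b}. g x < p \<and>
    (\<forall>d>0. \<exists>u v. a < u \<and> v < b \<and> u \<le> x \<and> x \<le> v \<and> u < v \<and> v - u < d \<and> integral {u..v} g > q * (v - u))}"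
    (is "negligible ?E")
  unfolding negligible_outer_le
proof (intro allI impI)
  fix e :: real assume e: "e > 0"
  define w where "w x = g x - q" for x
  define \<eta> where "\<eta> = q - p"
  have \<eta>: "\<eta> > 0" using pq by (simp add: \<eta>_def)
  have w: "w absolutely_integrable_on {a..b}"
    unfolding w_def using g
    by (rule set_integral_diff) (auto intro!: absolutely_integrable_on_const)
  obtain d where d: "d > 0" "\<And>A. \<lbrakk>A \<subseteq> {a..b}; A \<in> lmeasurable; measure lebesgue A < d\<rbrakk> \<Longrightarrow> integral A (\<lambda>x. \<bar>w x\<bar>) < e * \<eta>"
    using absolutely_integrable_small_sets[OF w, of "e*\<eta>"] e \<eta> by auto
  define G where "G = {x\<in>{a<..<b}. g x < p}"
  have "g absolutely_integrable_on {a<..<b}"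
    using set_integrable_subset[OF g, of "{a<..<b}"] by (simp add: subset_iff)
  then have gm: "g \<in> borel_measurable (lebesgue_on {a<..<b})"
    using absolutely_integrable_measurable[of "{a<..<b}" g] by auto
  have Gs: "G \<in> sets lebesgue"
  proof -
    have "{x\<in>space (lebesgue_on {a<..<b}). g x < p} \<in> sets (lebesgue_on {a<..<b})"
      using gm by measurable
    moreover have "{x\<in>space (lebesgue_on {a<..<b}). g x < p} = G" by (auto simp: G_def)
    ultimately show ?thesis by (simp add: sets_restrict_space_iff)
  qed
  have Gl: "G \<in> lmeasurable"
    by (rule bounded_set_imp_lmeasurable[OF _ Gs]) (auto simp: G_def intro: bounded_subset[of "{a<..<b}"])
  obtain U where U: "open U" "G \<subseteq> U" "(U - G) \<in> lmeasurable" "emeasure lebesgue (U - G) < ennreal d"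
    using sets_lebesgue_outer_open[OF Gs d(1)] by auto
  define I :: "real \<times> real \<Rightarrow> real set" where "I i = {fst i..snd i}" for i
  \<comment> \<open>The covering theorem speaks of closed balls; an interval containing x off-centre
    is a ball about its own midpoint.\<close>
  have cball: "cball ((fst i + snd i)/2) ((snd i - fst i)/2) = I i" for i :: "real \<times> real"
    by (simp add: cball_eq_atLeastAtMost I_def field_simps)
  define K where "K = {(u,v). a < u \<and> v < b \<and> u < v \<and> {u..v} \<subseteq> U \<and> q * (v - u) < integral {u..v} g}"
  obtain C where C: "countable C" "C \<subseteq> K"
     "pairwise (\<lambda>i j. disjnt (I i) (I j)) C"
     "negligible (?E - (\<Union>i \<in> C. I i))"
  proof (rule Vitali_covering_theorem_cballs[of K "\<lambda>i. (snd i - fst i)/2" ?E "\<lambda>i. (fst i + snd i)/2", unfolded cball])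
    show "0 < (snd i - fst i)/2" if "i \<in> K" for i using that by (auto simp: K_def)
    fix x and d :: real assume x: "x \<in> ?E" and "0 < d"
    then have "x \<in> U" using U(2) by (auto simp: G_def)
    then obtain r where r: "r > 0" "ball x r \<subseteq> U" using U(1) openE by blast
    obtain u v where uv: "a < u" "v < b" "u \<le> x" "x \<le> v" "u < v" "v - u < min r d" "integral {u..v} g > q * (v - u)"
      using x r(1) \<open>0 < d\<close> by (auto dest!: spec[of _ "min r d"])
    have "{u..v} \<subseteq> ball x r" using uv by (auto simp: dist_real_def)
    then have "(u,v) \<in> K" using uv r by (auto simp: K_def)
    then show "\<exists>i. i \<in> K \<and> x \<in> I i \<and> (snd i - fst i)/2 < d"
      using uv \<open>0 < d\<close> by (intro exI[of _ "(u,v)"]) (auto simp: I_def)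
  qed (use that in blast)
  have fin: "measure lebesgue (\<Union>i\<in>F. G \<inter> I i) \<le> e" if F: "F \<subseteq> C" "finite F" for F
  proof -
    define N where "N = (\<Union>i\<in>F. I i)"
    have Nc: "closed N" unfolding N_def I_def using F by auto
    have Nab: "N \<subseteq> {a..b}" using F C(2) by (auto simp: N_def I_def K_def)
    have NU: "N \<subseteq> U" using F C(2) by (fastforce simp: N_def I_def K_def)
    have Nl: "N \<in> lmeasurable"
      by (metis Nab Nc bounded_closed_interval bounded_subset compact_eq_bounded_closed lmeasurable_compact)
    have wN: "w absolutely_integrable_on N" using set_integrable_subset[OF w _ Nab] Nl by auto
    have wNG: "w absolutely_integrable_on N \<inter> G" "w absolutely_integrable_on N - G"
      using set_integrable_subset[OF wN] Nl Gl by auto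
    have "(w has_integral (\<Sum>S\<in>I ` F. integral S w)) (\<Union>(I ` F))"
    proof (rule has_integral_Union)
      show "finite (I ` F)" using F by simp
      show "(w has_integral integral S w) S" if "S \<in> I ` F" for S
      proof -
        have "S \<subseteq> {a..b}" "S \<in> sets lebesgue" using that Nab by (auto simp: I_def N_def)
        then show ?thesis using set_integrable_subset[OF w]
          by (blast intro: integrable_integral set_lebesgue_integral_eq_integral(1))
      qed
      show "pairwise (\<lambda>S S'. negligible (S \<inter> S')) (I ` F)"
        using C(3) F(1) unfolding pairwise_def disjnt_def by (metis imageE negligible_empty subsetD)
    qed
    then have "integral N w = (\<Sum>S\<in>I ` F. integral S w)" by (simp add: N_def integral_unique)
    also have "\<dots> \<ge> 0"
    proof (rule sum_nonneg)
      fix S assume "S \<in> I ` F"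
      then obtain u v where S: "S = {u..v}" and uv: "(u,v) \<in> K" using F C by (force simp: I_def)
      have "g absolutely_integrable_on {u..v}"
        using uv by (intro absolutely_integrable_on_subinterval[OF g]) (auto simp: K_def)
      then have "integral {u..v} w = integral {u..v} g - integral {u..v} (\<lambda>x. q)"
        unfolding w_def by (intro HK_diff) (auto simp: set_lebesgue_integral_eq_integral(1))
      also have "\<dots> \<ge> 0" using uv by (auto simp: K_def mult.commute)
      finally show "integral S w \<ge> 0" by (simp add: S)
    qed
    finally have "0 \<le> integral N w" .
    also have "integral N w = integral (N \<inter> G \<union> (N - G)) w" by (simp add: Int_Diff_Un)
    also have "\<dots> = integral (N \<inter> G) w + integral (N - G) w"
      using wNG by (intro HK_Un) (auto simp: set_lebesgue_integral_eq_integral(1) intro: negligible_subset[OF negligible_empty])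
    also have "integral (N \<inter> G) w \<le> integral (N \<inter> G) (\<lambda>x. - \<eta>)"
    proof (rule integral_le)
      show "w integrable_on N \<inter> G" using wNG set_lebesgue_integral_eq_integral(1) by blast
      show "(\<lambda>x. - \<eta>) integrable_on N \<inter> G" using Nl Gl by (intro integrable_on_const) (auto intro: fmeasurable.Int)
    qed (auto simp: G_def w_def \<eta>_def)
    also have "integral (N \<inter> G) (\<lambda>x. - \<eta>) = - \<eta> * measure lebesgue (N \<inter> G)"
      by (simp only: lmeasure_integral[OF fmeasurable.Int[OF Nl Gl]]
          integral_mult_right[of "N \<inter> G" "-\<eta>" "\<lambda>x. 1", symmetric] mult_1_right)
    also have "integral (N - G) w \<le> integral (N - G) (\<lambda>x. \<bar>w x\<bar>)"
    proof (rule integral_le)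
      show "w integrable_on N - G" using wNG set_lebesgue_integral_eq_integral(1) by blast
      show "(\<lambda>x. \<bar>w x\<bar>) integrable_on N - G" using wNG(2) by (simp add: absolutely_integrable_on_def)
    qed simp
    also have "\<dots> < e * \<eta>"
    proof (rule d(2))
      have "measure lebesgue (N - G) \<le> measure lebesgue (U - G)"
        using NU Nl Gl U(3) by (intro measure_mono_fmeasurable) auto
      also have "\<dots> < d" using U(4) d(1) emeasure_eq_measure2[OF U(3)] by (simp add: ennreal_less_iff)
      finally show "measure lebesgue (N - G) < d" .
    qed (use Nab Nl Gl in auto)
    finally have "\<eta> * measure lebesgue (N \<inter> G) \<le> \<eta> * e" by (simp add: mult.commute)
    then have "measure lebesgue (N \<inter> G) \<le> e" using \<eta> by simp
    moreover have "N \<inter> G = (\<Union>i\<in>F. G \<inter> I i)" by (auto simp: N_def)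
    ultimately show ?thesis by simp
  qed
  \<comment> \<open>The bound is uniform over finite subfamilies, so it passes to the countable
    union by exhaustion.\<close>
  define D where "D = (\<lambda>i. G \<inter> I i) ` C"
  have D: "countable D" "\<And>d. d \<in> D \<Longrightarrow> d \<in> lmeasurable"
    using C(1) Gl by (auto simp: D_def I_def intro: fmeasurable.Int)
  have finD: "measure lebesgue (\<Union>D') \<le> e" if D': "D' \<subseteq> D" "finite D'" for D'
  proof -
    obtain F where "F \<subseteq> C" "finite F" "D' = (\<lambda>i. G \<inter> I i) ` F"
      using finite_subset_image[OF D'(2) D'(1)[unfolded D_def]] by blast
    then show ?thesis using fin[of F] by (simp only: )
  qed
  have UD: "\<Union>D \<in> lmeasurable" "measure lebesgue (\<Union>D) \<le> e"
  proof -
    show "\<Union>D \<in> lmeasurable"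
      by (rule fmeasurableI2[OF Gl]) (use D C(1) Gs in \<open>auto simp: D_def I_def intro!: sets.Int sets.countable_UN''\<close>)
    show "measure lebesgue (\<Union>D) \<le> e"
    proof (rule field_le_epsilon)
      fix e' :: real assume "e' > 0"
      then obtain D' where D': "D' \<subseteq> D" "finite D'" "measure lebesgue (\<Union>D) - e' < measure lebesgue (\<Union>D')"
        using measure_countable_Union_approachable[OF D(1) _ D(2) finD, of e'] by blast
      then show "measure lebesgue (\<Union>D) \<le> e + e'" using finD[OF D'(1,2)] by linarith
    qed
  qed
  show "\<exists>T. ?E \<subseteq> T \<and> T \<in> lmeasurable \<and> measure lebesgue T \<le> e"
  proof (intro exI conjI)
    define Z where "Z = ?E - (\<Union>i \<in> C. I i)"
    show "?E \<subseteq> \<Union>D \<union> Z" by (auto simp: Z_def D_def G_def)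
    have Z: "Z \<in> lmeasurable" "measure lebesgue Z = 0"
      using C(4) negligible_iff_measure unfolding Z_def by auto
    show "\<Union>D \<union> Z \<in> lmeasurable" using UD Z by auto
    show "measure lebesgue (\<Union>D \<union> Z) \<le> e"
      using UD Z measure_Un_le[of "\<Union>D" lebesgue Z] by auto
  qed
qed


text \<open>Rationals p < r between g x and q reduce all pairs (g x, q) to countably many
  exceptional sets. The intervals only have to contain x, so that x may also be an endpoint.\<close>

lemma upper_derivative_le:
  fixes g :: "real \<Rightarrow> real"
  assumes g: "g absolutely_integrable_on {a..b}"
  obtains N where "negligible N" "\<And>x q. \<lbrakk>x \<in> {a<..<b}; x \<notin> N; g x < q\<rbrakk> \<Longrightarrow>
    \<exists>d>0. \<forall>u v. a < u \<and> v < b \<and> u \<le> x \<and> x \<le> v \<and> u < v \<and> v - u < d \<longrightarrow> integral {u..v} g \<le> q * (v - u)"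
proof
  define E where "E p q = {x\<in>{a<..<b}. g x < p \<and>
    (\<forall>d>0. \<exists>u v. a < u \<and> v < b \<and> u \<le> x \<and> x \<le> v \<and> u < v \<and> v - u < d \<and> integral {u..v} g > q * (v - u))}" for p q
  define N where "N = (\<Union>p\<in>\<rat>. \<Union>q\<in>{q\<in>\<rat>. p < q}. E p q)"
  show "negligible N"
    unfolding N_def
    by (intro negligible_countable_Union countable_image countable_rat countable_Collect ballI)
      (auto intro!: negligible_countable_Union countable_image countable_Collect countable_rat
            upper_density_negligible[OF g, folded E_def])
  fix x q assume x: "x \<in> {a<..<b}" "x \<notin> N" "g x < q"
  obtain p where p: "p \<in> \<rat>" "g x < p" "p < q" using Rats_dense_in_real x(3) by blast
  obtain r where r: "r \<in> \<rat>" "p < r" "r < q" using Rats_dense_in_real p by blast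
  have "x \<notin> E p r" using x(2) p r by (auto simp: N_def)
  then obtain d where d: "d > 0" "\<And>u v. \<lbrakk>a < u; v < b; u \<le> x; x \<le> v; u < v; v - u < d\<rbrakk> \<Longrightarrow> integral {u..v} g \<le> r * (v - u)"
    using x(1) p(2) unfolding E_def mem_Collect_eq not_less[symmetric] by blast
  have "integral {u..v} g \<le> q * (v - u)" if "a < u" "v < b" "u \<le> x" "x \<le> v" "u < v" "v - u < d" for u v
    using d(2)[OF that] r that by (smt (verit) mult_right_mono)
  then show "\<exists>d>0. \<forall>u v. a < u \<and> v < b \<and> u \<le> x \<and> x \<le> v \<and> u < v \<and> v - u < d \<longrightarrow> integral {u..v} g \<le> q * (v - u)"
    using d(1) by blast
qed

text \<open>The upper estimates for g and for -g pin the mean values to within e of g x. Intervals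
  with x as left or right endpoint turn this into bounds for both one-sided difference quotients of
  the primitive.\<close>

lemma Lebesgue_differentiation_real:
  fixes g :: "real \<Rightarrow> real"
  assumes g: "g absolutely_integrable_on {a..b}"
  obtains N where "negligible N"
    "\<And>x. \<lbrakk>x \<in> {a<..<b}; x \<notin> N\<rbrakk> \<Longrightarrow> ((\<lambda>y. integral {a..y} g) has_vector_derivative g x) (at x)"
proof -
  obtain N1 where N1: "negligible N1" "\<And>x q. \<lbrakk>x \<in> {a<..<b}; x \<notin> N1; g x < q\<rbrakk> \<Longrightarrow>
    \<exists>d>0. \<forall>u v. a < u \<and> v < b \<and> u \<le> x \<and> x \<le> v \<and> u < v \<and> v - u < d \<longrightarrow> integral {u..v} g \<le> q * (v - u)"
    using upper_derivative_le[OF g] by metis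
  have g': "(\<lambda>x. - g x) absolutely_integrable_on {a..b}" using set_integrable_mult_right[of "-1", OF g] by simp
  obtain N2 where N2: "negligible N2" "\<And>x q. \<lbrakk>x \<in> {a<..<b}; x \<notin> N2; - g x < q\<rbrakk> \<Longrightarrow>
    \<exists>d>0. \<forall>u v. a < u \<and> v < b \<and> u \<le> x \<and> x \<le> v \<and> u < v \<and> v - u < d \<longrightarrow> integral {u..v} (\<lambda>x. - g x) \<le> q * (v - u)"
    using upper_derivative_le[OF g'] by metis
  have gi: "g integrable_on {a..b}" using g set_lebesgue_integral_eq_integral(1) by blast
  show thesis
  proof
    show "negligible (N1 \<union> N2)" using N1 N2 by simp
    fix x assume x: "x \<in> {a<..<b}" "x \<notin> N1 \<union> N2"
    show "((\<lambda>y. integral {a..y} g) has_vector_derivative g x) (at x)"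
      unfolding has_vector_derivative_def has_derivative_within_alt2
    proof (intro conjI allI impI)
      show "bounded_linear (\<lambda>h. h *\<^sub>R g x)" by (rule bounded_linear_scaleR_left)
      fix e :: real assume e: "e > 0"
      obtain d1 where d1: "d1 > 0" "\<And>u v. \<lbrakk>a < u; v < b; u \<le> x; x \<le> v; u < v; v - u < d1\<rbrakk> \<Longrightarrow> integral {u..v} g \<le> (g x + e) * (v - u)"
        using N1(2)[of x "g x + e"] x e by auto
      obtain d2 where d2: "d2 > 0" "\<And>u v. \<lbrakk>a < u; v < b; u \<le> x; x \<le> v; u < v; v - u < d2\<rbrakk> \<Longrightarrow> - integral {u..v} g \<le> (- g x + e) * (v - u)"
        using N2(2)[of x "- g x + e"] x e by auto
      have bd: "\<bar>integral {u..v} g - (v - u) * g x\<bar> \<le> e * (v - u)"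
        if "a < u" "v < b" "u \<le> x" "x \<le> v" "u < v" "v - u < min d1 d2" for u v
        using d1(2)[of u v] d2(2)[of u v] that by (auto simp: algebra_simps abs_le_iff)
      have *: "norm (integral {a..y} g - integral {a..x} g - (y - x) *\<^sub>R g x) \<le> e * norm (y - x)"
        if y: "a < y" "y < b" "\<bar>y - x\<bar> < min d1 d2" for y
      proof (cases y x rule: linorder_cases)
        case less
        have "integral {a..y} g + integral {y..x} g = integral {a..x} g"
          using less x y by (intro HK_combine integrable_subinterval_real[OF gi]) auto
        then have eq: "integral {a..y} g - integral {a..x} g = - integral {y..x} g" by simp
        show ?thesis unfolding eq using bd[of y x] less x y by (auto simp: abs_if algebra_simps split: if_splits)
      next
        case greater
        have "integral {a..x} g + integral {x..y} g = integral {a..y} g"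
          using greater x y by (intro HK_combine integrable_subinterval_real[OF gi]) auto
        then have eq: "integral {a..y} g - integral {a..x} g = integral {x..y} g" by simp
        show ?thesis unfolding eq using bd[of x y] greater x y by (auto simp: algebra_simps)
      qed auto
      have "\<forall>\<^sub>F y in at x. y \<in> {a<..<b} \<inter> ball x (min d1 d2)"
        using x d1(1) d2(1) by (intro eventually_at_topological[THEN iffD2] exI[of _ "{a<..<b} \<inter> ball x (min d1 d2)"]) auto
      then show "\<forall>\<^sub>F y in at x. norm (integral {a..y} g - integral {a..x} g - (y - x) *\<^sub>R g x) \<le> e * norm (y - x)"
        by eventually_elim (use * in \<open>auto simp: dist_real_def abs_minus_commute\<close>)
    qed
  qed
qed

section \<open>Primitives and their differentiability almost everywhere\<close>

definition antideriv_on :: "real set \<Rightarrow> (real \<Rightarrow> 'b::euclidean_space) \<Rightarrow> (real \<Rightarrow> 'b) \<Rightarrow> bool" where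
  "antideriv_on S f g \<longleftrightarrow> (\<forall>x y. x \<le> y \<and> {x..y} \<subseteq> S \<longrightarrow>
     g absolutely_integrable_on {x..y} \<and> f y - f x = integral {x..y} g)"

lemma antideriv_onD:
  assumes "antideriv_on S f g" "x \<le> y" "{x..y} \<subseteq> S"
  shows "g absolutely_integrable_on {x..y}" "g integrable_on {x..y}" "integral {x..y} g = f y - f x"
  using assms by (auto simp: antideriv_on_def set_lebesgue_integral_eq_integral(1))

lemma antideriv_on_subset: "antideriv_on S f g \<Longrightarrow> T \<subseteq> S \<Longrightarrow> antideriv_on T f g"
  unfolding antideriv_on_def by blast

lemma antideriv_on_component:
  assumes "antideriv_on S f g"
  shows "antideriv_on S (\<lambda>x. f x \<bullet> i) (\<lambda>x. g x \<bullet> i)"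
  unfolding antideriv_on_def
proof (intro allI impI conjI)
  fix x y assume xy: "x \<le> y \<and> {x..y} \<subseteq> S"
  note * = antideriv_onD[OF assms, of x y]
  show "(\<lambda>x. g x \<bullet> i) absolutely_integrable_on {x..y}"
    using absolutely_integrable_linear[OF *(1) bounded_linear_inner_left[of i]] xy by (simp add: o_def)
  show "f y \<bullet> i - f x \<bullet> i = integral {x..y} (\<lambda>x. g x \<bullet> i)"
    using integral_linear[OF *(2) bounded_linear_inner_left[of i]] *(3) xy
    by (simp add: o_def inner_diff_left)
qed

lemma antideriv_on_componentI:
  assumes "\<And>i. i \<in> Basis \<Longrightarrow> antideriv_on S (\<lambda>x. f x \<bullet> i) (\<lambda>x. g i x)"
  shows "antideriv_on S f (\<lambda>x. \<Sum>i\<in>Basis. g i x *\<^sub>R i)"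
  unfolding antideriv_on_def
proof (intro allI impI conjI)
  fix x y assume xy: "x \<le> y \<and> {x..y} \<subseteq> S"
  have *: "(\<lambda>x. g i x *\<^sub>R i) absolutely_integrable_on {x..y}" if "i \<in> Basis" for i
    using absolutely_integrable_linear[OF antideriv_onD(1)[OF assms[OF that]] bounded_linear_scaleR_left[of i]] xy
    by (simp add: o_def)
  show "(\<lambda>x. \<Sum>i\<in>Basis. g i x *\<^sub>R i) absolutely_integrable_on {x..y}"
    using * by (rule absolutely_integrable_sum[OF finite_Basis])
  have "integral {x..y} (\<lambda>x. \<Sum>i\<in>Basis. g i x *\<^sub>R i) = (\<Sum>i\<in>Basis. integral {x..y} (\<lambda>x. g i x *\<^sub>R i))"
    by (intro HK_sum finite_Basis) (use * set_lebesgue_integral_eq_integral(1) in blast)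
  also have "\<dots> = (\<Sum>i\<in>Basis. ((f y - f x) \<bullet> i) *\<^sub>R i)"
  proof (rule sum.cong[OF refl])
    fix i :: 'a assume "i \<in> Basis"
    then show "integral {x..y} (\<lambda>x. g i x *\<^sub>R i) = ((f y - f x) \<bullet> i) *\<^sub>R i"
      using integral_linear[OF antideriv_onD(2)[OF assms] bounded_linear_scaleR_left[of i]]
        antideriv_onD(3)[OF assms] xy by (simp add: o_def inner_diff_left)
  qed
  finally show "f y - f x = integral {x..y} (\<lambda>x. \<Sum>i\<in>Basis. g i x *\<^sub>R i)" by (simp add: euclidean_representation)
qed

text \<open>Componentwise Lebesgue differentiation on compact intervals. Those with rational
  endpoints already exhaust the open set, so only countably many null sets are collected.\<close>

lemma antideriv_on_has_vector_derivative:
  assumes "open U" "antideriv_on U f g"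
  shows "negligible {x\<in>U. \<not> (f has_vector_derivative g x) (at x)}"
proof -
  have 1: "\<exists>N. negligible N \<and> (\<forall>x\<in>{a<..<b} - N. (f has_vector_derivative g x) (at x))" if ab: "a \<le> b" "{a..b} \<subseteq> U" for a b
  proof -
    have "\<exists>N. negligible N \<and> (\<forall>x\<in>{a<..<b} - N. ((\<lambda>x. f x \<bullet> i) has_vector_derivative g x \<bullet> i) (at x))" for i
    proof -
      note comp = antideriv_on_component[OF assms(2), of i]
      obtain N where N: "negligible N"
        "\<And>x. \<lbrakk>x \<in> {a<..<b}; x \<notin> N\<rbrakk> \<Longrightarrow> ((\<lambda>y. integral {a..y} (\<lambda>x. g x \<bullet> i)) has_vector_derivative g x \<bullet> i) (at x)"
        using Lebesgue_differentiation_real[OF antideriv_onD(1)[OF comp ab]] by metis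
      have "((\<lambda>x. f x \<bullet> i) has_vector_derivative g x \<bullet> i) (at x)" if x: "x \<in> {a<..<b} - N" for x
      proof (rule has_vector_derivative_transform_within_open)
        show "((\<lambda>y. f a \<bullet> i + integral {a..y} (\<lambda>x. g x \<bullet> i)) has_vector_derivative g x \<bullet> i) (at x)"
          using N(2)[of x] x by (auto intro!: derivative_eq_intros)
        fix y assume "y \<in> {a<..<b}"
        then show "f a \<bullet> i + integral {a..y} (\<lambda>x. g x \<bullet> i) = f y \<bullet> i"
          using antideriv_onD(3)[OF comp, of a y] ab by (auto simp: subset_iff)
      qed (use x in auto)
      then show ?thesis using N(1) by blast
    qed
    then obtain N where N: "\<And>i. negligible (N i)"
       "\<And>i x. x\<in>{a<..<b} - N i \<Longrightarrow> ((\<lambda>x. f x \<bullet> i) has_vector_derivative g x \<bullet> i) (at x)" by metis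
    show ?thesis
    proof (intro exI conjI ballI)
      show "negligible (\<Union>i\<in>Basis. N i)" using N(1) by (intro negligible_Union) auto
      fix x assume "x \<in> {a<..<b} - (\<Union>i\<in>Basis. N i)"
      then have "\<forall>i\<in>Basis. ((\<lambda>x. f x \<bullet> i) has_vector_derivative g x \<bullet> i) (at x)" using N(2) by blast
      then show "(f has_vector_derivative g x) (at x)"
        unfolding has_vector_derivative_def
        by (subst has_derivative_componentwise_within) (simp add: inner_scaleR_left)
    qed
  qed
  then have "\<forall>a b. \<exists>N. negligible N \<and> (a \<le> b \<longrightarrow> {a..b} \<subseteq> U \<longrightarrow> (\<forall>x\<in>{a<..<b} - N. (f has_vector_derivative g x) (at x)))"
    by (metis negligible_empty)
  then obtain N where N: "\<And>a b. negligible (N a b)"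
     "\<And>a b x. \<lbrakk>a \<le> b; {a..b} \<subseteq> U; x \<in> {a<..<b} - N a b\<rbrakk> \<Longrightarrow> (f has_vector_derivative g x) (at x)"
    by metis
  have "negligible (\<Union>(a,b)\<in>\<rat>\<times>\<rat>. N a b)"
    using N(1) by (intro negligible_countable_Union countable_image countable_SIGMA countable_rat) auto
  moreover have "{x\<in>U. \<not> (f has_vector_derivative g x) (at x)} \<subseteq> (\<Union>(a,b)\<in>\<rat>\<times>\<rat>. N a b)"
  proof clarify
    fix x assume x: "x \<in> U" "\<not> (f has_vector_derivative g x) (at x)"
    obtain r where r: "r > 0" "ball x r \<subseteq> U" using assms(1) x(1) openE by blast
    obtain p where p: "p \<in> \<rat>" "x - r < p" "p < x" using Rats_dense_in_real[of "x-r" x] r by auto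
    obtain q where q: "q \<in> \<rat>" "x < q" "q < x + r" using Rats_dense_in_real[of x "x+r"] r by auto
    have "{p..q} \<subseteq> ball x r" using p q by (auto simp: dist_real_def)
    then have "x \<in> N p q" using N(2)[of p q x] x(2) p q r by auto
    then show "x \<in> (\<Union>(a,b)\<in>\<rat>\<times>\<rat>. N a b)" using p q by auto
  qed
  ultimately show ?thesis by (rule negligible_subset)
qed

section \<open>Functions with integrably bounded increments\<close>

text \<open>Half-open intervals are stable under intersection, generate the Borel sets and have
  finite measure, so they determine the sum of M and N. The sum is set up as a measure S of its own
  in order to apply the uniqueness theorem.\<close>

lemma emeasure_add_eq_of_intervals:
  fixes M N D :: "real measure"
  assumes sets: "sets M = sets borel" "sets N = sets borel" "sets D = sets borel"
    and Ioc: "\<And>u v. u \<le> v \<Longrightarrow> emeasure M {u<..v} + emeasure N {u<..v} = emeasure D {u<..v}"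
    and fin: "\<And>u v. emeasure D {u<..v} \<noteq> \<infinity>"
    and A: "A \<in> sets borel"
  shows "emeasure M A + emeasure N A = emeasure D A"
proof -
  define S where "S = measure_of UNIV (sets borel) (\<lambda>A. emeasure M A + emeasure N A)"
  have S: "emeasure S A = emeasure M A + emeasure N A" if "A \<in> sets borel" for A
    unfolding S_def
  proof (rule emeasure_measure_of_sigma[OF _ _ _ that])
    show "sigma_algebra UNIV (sets borel)" using sets.sigma_algebra_axioms[of borel] by simp
    show "positive (sets borel) (\<lambda>A. emeasure M A + emeasure N A)" by (simp add: positive_def)
    show "countably_additive (sets borel) (\<lambda>A. emeasure M A + emeasure N A)"
      unfolding countably_additive_def
    proof (intro allI impI)
      fix B :: "nat \<Rightarrow> real set" assume B: "range B \<subseteq> sets borel" "disjoint_family B"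
      have "(\<Sum>i. emeasure M (B i) + emeasure N (B i)) = (\<Sum>i. emeasure M (B i)) + (\<Sum>i. emeasure N (B i))"
        by (intro suminf_add[symmetric]) auto
      also have "\<dots> = emeasure M (\<Union>i. B i) + emeasure N (\<Union>i. B i)"
        using B sets by (intro arg_cong2[where f="(+)"] suminf_emeasure) auto
      finally show "(\<Sum>i. emeasure M (B i) + emeasure N (B i)) = emeasure M (\<Union>i. B i) + emeasure N (\<Union>i. B i)" .
    qed
  qed
  have "S = D"
  proof (rule measure_eqI_generator_eq[where E="range (\<lambda>(u,v). {u<..v::real})" and \<Omega>=UNIV and A="\<lambda>n. {- real n<..real n}"])
    show "Int_stable (range (\<lambda>(u,v). {u<..v::real}))"
      by (auto simp: Int_stable_def Int_greaterThanAtMost image_iff)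
    have Ssets: "sets S = sets borel"
      unfolding S_def using sets.sigma_algebra_axioms[of "borel :: real measure"]
      by (simp add: sigma_algebra.sigma_sets_eq)
    show "sets S = sigma_sets UNIV (range (\<lambda>(u,v). {u<..v::real}))"
      "sets D = sigma_sets UNIV (range (\<lambda>(u,v). {u<..v::real}))"
      by (simp_all add: Ssets sets borel_sigma_sets_Ioc)
    show "emeasure S X = emeasure D X" if X: "X \<in> range (\<lambda>(u,v). {u<..v::real})" for X
    proof -
      obtain u v where "X = {u<..v}" using X by auto
      then show ?thesis using S[of X] Ioc[of u v] by (cases "u \<le> v") auto
    qed
    show "(\<Union>n. {- real n<..real n}) = UNIV"
    proof (rule set_eqI, simp)
      fix x :: real
      obtain n where "\<bar>x\<bar> < real n" using reals_Archimedean2 by blast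
      then show "\<exists>n. - real n < x \<and> x \<le> real n" by (intro exI[of _ n]) auto
    qed
    show "emeasure S {- real n<..real n} \<noteq> \<infinity>" for n
      using fin[of "- real n" "real n"] S[of "{- real n<..real n}"] Ioc[of "- real n" "real n"] by auto
  qed auto
  then show ?thesis using S[OF A] by simp
qed

text \<open>With H a primitive of h, both H + f and H - f are nondecreasing. Their Stieltjes
  measures add up to the measure with density 2 h, so each vanishes on Lebesgue null sets; a
  Radon-Nikodym density of the first, minus h, is a derivative of f.\<close>

lemma bounded_increments_antideriv_real:
  fixes f h :: "real \<Rightarrow> real"
  assumes ab: "a \<le> b" and h: "h absolutely_integrable_on {a..b}" and h0: "\<And>x. 0 \<le> h x"
    and f: "\<And>u v. \<lbrakk>a \<le> u; u \<le> v; v \<le> b\<rbrakk> \<Longrightarrow> \<bar>f v - f u\<bar> \<le> integral {u..v} h"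
  shows "\<exists>g. antideriv_on {a..b} f g"
proof -
  have hi: "h integrable_on {u..v}" if "a \<le> u" "v \<le> b" for u v
    using absolutely_integrable_on_subinterval[OF h, of u v] that set_lebesgue_integral_eq_integral(1) by auto
  define H where "H x = integral {a..x} h" for x
  have Hd: "H v - H u = integral {u..v} h" if "a \<le> u" "u \<le> v" "v \<le> b" for u v
    using HK_combine[OF that(1,2) hi] that by (simp add: H_def)
  have Hc: "continuous_on {a..b} H"
    unfolding H_def by (rule indefinite_integral_continuous_1[OF hi]) auto
  have fc: "continuous_on {a..b} f"
    unfolding continuous_on_iff
  proof (intro ballI allI impI)
    fix x e :: real assume x: "x \<in> {a..b}" and "e > 0"
    then obtain d where d: "d > 0" "\<And>y. \<lbrakk>y \<in> {a..b}; dist y x < d\<rbrakk> \<Longrightarrow> dist (H y) (H x) < e"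
      using Hc unfolding continuous_on_iff by metis
    have "\<bar>f y - f x\<bar> \<le> \<bar>H y - H x\<bar>" if "y \<in> {a..b}" for y
      using f[of x y] f[of y x] Hd[of x y] Hd[of y x] x that by (cases "x \<le> y") auto
    then have "dist (f y) (f x) < e" if "y \<in> {a..b}" "dist y x < d" for y
      using d(2)[OF that] that by (fastforce simp: dist_real_def)
    then show "\<exists>d>0. \<forall>y\<in>{a..b}. dist y x < d \<longrightarrow> dist (f y) (f x) < e" using d(1) by blast
  qed
  \<comment> \<open>Clamping to the interval extends H and f by constants, since Stieltjes measures
    live on the whole line.\<close>
  define c where "c x = max a (min b x)" for x :: real
  have c: "c x \<in> {a..b}" for x using ab by (auto simp: c_def)
  have c_mono: "c x \<le> c y" if "x \<le> y" for x y using that by (auto simp: c_def)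
  define F where "F s x = H (c x) + s * f (c x)" for s x :: real
  have cc: "continuous_on UNIV c" unfolding c_def by (intro continuous_intros)
  have F_mono: "F s x \<le> F s y" if "\<bar>s\<bar> = 1" "x \<le> y" for s x y
  proof -
    have "\<bar>f (c y) - f (c x)\<bar> \<le> H (c y) - H (c x)"
      using f[of "c x" "c y"] Hd[of "c x" "c y"] c[of x] c[of y] c_mono[OF that(2)] by auto
    moreover have "s = 1 \<or> s = -1" using that(1) by auto
    ultimately show ?thesis unfolding F_def by auto
  qed
  have F_cont: "continuous_on UNIV (F s)" for s
  proof -
    have "continuous_on UNIV (\<lambda>x. H (c x))" "continuous_on UNIV (\<lambda>x. f (c x))"
      using c by (auto intro!: continuous_on_compose2[OF Hc cc] continuous_on_compose2[OF fc cc])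
    then show ?thesis unfolding F_def by (intro continuous_intros)
  qed
  have F_rc: "continuous (at_right x) (F s)" for s x
    using F_cont[of s] by (auto simp: continuous_on_eq_continuous_at continuous_at_imp_continuous_at_within)
  define M where "M s = interval_measure (F s)" for s
  have M_Ioc: "emeasure (M s) {u<..v} = ennreal (F s v - F s u)" if "\<bar>s\<bar> = 1" "u \<le> v" for s u v
    unfolding M_def using emeasure_interval_measure_Ioc[OF that(2) F_mono[OF that(1)] F_rc] by simp
  define k where "k x = indicator {a..b} x * (2 * h x)" for x
  have ki: "integrable lebesgue k"
    using h unfolding set_integrable_def k_def by (simp add: mult.left_commute)
  have km: "(\<lambda>x. ennreal (k x)) \<in> borel_measurable lebesgue" using ki by measurable
  \<comment> \<open>h is only Lebesgue measurable while Stieltjes measures are Borel, hence the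
    transport to the Borel sets.\<close>
  define D where "D = distr (density lebesgue k) borel (\<lambda>x. x)"
  have idm: "(\<lambda>x. x) \<in> measurable (density lebesgue k) borel" by (simp add: measurable_def)
  have D_em: "emeasure D A = (\<integral>\<^sup>+x. ennreal (k x) * indicator A x \<partial>lebesgue)" if "A \<in> sets borel" for A
    unfolding D_def using that idm km
    by (subst emeasure_distr) (auto simp: emeasure_density)
  have D_Ioc: "emeasure D {u<..v} = ennreal (2 * (H (c v) - H (c u)))" if "u \<le> v" for u v
  proof -
    have iv: "{u<..v} \<inter> {a..b} = (if c u \<in> {u<..v} then {c u..c v} else {c u<..c v})"
      using that ab by (auto simp: c_def max_def min_def)
    have kI: "integrable lebesgue (\<lambda>x. k x * indicator {u<..v} x)"
      using integrable_mult_indicator[OF _ ki, of "{u<..v}"] by (simp add: mult.commute)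
    have "emeasure D {u<..v} = (\<integral>\<^sup>+x. ennreal (k x * indicator {u<..v} x) \<partial>lebesgue)"
      by (subst D_em) (auto intro!: nn_integral_cong simp: indicator_def)
    also have "\<dots> = ennreal (\<integral>x. k x * indicator {u<..v} x \<partial>lebesgue)"
      by (rule nn_integral_eq_integral[OF kI]) (auto simp: k_def indicator_def h0)
    also have "(\<integral>x. k x * indicator {u<..v} x \<partial>lebesgue) = (LINT x:{u<..v}|lebesgue. k x)"
      by (simp add: set_lebesgue_integral_def mult.commute)
    also have "\<dots> = integral {u<..v} k"
      using kI by (intro set_lebesgue_integral_eq_integral) (auto simp: set_integrable_def mult.commute)
    also have "\<dots> = integral {c u..c v} (\<lambda>x. 2 * h x)"
    proof -
      have "k = (\<lambda>x. if x \<in> {a..b} then 2 * h x else 0)" by (auto simp: k_def)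
      then have "integral {u<..v} k = integral ({u<..v} \<inter> {a..b}) (\<lambda>x. 2 * h x)"
        by (simp only: HK_restrict_Int Int_commute)
      \<comment> \<open>The two domains differ at most in the point c u.\<close>
      also have "\<dots> = integral {c u..c v} (\<lambda>x. 2 * h x)"
      proof (rule integral_spike_set)
        have "{u<..v} \<inter> {a..b} - {c u..c v} \<subseteq> {}" "{c u..c v} - {u<..v} \<inter> {a..b} \<subseteq> {c u}"
          using that ab by (auto simp: c_def max_def min_def split: if_splits)
        then have "{x \<in> {u<..v} \<inter> {a..b} - {c u..c v}. 2 * h x \<noteq> 0} \<subseteq> {}"
          "{x \<in> {c u..c v} - {u<..v} \<inter> {a..b}. 2 * h x \<noteq> 0} \<subseteq> {c u}" by blast+
        then show "negligible {x \<in> {u<..v} \<inter> {a..b} - {c u..c v}. 2 * h x \<noteq> 0}"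
          "negligible {x \<in> {c u..c v} - {u<..v} \<inter> {a..b}. 2 * h x \<noteq> 0}"
          using negligible_subset negligible_sing negligible_empty by metis+
      qed
      finally show ?thesis .
    qed
    also have "\<dots> = 2 * (H (c v) - H (c u))"
      using Hd[of "c u" "c v"] c[of u] c[of v] c_mono[OF that] by simp
    finally show ?thesis .
  qed
  have sum: "emeasure (M 1) A + emeasure (M (-1)) A = emeasure D A" if "A \<in> sets borel" for A
  proof (rule emeasure_add_eq_of_intervals[OF _ _ _ _ _ that])
    fix u v :: real
    show "emeasure (M 1) {u<..v} + emeasure (M (-1)) {u<..v} = emeasure D {u<..v}" if uv: "u \<le> v"
    proof -
      have "F 1 u \<le> F 1 v" "F (-1) u \<le> F (-1) v" using F_mono uv by auto
      then show ?thesis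
        using uv by (simp add: M_Ioc D_Ioc F_def flip: ennreal_plus)
    qed
    show "emeasure D {u<..v} \<noteq> \<infinity>" by (cases "u \<le> v") (auto simp: D_Ioc)
  qed (auto simp: M_def D_def)
  have ac: "absolutely_continuous lborel (M 1)"
    unfolding absolutely_continuous_def
  proof
    fix A assume "A \<in> null_sets (lborel :: real measure)"
    then have A: "A \<in> sets borel" "A \<in> null_sets lebesgue" by (auto simp: null_sets_completionI)
    have "AE x in lebesgue. ennreal (k x) * indicator A x = 0"
      using AE_not_in[OF A(2)] by eventually_elim auto
    then have "emeasure D A = 0"
      using A(1) nn_integral_cong_AE[where M=lebesgue and u="\<lambda>x. ennreal (k x) * indicator A x" and v="\<lambda>x. 0"] by (simp add: D_em)
    then have "emeasure (M 1) A = 0" using sum[OF A(1)] by simp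
    then show "A \<in> null_sets (M 1)" using A(1) by (auto simp: null_sets_def M_def)
  qed
  obtain \<phi> where \<phi>: "\<phi> \<in> borel_measurable lborel" "density lborel \<phi> = M 1"
    using sigma_finite_measure.Radon_Nikodym[OF sigma_finite_lborel ac] by (auto simp: M_def)
  have fin: "(\<integral>\<^sup>+x. \<phi> x * indicator {u<..v} x \<partial>lborel) = ennreal (F 1 v - F 1 u)" if "u \<le> v" for u v
    using M_Ioc[of 1 u v] \<phi> that emeasure_density[of \<phi> lborel "{u<..v}"] by auto
  \<comment> \<open>\<phi> takes extended values; its integrals over bounded intervals are finite,
    so it is finite almost everywhere and \<open>enn2real\<close> changes it only on a null
    set.\<close>
  define g where "g x = enn2real (\<phi> x)" for x
  have g_int: "g absolutely_integrable_on {u..v} \<and> integral {u..v} g = F 1 v - F 1 u" if "u \<le> v" for u v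
  proof -
    have m: "(\<lambda>x. \<phi> x * indicator {u<..v} x) \<in> borel_measurable lborel" using \<phi> by measurable
    have "AE x in lborel. \<phi> x * indicator {u<..v} x \<noteq> \<infinity>"
      using fin[OF that] by (intro nn_integral_noteq_infinite[OF m]) auto
    then have eq: "AE x in lborel. \<phi> x * indicator {u<..v} x = ennreal (indicator {u<..v} x * g x)"
      by eventually_elim (auto simp: g_def indicator_def ennreal_enn2real_if)
    have "(\<integral>\<^sup>+x. ennreal (indicator {u<..v} x * g x) \<partial>lborel) = ennreal (F 1 v - F 1 u)"
      using fin[OF that] nn_integral_cong_AE[OF eq] by simp
    moreover have gm: "g \<in> borel_measurable lborel"
      unfolding g_def using \<phi>(1) by measurable
    have bm: "(\<lambda>x. indicator {u<..v} x * g x) \<in> borel_measurable lborel"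
      by (intro borel_measurable_times gm borel_measurable_indicator) simp
    ultimately have "has_bochner_integral lborel (\<lambda>x. indicator {u<..v} x * g x) (F 1 v - F 1 u)"
      using bm F_mono[of 1 u v] that by (intro has_bochner_integral_nn_integral) (auto simp: g_def)
    then have hb: "integrable lebesgue (\<lambda>x. indicator {u<..v} x * g x)"
       "(\<integral>x. indicator {u<..v} x * g x \<partial>lebesgue) = F 1 v - F 1 u"
      unfolding has_bochner_integral_iff integrable_completion[OF bm] integral_completion[OF bm] by auto
    have 1: "g absolutely_integrable_on {u<..v}" using hb(1) by (simp add: set_integrable_def)
    have "integral {u<..v} g = F 1 v - F 1 u"
      using set_lebesgue_integral_eq_integral(2)[OF 1] hb(2) by (simp add: set_lebesgue_integral_def)
    note 1 = 1 this
    have "{x \<in> {u<..v} - {u..v}. g x \<noteq> 0} \<subseteq> {}" "{x \<in> {u..v} - {u<..v}. g x \<noteq> 0} \<subseteq> {u}" by auto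
    then have neg: "negligible {x \<in> {u<..v} - {u..v}. g x \<noteq> 0}" "negligible {x \<in> {u..v} - {u<..v}. g x \<noteq> 0}"
      using negligible_subset negligible_sing negligible_empty by metis+
    show ?thesis
      using 1 integral_spike_set[OF neg] absolutely_integrable_spike_set[OF 1(1) neg] by simp
  qed
  have "antideriv_on {a..b} f (\<lambda>x. g x - h x)"
    unfolding antideriv_on_def
  proof (intro allI impI)
    fix x y assume xy: "x \<le> y \<and> {x..y} \<subseteq> {a..b}"
    then have xy': "a \<le> x" "y \<le> b" "x \<le> y" "c x = x" "c y = y" by (auto simp: c_def)
    have 1: "h absolutely_integrable_on {x..y}" using absolutely_integrable_on_subinterval[OF h] xy by blast
    show "(\<lambda>x. g x - h x) absolutely_integrable_on {x..y} \<and> f y - f x = integral {x..y} (\<lambda>x. g x - h x)"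
      using 1 g_int[of x y] xy' Hd[of x y] hi[of x y]
      by (auto simp: F_def set_lebesgue_integral_eq_integral(1) HK_diff)
  qed
  then show ?thesis by blast
qed

section \<open>Local absolute continuity\<close>

lemma antideriv_on_cong_ae:
  assumes "antideriv_on U f g" "negligible {x\<in>U. g x \<noteq> g' x}"
  shows "antideriv_on U f g'"
  unfolding antideriv_on_def
proof (intro allI impI)
  fix x y assume xy: "x \<le> y \<and> {x..y} \<subseteq> U"
  note * = antideriv_onD[OF assms(1), of x y]
  have eq: "g' z = g z" if "z \<in> {x..y} - {x\<in>U. g x \<noteq> g' x}" for z using that xy by auto
  show "g' absolutely_integrable_on {x..y} \<and> f y - f x = integral {x..y} g'"
  proof
    show "g' absolutely_integrable_on {x..y}"
      using xy by (intro absolutely_integrable_spike[OF *(1) assms(2) eq]) auto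
    have "integral {x..y} g = integral {x..y} g'" by (rule integral_spike[OF assms(2) eq])
    then show "f y - f x = integral {x..y} g'" using *(3) xy by simp
  qed
qed

text \<open>The claim for an interval follows from the claims for two adjacent pieces and holds for
  short intervals about each point, so bisection in the form of \<open>Bolzano\<close> yields it for
  all compact intervals.\<close>

lemma antideriv_on_local:
  assumes "\<And>z. z \<in> U \<Longrightarrow> \<exists>e>0. antideriv_on (ball z e) f g"
  shows "antideriv_on U f g"
proof -
  have "g absolutely_integrable_on {x..y} \<and> f y - f x = integral {x..y} g" if "x \<le> y" "{x..y} \<subseteq> U" for x y
    using that(1)
  proof (induction x y rule: Bolzano)
    case (trans p q r)
    then have pr: "g absolutely_integrable_on {p..r}"
      using absolutely_integrable_on_combine by blast
    have "integral {p..q} g + integral {q..r} g = integral {p..r} g"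
      using trans set_lebesgue_integral_eq_integral(1)[OF pr]
      by (intro HK_combine) auto
    moreover have "f r - f p = (f q - f p) + (f r - f q)" by simp
    ultimately show ?case using pr trans by (simp del: diff_add_cancel)
  next
    case (local z)
    then have "z \<in> U" using that by auto
    then obtain e where e: "e > 0" "antideriv_on (ball z e) f g" using assms by blast
    have "g absolutely_integrable_on {p..q} \<and> f q - f p = integral {p..q} g" if "p \<le> z" "z \<le> q" "q - p < e" for p q
    proof -
      have "{p..q} \<subseteq> ball z e" using that by (auto simp: dist_real_def)
      then show ?thesis using antideriv_onD[OF e(2), of p q] that by auto
    qed
    then show ?case using e(1) by blast
  qed
  then show ?thesis by (simp add: antideriv_on_def)
qed

lemma bounded_increments_antideriv:
  fixes f :: "real \<Rightarrow> 'b::euclidean_space"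
  assumes ab: "a \<le> b" and h: "h absolutely_integrable_on {a..b}" and h0: "\<And>x. 0 \<le> h x"
    and f: "\<And>u v. \<lbrakk>a \<le> u; u \<le> v; v \<le> b\<rbrakk> \<Longrightarrow> norm (f v - f u) \<le> integral {u..v} h"
  shows "\<exists>g. antideriv_on {a..b} f g"
proof -
  have "\<exists>g. antideriv_on {a..b} (\<lambda>x. f x \<bullet> i) g" if "i \<in> Basis" for i
  proof (rule bounded_increments_antideriv_real[OF ab h h0])
    fix u v assume "a \<le> u" "u \<le> v" "v \<le> b"
    then show "\<bar>f v \<bullet> i - f u \<bullet> i\<bar> \<le> integral {u..v} h"
      using f[of u v] Basis_le_norm[OF that, of "f v - f u"] by (simp add: inner_diff_left)
  qed
  then obtain g where "\<And>i. i \<in> Basis \<Longrightarrow> antideriv_on {a..b} (\<lambda>x. f x \<bullet> i) (g i)" by metis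
  then show ?thesis using antideriv_on_componentI by blast
qed

text \<open>Absolute continuity near z through a majorant of the increments. No derivative is
  mentioned, so any function whose increments are controlled by those of another inherits
  it.\<close>

definition ac_at :: "(real \<Rightarrow> 'b::euclidean_space) \<Rightarrow> real \<Rightarrow> bool" where
  "ac_at f z \<longleftrightarrow> (\<exists>e>0. \<exists>h. (\<forall>x. 0 \<le> h x) \<and> h absolutely_integrable_on {z-e..z+e} \<and>
     (\<forall>u v. z - e \<le> u \<and> u \<le> v \<and> v \<le> z + e \<longrightarrow> norm (f v - f u) \<le> integral {u..v} h))"

lemma ac_atI:
  assumes "open W" "z \<in> W" "\<And>x. x \<in> W \<Longrightarrow> 0 \<le> h x"
    "\<And>u v. \<lbrakk>u \<le> v; {u..v} \<subseteq> W\<rbrakk> \<Longrightarrow> h absolutely_integrable_on {u..v}"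
    "\<And>u v. \<lbrakk>u \<le> v; {u..v} \<subseteq> W\<rbrakk> \<Longrightarrow> norm (f v - f u) \<le> integral {u..v} h"
  shows "ac_at f z"
proof -
  obtain e where e: "e > 0" "cball z e \<subseteq> W" using assms(1,2) open_contains_cball by blast
  have cb: "cball z e = {z-e..z+e}" by (simp add: cball_eq_atLeastAtMost)
  have 1: "(\<lambda>x. \<bar>h x\<bar>) absolutely_integrable_on {z-e..z+e}"
    using assms(4)[of "z-e" "z+e"] e unfolding cb by (intro set_integrable_abs) auto
  have "norm (f v - f u) \<le> integral {u..v} (\<lambda>x. \<bar>h x\<bar>)" if "z - e \<le> u" "u \<le> v" "v \<le> z + e" for u v
  proof -
    have sub: "{u..v} \<subseteq> W" using that e unfolding cb by auto
    then have "integral {u..v} (\<lambda>x. \<bar>h x\<bar>) = integral {u..v} h"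
      using assms(3) by (intro HK_cong) auto
    then show ?thesis using assms(5)[OF that(2) sub] by simp
  qed
  then show ?thesis unfolding ac_at_def using e(1) 1 by (intro exI[of _ e] exI[of _ "\<lambda>x. \<bar>h x\<bar>"] conjI) auto
qed

lemma antideriv_on_norm_le:
  assumes "antideriv_on U f g" "u \<le> v" "{u..v} \<subseteq> U"
  shows "norm (f v - f u) \<le> integral {u..v} (\<lambda>x. norm (g x))"
  unfolding antideriv_onD(3)[OF assms, symmetric]
  using antideriv_onD(1)[OF assms] by (intro integral_norm_bound_integral) (auto simp: absolutely_integrable_on_def)

lemma antideriv_on_ac_at:
  assumes "open U" "antideriv_on U f g" "z \<in> U"
  shows "ac_at f z"
proof (rule ac_atI[OF assms(1,3)])
  show "(\<lambda>x. norm (g x)) absolutely_integrable_on {u..v}" if "u \<le> v" "{u..v} \<subseteq> U" for u v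
    using antideriv_onD(1)[OF assms(2) that] by (rule set_integrable_norm)
qed (use antideriv_on_norm_le[OF assms(2)] in auto)

text \<open>The density obtained from bounded increments depends on the neighbourhood. It agrees
  almost everywhere with \<open>vector_derivative f (at x)\<close>, which does not, and this common
  choice is what allows local statements to be glued.\<close>

lemma ac_at_local_antideriv:
  fixes f :: "real \<Rightarrow> 'b::euclidean_space"
  assumes "ac_at f z"
  obtains e where "e > 0" "antideriv_on (ball z e) f (\<lambda>x. vector_derivative f (at x))"
proof -
  obtain e h where e: "e > 0" "\<And>x. 0 \<le> h x" "h absolutely_integrable_on {z-e..z+e}"
     "\<And>u v. \<lbrakk>z - e \<le> u; u \<le> v; v \<le> z + e\<rbrakk> \<Longrightarrow> norm (f v - f u) \<le> integral {u..v} h"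
    using assms unfolding ac_at_def by blast
  obtain g where g: "antideriv_on {z-e..z+e} f g"
    using bounded_increments_antideriv[of "z-e" "z+e", OF _ e(3,2,4)] e(1) by auto
  have g': "antideriv_on (ball z e) f g"
    by (rule antideriv_on_subset[OF g]) (auto simp: dist_real_def)
  have "negligible {x\<in>ball z e. g x \<noteq> vector_derivative f (at x)}"
    by (rule negligible_subset[OF antideriv_on_has_vector_derivative[OF open_ball g']])
      (auto dest: vector_derivative_at)
  then show thesis using that[OF e(1)] antideriv_on_cong_ae[OF g', of "\<lambda>x. vector_derivative f (at x)"] by blast
qed

lemma ac_at_antideriv:
  assumes "\<And>z. z \<in> U \<Longrightarrow> ac_at f z"
  shows "antideriv_on U f (\<lambda>x. vector_derivative f (at x))"
  by (rule antideriv_on_local, drule assms, erule ac_at_local_antideriv) blast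

lemma ac_at_cong:
  assumes "ac_at f z" "open W" "z \<in> W" "\<And>x. x \<in> W \<Longrightarrow> f x = f' x"
  shows "ac_at f' z"
proof -
  obtain e where e: "e > 0" "antideriv_on (ball z e) f (\<lambda>x. vector_derivative f (at x))"
    using ac_at_local_antideriv[OF assms(1)] .
  have "antideriv_on (ball z e \<inter> W) f' (\<lambda>x. vector_derivative f (at x))"
    unfolding antideriv_on_def
  proof (intro allI impI)
    fix x y assume xy: "x \<le> y \<and> {x..y} \<subseteq> ball z e \<inter> W"
    then have "x \<in> W" "y \<in> W" by auto
    then show "(\<lambda>x. vector_derivative f (at x)) absolutely_integrable_on {x..y} \<and>
      f' y - f' x = integral {x..y} (\<lambda>x. vector_derivative f (at x))"
      using antideriv_onD[OF e(2), of x y] assms(4) xy by auto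
  qed
  then show ?thesis by (rule antideriv_on_ac_at[rotated]) (use assms e in auto)
qed

lemma ac_at_isCont: "ac_at f z \<Longrightarrow> isCont f z"
proof -
  assume "ac_at f z"
  then obtain e where e: "e > 0" "antideriv_on (ball z e) f (\<lambda>x. vector_derivative f (at x))"
    using ac_at_local_antideriv by blast
  let ?g = "\<lambda>x. vector_derivative f (at x)"
  have sub: "{z-e/2..z+e/2} \<subseteq> ball z e" using e(1) by (auto simp: dist_real_def)
  have "continuous_on {z-e/2..z+e/2} (\<lambda>x. f (z - e/2) + integral {z-e/2..x} ?g)"
    using antideriv_onD(2)[OF e(2) _ sub] e(1)
    by (intro continuous_intros indefinite_integral_continuous_1) auto
  moreover have "f (z - e/2) + integral {z-e/2..x} ?g = f x" if "x \<in> {z-e/2..z+e/2}" for x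
    using antideriv_onD(3)[OF e(2), of "z-e/2" x] that sub by (auto simp: subset_iff)
  ultimately have "continuous_on {z-e/2..z+e/2} f" by (metis (no_types, lifting) continuous_on_cong)
  then show "isCont f z" using e(1) by (intro continuous_on_interior[of "{z-e/2..z+e/2}"]) auto
qed

text \<open>Stated for increments rather than for compositions: a director is not a function of Q,
  but with a consistent sign its increments are controlled by those of Q.\<close>

lemma ac_at_lipschitz_image:
  fixes Q :: "real \<Rightarrow> 'a::euclidean_space" and f :: "real \<Rightarrow> 'b::euclidean_space"
  assumes "ac_at Q z" "open W" "z \<in> W" "\<And>x y. \<lbrakk>x \<in> W; y \<in> W\<rbrakk> \<Longrightarrow> norm (f x - f y) \<le> C * norm (Q x - Q y)"
  shows "ac_at f z"
proof -
  obtain e where e: "e > 0" "antideriv_on (ball z e) Q (\<lambda>x. vector_derivative Q (at x))"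
    using ac_at_local_antideriv[OF assms(1)] .
  let ?q = "\<lambda>x. vector_derivative Q (at x)"
  show ?thesis
  proof (rule ac_atI[of "ball z e \<inter> W" _ "\<lambda>x. \<bar>C\<bar> * norm (?q x)"])
    fix u v assume uv: "u \<le> v" "{u..v} \<subseteq> ball z e \<inter> W"
    have "?q absolutely_integrable_on {u..v}" using antideriv_onD(1)[OF e(2)] uv by auto
    then have ai: "(\<lambda>x. norm (?q x)) absolutely_integrable_on {u..v}" by (rule set_integrable_norm)
    then show "(\<lambda>x. \<bar>C\<bar> * norm (?q x)) absolutely_integrable_on {u..v}" by (intro set_integrable_mult_right) auto
    have "u \<in> W" "v \<in> W" using uv by auto
    then have "norm (f v - f u) \<le> \<bar>C\<bar> * norm (Q v - Q u)"
      using assms(4)[of v u] by (meson abs_ge_self mult_right_mono norm_ge_zero order_trans)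
    also have "\<dots> \<le> \<bar>C\<bar> * integral {u..v} (\<lambda>x. norm (?q x))"
      using antideriv_on_norm_le[OF e(2) uv(1)] uv(2) by (intro mult_left_mono) auto
    finally show "norm (f v - f u) \<le> integral {u..v} (\<lambda>x. \<bar>C\<bar> * norm (?q x))" by simp
  qed (use e assms in auto)
qed

lemma ac_at_Pair:
  assumes "ac_at f z" "ac_at g z"
  shows "ac_at (\<lambda>x. (f x, g x)) z"
proof -
  obtain e1 where e1: "e1 > 0" "antideriv_on (ball z e1) f (\<lambda>x. vector_derivative f (at x))"
    using ac_at_local_antideriv[OF assms(1)] .
  obtain e2 where e2: "e2 > 0" "antideriv_on (ball z e2) g (\<lambda>x. vector_derivative g (at x))"
    using ac_at_local_antideriv[OF assms(2)] .
  let ?f = "\<lambda>x. vector_derivative f (at x)" and ?g = "\<lambda>x. vector_derivative g (at x)"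
  show ?thesis
  proof (rule ac_atI[of "ball z e1 \<inter> ball z e2" _ "\<lambda>x. norm (?f x) + norm (?g x)"])
    fix u v assume uv: "u \<le> v" "{u..v} \<subseteq> ball z e1 \<inter> ball z e2"
    have f: "(\<lambda>x. norm (?f x)) absolutely_integrable_on {u..v}"
      using antideriv_onD(1)[OF e1(2)] uv by (intro set_integrable_norm) auto
    have g: "(\<lambda>x. norm (?g x)) absolutely_integrable_on {u..v}"
      using antideriv_onD(1)[OF e2(2)] uv by (intro set_integrable_norm) auto
    show "(\<lambda>x. norm (?f x) + norm (?g x)) absolutely_integrable_on {u..v}" using f g by (rule set_integral_add)
    have "norm ((f v, g v) - (f u, g u)) \<le> norm (f v - f u) + norm (g v - g u)"
      by (simp add: norm_Pair_le)
    also have "\<dots> \<le> integral {u..v} (\<lambda>x. norm (?f x)) + integral {u..v} (\<lambda>x. norm (?g x))"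
      using antideriv_on_norm_le[OF e1(2) uv(1)] antideriv_on_norm_le[OF e2(2) uv(1)] uv(2)
      by (intro add_mono) auto
    also have "\<dots> = integral {u..v} (\<lambda>x. norm (?f x) + norm (?g x))"
      using f g by (intro HK_add[symmetric]) (auto simp: set_lebesgue_integral_eq_integral(1))
    finally show "norm ((f v, g v) - (f u, g u)) \<le> integral {u..v} (\<lambda>x. norm (?f x) + norm (?g x))" .
  qed (use e1 e2 in auto)
qed

lemma ac_at_bilinear:
  assumes "bounded_bilinear B" "ac_at f z" "ac_at g z"
  shows "ac_at (\<lambda>x. B (f x) (g x)) z"
proof -
  interpret bounded_bilinear B by fact
  obtain K where K: "K \<ge> 0" "\<And>a b. norm (B a b) \<le> norm a * norm b * K" using nonneg_bounded by blast
  have "isCont f z" "isCont g z" using ac_at_isCont assms(2,3) by auto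
  then have "\<forall>\<^sub>F x in at z. dist (f x) (f z) < 1" "\<forall>\<^sub>F x in at z. dist (g x) (g z) < 1"
    unfolding isCont_def tendsto_iff by auto
  then have "\<forall>\<^sub>F x in at z. dist (f x) (f z) < 1 \<and> dist (g x) (g z) < 1" by eventually_elim auto
  then obtain W where W: "open W" "z \<in> W" "\<And>x. x \<in> W \<Longrightarrow> x \<noteq> z \<Longrightarrow> dist (f x) (f z) < 1 \<and> dist (g x) (g z) < 1"
    unfolding eventually_at_topological by blast
  define M where "M = max (norm (f z)) (norm (g z)) + 1"
  have M: "norm (f x) \<le> M \<and> norm (g x) \<le> M" if "x \<in> W" for x
  proof (cases "x = z")
    case False
    then show ?thesis using W(3)[OF that False] norm_triangle_ineq2[of "f x" "f z"] norm_triangle_ineq2[of "g x" "g z"]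
      by (auto simp: M_def dist_norm)
  qed (auto simp: M_def)
  show ?thesis
  \<comment> \<open>The product is Lipschitz in the pair where both factors are bounded by M; K
    bounds B, and 2 compares the sum of two norms with the norm of the pair.\<close>
  proof (rule ac_at_lipschitz_image[OF ac_at_Pair[OF assms(2,3)] W(1,2), of _ "2 * (M * K)"])
    fix x y assume xy: "x \<in> W" "y \<in> W"
    have M0: "0 \<le> M" using M xy norm_ge_zero order_trans by blast
    have "B (f x) (g x) - B (f y) (g y) = B (f x) (g x - g y) + B (f x - f y) (g y)"
      by (simp add: diff_left diff_right)
    then have "norm (B (f x) (g x) - B (f y) (g y)) \<le> norm (f x) * norm (g x - g y) * K + norm (f x - f y) * norm (g y) * K"
      using norm_triangle_le[OF add_mono[OF K(2) K(2)]] by metis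
    also have "\<dots> \<le> M * norm (g x - g y) * K + norm (f x - f y) * M * K"
      using M[OF xy(1)] M[OF xy(2)] K(1) by (intro add_mono mult_right_mono mult_left_mono) auto
    also have "\<dots> = (M * K) * (norm (g x - g y) + norm (f x - f y))" by (simp add: algebra_simps)
    also have "\<dots> \<le> (M * K) * (2 * norm ((f x, g x) - (f y, g y)))"
      using norm_fst_le[of "f x - f y" "g x - g y"] norm_snd_le[of "g x - g y" "f x - f y"] K(1) M0
      by (intro mult_left_mono) auto
    finally show "norm (B (f x) (g x) - B (f y) (g y)) \<le> 2 * (M * K) * norm ((f x, g x) - (f y, g y))"
      by (simp add: algebra_simps)
  qed
qed

lemma ac_at_add:
  assumes "ac_at f z" "ac_at g z"
  shows "ac_at (\<lambda>x. f x + g x) z"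
proof (rule ac_at_lipschitz_image[OF ac_at_Pair[OF assms] open_UNIV UNIV_I])
  fix x y
  have "norm (f x + g x - (f y + g y)) \<le> norm (f x - f y) + norm (g x - g y)"
    by (rule norm_diff_triangle_ineq)
  then show "norm (f x + g x - (f y + g y)) \<le> 2 * norm ((f x, g x) - (f y, g y))"
    using norm_fst_le[of "f x - f y" "g x - g y"] norm_snd_le[of "g x - g y" "f x - f y"]
    by (simp only: diff_Pair)
qed

lemma ac_at_const: "ac_at (\<lambda>x. c) z"
  by (rule ac_atI[of UNIV _ "\<lambda>x. 0"]) auto

lemma has_vector_derivative_tendsto:
  assumes "(k has_vector_derivative k') (at x)"
  shows "((\<lambda>y. (1 / (y - x)) *\<^sub>R (k y - k x)) \<longlongrightarrow> k') (at x)"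
proof -
  have "((\<lambda>y. norm (k y - k x - (y - x) *\<^sub>R k') / norm (y - x)) \<longlongrightarrow> 0) (at x)"
    using assms by (simp add: has_vector_derivative_def has_derivative_iff_norm)
  moreover have "\<forall>\<^sub>F y in at x. norm (k y - k x - (y - x) *\<^sub>R k') / norm (y - x) = norm ((1 / (y - x)) *\<^sub>R (k y - k x) - k')"
    unfolding eventually_at_filter
  proof (rule always_eventually, intro allI impI)
    fix y assume "y \<noteq> x"
    then have "(1 / (y - x)) *\<^sub>R (k y - k x) - k' = (1 / (y - x)) *\<^sub>R (k y - k x - (y - x) *\<^sub>R k')"
      by (simp add: scaleR_diff_right)
    then show "norm (k y - k x - (y - x) *\<^sub>R k') / norm (y - x) = norm ((1 / (y - x)) *\<^sub>R (k y - k x) - k')"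
      by (simp add: divide_simps)
  qed
  ultimately have "((\<lambda>y. norm ((1 / (y - x)) *\<^sub>R (k y - k x) - k')) \<longlongrightarrow> 0) (at x)"
    by (rule Lim_transform_eventually)
  then have "((\<lambda>y. (1 / (y - x)) *\<^sub>R (k y - k x) - k') \<longlongrightarrow> 0) (at x)"
    by (rule tendsto_norm_zero_cancel)
  then show ?thesis by (rule LIM_zero_cancel)
qed

lemma vector_derivative_norm_le:
  assumes "(f has_vector_derivative f') (at x)" "(Q has_vector_derivative Q') (at x)"
    and "open W" "x \<in> W" "\<And>y. y \<in> W \<Longrightarrow> norm (f y - f x) \<le> C * norm (Q y - Q x)"
  shows "norm f' \<le> C * norm Q'"
proof (rule tendsto_le[where F="at x"])
  note q = has_vector_derivative_tendsto
  show "((\<lambda>y. norm ((1 / (y - x)) *\<^sub>R (f y - f x))) \<longlongrightarrow> norm f') (at x)" using q[OF assms(1)] by (rule tendsto_norm)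
  show "((\<lambda>y. C * norm ((1 / (y - x)) *\<^sub>R (Q y - Q x))) \<longlongrightarrow> C * norm Q') (at x)"
    using q[OF assms(2)] by (intro tendsto_intros)
  have "\<forall>\<^sub>F y in at x. y \<in> W" using assms(3,4) eventually_at_topological by blast
  then show "\<forall>\<^sub>F y in at x. norm ((1 / (y - x)) *\<^sub>R (f y - f x)) \<le> C * norm ((1 / (y - x)) *\<^sub>R (Q y - Q x))"
  proof eventually_elim
    case (elim y)
    then show ?case using mult_left_mono[OF assms(5)[OF elim], of "\<bar>1/(y-x)\<bar>"] by (simp add: mult.left_commute)
  qed
qed simp

section \<open>Test functions and weak derivatives\<close>

text \<open>Smoothness by closure: in a family stable under differentiation all iterated derivatives
  stay in the family and are therefore differentiable.\<close>

lemma iterated_deriv_differentiable: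
  assumes "f \<in> S" "\<And>g. g \<in> S \<Longrightarrow> \<exists>g'\<in>S. \<forall>x. (g has_field_derivative g' x) (at x)"
  shows "(deriv ^^ j) f field_differentiable (at x)"
proof -
  have "(deriv ^^ j) f \<in> S"
  proof (induction j)
    case (Suc j)
    then obtain g' where "g' \<in> S" "\<forall>x. ((deriv ^^ j) f has_field_derivative g' x) (at x)" using assms(2) by blast
    then have "deriv ((deriv ^^ j) f) = g'" using DERIV_imp_deriv by blast
    then show ?case using \<open>g' \<in> S\<close> by simp
  qed (use assms(1) in simp)
  then show ?thesis using assms(2) by (auto simp: field_differentiable_def)
qed

section \<open>Smooth bumps supported in a given interval\<close>

definition flat_exp :: "real poly \<Rightarrow> real \<Rightarrow> real" where
  "flat_exp p u = (if u > 0 then poly p (1/u) * exp (- (1/u)) else 0)"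

lemma poly_times_exp_minus_tendsto: "((\<lambda>w::real. poly p w * exp (- w)) \<longlongrightarrow> 0) at_top"
proof -
  have "((\<lambda>w. \<Sum>i\<le>degree p. coeff p i * (w ^ i / exp w)) \<longlongrightarrow> (\<Sum>i\<le>degree p. coeff p i * 0)) at_top"
    by (intro tendsto_intros tendsto_power_div_exp_0)
  then show ?thesis
    by (simp add: poly_altdef sum_distrib_right exp_minus divide_inverse mult.assoc)
qed

text \<open>With w = 1/u, hence dw/du = -w^2, the derivative of p(w) exp(-w) is w^2 (p - p')(w)
  exp(-w); the factor w^2 is the polynomial \<open>[:0,0,1:]\<close>. Polynomial factors thus keep
  the family closed under differentiation.\<close>

lemma flat_exp_has_derivative:
  "(flat_exp p has_field_derivative flat_exp ([:0,0,1:] * (p - pderiv p)) u) (at u)"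
proof -
  let ?q = "[:0,0,1:] * (p - pderiv p)"
  consider "u > 0" | "u < 0" | "u = 0" by linarith
  then show ?thesis
  proof cases
    case 1
    have "((\<lambda>u. poly p (1/u) * exp (- (1/u))) has_field_derivative
       poly p (1/u) * (exp (- (1/u)) * (1 / u^2)) + poly (pderiv p) (1/u) * (- (1 / u^2)) * exp (- (1/u))) (at u)"
      using 1 by (auto intro!: derivative_eq_intros DERIV_chain2[OF poly_DERIV] simp: power2_eq_square)
    also have "poly p (1/u) * (exp (- (1/u)) * (1 / u^2)) + poly (pderiv p) (1/u) * (- (1 / u^2)) * exp (- (1/u)) = flat_exp ?q u"
      using 1 by (simp add: flat_exp_def algebra_simps power2_eq_square)
    finally show ?thesis
      by (rule has_field_derivative_transform_within_open[where S="{0<..}"]) (use 1 in \<open>auto simp: flat_exp_def\<close>)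
  next
    case 2
    have "((\<lambda>u. 0) has_field_derivative flat_exp ?q u) (at u)" using 2 by (simp add: flat_exp_def)
    then show ?thesis
      by (rule has_field_derivative_transform_within_open[where S="{..<0}"]) (use 2 in \<open>auto simp: flat_exp_def\<close>)
  next
    case 3
    have "((\<lambda>h. (flat_exp p h - flat_exp p 0) / h) \<longlongrightarrow> 0) (at 0)"
    proof (rule filterlim_split_at)
      show "((\<lambda>h. (flat_exp p h - flat_exp p 0) / h) \<longlongrightarrow> 0) (at_left 0)"
        by (rule tendsto_eventually) (auto simp: eventually_at_filter flat_exp_def)
      \<comment> \<open>The right difference quotient at 0 is w p(w) exp(-w) with w = 1/h, hence the
        shifted polynomial \<open>pCons 0 p\<close>.\<close>
      have "((\<lambda>h. poly (pCons 0 p) (inverse h) * exp (- (inverse h))) \<longlongrightarrow> 0) (at_right 0)"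
        by (rule filterlim_compose[OF poly_times_exp_minus_tendsto filterlim_inverse_at_top_right])
      then show "((\<lambda>h. (flat_exp p h - flat_exp p 0) / h) \<longlongrightarrow> 0) (at_right 0)"
        by (rule Lim_transform_eventually)
          (auto simp: eventually_at_filter flat_exp_def divide_inverse mult.assoc mult.left_commute)
    qed
    then show ?thesis using 3 by (simp add: DERIV_def flat_exp_def)
  qed
qed

text \<open>The bump \<open>exp (-1/(r (x - a)) - 1/(r (b - x)))\<close> on the interval from \<open>a\<close> to \<open>b\<close>; it tends to
  the indicator function of the interval as \<open>r\<close> tends to infinity.\<close>

definition bump :: "real \<Rightarrow> real \<Rightarrow> real \<Rightarrow> real \<Rightarrow> real" where
  "bump a b r x = flat_exp 1 (r * (x - a)) * flat_exp 1 (r * (b - x))"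

text \<open>A family that contains the bump and is closed under differentiation; sums are included
  because of the product rule.\<close>

inductive_set bump_span :: "real \<Rightarrow> real \<Rightarrow> real \<Rightarrow> (real \<Rightarrow> real) set" for a b r where
  prod: "(\<lambda>x. k * (flat_exp p (r * (x - a)) * flat_exp q (r * (b - x)))) \<in> bump_span a b r"
| add: "f \<in> bump_span a b r \<Longrightarrow> g \<in> bump_span a b r \<Longrightarrow> (\<lambda>x. f x + g x) \<in> bump_span a b r"

lemma bump_span_derivative:
  "f \<in> bump_span a b r \<Longrightarrow> \<exists>g\<in>bump_span a b r. \<forall>x. (f has_field_derivative g x) (at x)"
proof (induction rule: bump_span.induct)
  case (prod k p q)
  let ?D = "\<lambda>p. [:0,0,1:] * (p - pderiv p)"
  define g where "g = (\<lambda>x. (k * r) * (flat_exp (?D p) (r * (x - a)) * flat_exp q (r * (b - x))) +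
    (- k * r) * (flat_exp p (r * (x - a)) * flat_exp (?D q) (r * (b - x))))"
  have "g \<in> bump_span a b r" unfolding g_def by (intro bump_span.intros)
  moreover have "((\<lambda>x. k * (flat_exp p (r * (x - a)) * flat_exp q (r * (b - x)))) has_field_derivative g x) (at x)" for x
  proof -
    have "((\<lambda>x. flat_exp p (r * (x - a))) has_field_derivative flat_exp (?D p) (r * (x - a)) * r) (at x)"
      by (rule DERIV_chain2[OF flat_exp_has_derivative]) (auto intro!: derivative_eq_intros)
    moreover have "((\<lambda>x. flat_exp q (r * (b - x))) has_field_derivative flat_exp (?D q) (r * (b - x)) * (- r)) (at x)"
      by (rule DERIV_chain2[OF flat_exp_has_derivative]) (auto intro!: derivative_eq_intros)
    ultimately have "((\<lambda>x. k * (flat_exp p (r * (x - a)) * flat_exp q (r * (b - x)))) has_field_derivative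
       k * (flat_exp p (r * (x - a)) * (flat_exp (?D q) (r * (b - x)) * (- r)) + flat_exp (?D p) (r * (x - a)) * r * flat_exp q (r * (b - x)))) (at x)"
      by (intro DERIV_cmult DERIV_mult')
    then show ?thesis by (rule back_subst[where P="\<lambda>d. (_ has_field_derivative d) (at x)"]) (simp add: g_def algebra_simps)
  qed
  ultimately show ?case by blast
next
  case (add f g)
  then obtain f' g' where "f' \<in> bump_span a b r" "\<forall>x. (f has_field_derivative f' x) (at x)"
    "g' \<in> bump_span a b r" "\<forall>x. (g has_field_derivative g' x) (at x)" by blast
  then show ?case by (intro bexI[of _ "\<lambda>x. f' x + g' x"] bump_span.add) (auto intro: DERIV_add)
qed

lemma bump_in_span: "bump a b r \<in> bump_span a b r"
  using bump_span.prod[of 1 1 r a 1 b] by (simp add: bump_def[abs_def])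

lemma bump_smooth: "(deriv ^^ j) (bump a b r) field_differentiable (at x)"
  using iterated_deriv_differentiable[OF bump_in_span bump_span_derivative] .

lemma bump_eq:
  assumes "r > 0"
  shows "bump a b r x = (if a < x \<and> x < b then exp (- ((1/(x - a) + 1/(b - x)) / r)) else 0)"
  using assms by (auto simp: bump_def flat_exp_def zero_less_mult_iff add_divide_distrib algebra_simps simp flip: exp_add)

lemma bump_test_function:
  assumes "a < b" "r > 0" "{a..b} \<subseteq> U"
  shows "bump a b r \<in> test_functions U"
proof -
  have "{x. bump a b r x \<noteq> 0} = {a<..<b}" using assms by (auto simp: bump_eq)
  then show ?thesis using assms bump_smooth by (auto simp: test_functions_def)
qed

lemma test_function_deriv:
  fixes f :: "real \<Rightarrow> real"
  assumes "\<And>j x. (deriv ^^ j) f field_differentiable (at x)"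
  shows "(f has_field_derivative deriv f x) (at x)" "isCont f x" "isCont (deriv f) x"
proof -
  show "(f has_field_derivative deriv f x) (at x)"
    using assms[of 0 x] by (simp add: DERIV_deriv_iff_field_differentiable)
  then show "isCont f x" by (rule DERIV_isCont)
  show "isCont (deriv f) x"
    using assms[of 1 x] field_differentiable_imp_continuous_at by simp
qed

text \<open>The \<open>\<rho>' n\<close> are an approximate identity at the left endpoint: they are
  nonnegative with total mass tending to 1, and the mass beyond any d > a is
  \<open>\<rho> n c - \<rho> n d\<close>, which tends to 0.\<close>

lemma integral_derivative_concentrating:
  fixes f :: "real \<Rightarrow> 'b::euclidean_space"
  assumes ac: "a < c" and f: "continuous_on {a..c} f"
    and \<rho>: "\<And>n x. (\<rho> n has_field_derivative \<rho>' n x) (at x)" "\<And>n. continuous_on {a..c} (\<rho>' n)"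
    and pos: "\<And>n x. a < x \<Longrightarrow> x < c \<Longrightarrow> 0 \<le> \<rho>' n x" and a0: "\<And>n. \<rho> n a = 0"
    and lim: "\<And>x. a < x \<Longrightarrow> x \<le> c \<Longrightarrow> (\<lambda>n::nat. \<rho> n x) \<longlonglongrightarrow> 1"
  shows "(\<lambda>n. integral {a..c} (\<lambda>x. \<rho>' n x *\<^sub>R f x)) \<longlonglongrightarrow> f a"
proof -
  have ftc: "integral {u..v} (\<rho>' n) = \<rho> n v - \<rho> n u" if "u \<le> v" for u v n
    using that \<rho>(1) by (intro integral_unique fundamental_theorem_of_calculus)
      (auto simp: has_real_derivative_iff_has_vector_derivative has_vector_derivative_at_within)
  \<comment> \<open>\<open>pos\<close> covers the open interval; continuity extends the sign to its
    endpoints.\<close>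
  have \<rho>0: "0 \<le> \<rho>' n x" if "x \<in> {a..c}" for n x
    using continuous_ge_on_closure[of "{a<..<c}" "\<rho>' n" x 0] that ac \<rho>(2)[of n] pos by auto
  obtain M where "\<forall>y\<in>f ` {a..c}. norm y \<le> M"
    using compact_imp_bounded[OF compact_continuous_image[OF f compact_Icc]] unfolding bounded_iff by blast
  then have M: "norm (f x) \<le> M" if "x \<in> {a..c}" for x using that by blast
  have M0: "M \<ge> 0" using order_trans[OF norm_ge_zero M[of a]] ac by auto
  have key: "norm (integral {a..c} (\<lambda>x. \<rho>' n x *\<^sub>R (f x - f a))) \<le> \<eta> * \<rho> n d + 2 * M * (\<rho> n c - \<rho> n d)"
    if d: "a < d" "d < c" and \<eta>: "\<And>x. x \<in> {a..d} \<Longrightarrow> norm (f x - f a) \<le> \<eta>" for n d \<eta>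
  proof -
    have int: "(\<lambda>x. \<rho>' n x *\<^sub>R (f x - f a)) integrable_on {u..v}" if "a \<le> u" "v \<le> c" for u v
      using that by (intro integrable_continuous_real continuous_intros continuous_on_subset[OF f] continuous_on_subset[OF \<rho>(2)]) auto
    have int': "(\<lambda>x. K * \<rho>' n x) integrable_on {u..v}" if "a \<le> u" "v \<le> c" for u v K
      using that by (intro integrable_continuous_real continuous_intros continuous_on_subset[OF \<rho>(2)]) auto
    have bd: "norm (integral {u..v} (\<lambda>x. \<rho>' n x *\<^sub>R (f x - f a))) \<le> K * (\<rho> n v - \<rho> n u)"
      if uv: "a \<le> u" "u \<le> v" "v \<le> c" and K: "\<And>x. x \<in> {u..v} \<Longrightarrow> norm (f x - f a) \<le> K" for u v K
    proof -
      have "norm (integral {u..v} (\<lambda>x. \<rho>' n x *\<^sub>R (f x - f a))) \<le> integral {u..v} (\<lambda>x. K * \<rho>' n x)"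
      proof (rule integral_norm_bound_integral[OF int int'])
        fix x assume x: "x \<in> {u..v}"
        then have "0 \<le> \<rho>' n x" using uv by (intro \<rho>0) auto
        then show "norm (\<rho>' n x *\<^sub>R (f x - f a)) \<le> K * \<rho>' n x"
          using K[of x] x mult_left_mono[of "norm (f x - f a)" K "\<rho>' n x"] by (simp add: mult.commute)
      qed (use uv in auto)
      then show ?thesis using ftc[OF uv(2)] by simp
    qed
    have "integral {a..c} (\<lambda>x. \<rho>' n x *\<^sub>R (f x - f a)) =
      integral {a..d} (\<lambda>x. \<rho>' n x *\<^sub>R (f x - f a)) + integral {d..c} (\<lambda>x. \<rho>' n x *\<^sub>R (f x - f a))"
      using d by (intro HK_combine[symmetric] int) auto
    moreover have "norm (f x - f a) \<le> 2 * M" if "x \<in> {d..c}" for x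
      using M[of x] M[of a] that d norm_triangle_ineq4[of "f x" "f a"] by auto
    ultimately show ?thesis
      using bd[of a d \<eta>] bd[of d c "2*M"] \<eta> d a0[of n] by (smt (verit) norm_triangle_ineq)
  qed
  have "(\<lambda>n. integral {a..c} (\<lambda>x. \<rho>' n x *\<^sub>R (f x - f a))) \<longlonglongrightarrow> 0"
    unfolding tendsto_iff
  proof (intro allI impI)
    fix e :: real assume e: "e > 0"
    obtain d0 where d0: "d0 > 0" "\<And>x. x \<in> {a..c} \<Longrightarrow> dist x a < d0 \<Longrightarrow> dist (f x) (f a) < e/2"
      using f[unfolded continuous_on_iff, rule_format, of a "e/2"] ac e by auto
    define d where "d = a + min (d0/2) ((c - a)/2)"
    have d: "a < d" "d < c" "d - a < d0" using d0(1) ac by (auto simp: d_def min_def field_simps)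
    have "norm (f x - f a) \<le> e/2" if "x \<in> {a..d}" for x
      using d0(2)[of x] d that by (auto simp: dist_norm)
    note key' = key[OF d(1,2) this]
    have "(\<lambda>n. e/2 * \<rho> n d + 2 * M * (\<rho> n c - \<rho> n d)) \<longlonglongrightarrow> e/2 * 1 + 2 * M * (1 - 1)"
      using lim d ac by (intro tendsto_intros) auto
    then have "\<forall>\<^sub>F n in sequentially. e/2 * \<rho> n d + 2 * M * (\<rho> n c - \<rho> n d) < e"
      using e by (intro order_tendstoD(2)[where y="e/2"]) auto
    then show "\<forall>\<^sub>F n in sequentially. dist (integral {a..c} (\<lambda>x. \<rho>' n x *\<^sub>R (f x - f a))) 0 < e"
    proof eventually_elim
      case (elim n)
      show ?case using order_le_less_trans[OF key'[of n] elim] by (simp only: dist_norm diff_zero)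
    qed
  qed
  moreover have "integral {a..c} (\<lambda>x. \<rho>' n x *\<^sub>R (f x - f a)) = integral {a..c} (\<lambda>x. \<rho>' n x *\<^sub>R f x) - \<rho> n c *\<^sub>R f a" for n
  proof -
    have "integral {a..c} (\<lambda>x. \<rho>' n x *\<^sub>R f x - \<rho>' n x *\<^sub>R f a) = integral {a..c} (\<lambda>x. \<rho>' n x *\<^sub>R f x) - integral {a..c} (\<lambda>x. \<rho>' n x *\<^sub>R f a)"
      by (intro HK_diff integrable_continuous_real continuous_intros f \<rho>(2))
    also have "integral {a..c} (\<lambda>x. \<rho>' n x *\<^sub>R f a) = integral {a..c} (\<rho>' n) *\<^sub>R f a"
      by (rule integral_unique[OF has_integral_scaleR_left[OF integrable_integral]]) (intro integrable_continuous_real \<rho>(2))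
    finally show ?thesis using ftc[of a c n] ac a0 by (simp add: scaleR_diff_right)
  qed
  ultimately have "(\<lambda>n. integral {a..c} (\<lambda>x. \<rho>' n x *\<^sub>R f x) - \<rho> n c *\<^sub>R f a + \<rho> n c *\<^sub>R f a) \<longlonglongrightarrow> 0 + 1 *\<^sub>R f a"
    using lim[of c] ac by (intro tendsto_intros) auto
  then show ?thesis by simp
qed


lemma integral_lebesgue_on_subset:
  fixes F :: "'a::euclidean_space \<Rightarrow> 'b::euclidean_space"
  assumes "S \<subseteq> U" "S \<in> sets lebesgue" "U \<in> sets lebesgue" "\<And>x. x \<in> U - S \<Longrightarrow> F x = 0"
  shows "integrable (lebesgue_on U) F \<longleftrightarrow> integrable (lebesgue_on S) F"
    and "integral\<^sup>L (lebesgue_on U) F = integral\<^sup>L (lebesgue_on S) F"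
proof -
  have "(\<lambda>x. indicator U x *\<^sub>R F x) = (\<lambda>x. indicator S x *\<^sub>R F x)"
    using assms by (auto simp: fun_eq_iff indicator_def)
  then show "integrable (lebesgue_on U) F \<longleftrightarrow> integrable (lebesgue_on S) F"
    and "integral\<^sup>L (lebesgue_on U) F = integral\<^sup>L (lebesgue_on S) F"
    using assms by (simp_all add: integrable_restrict_space integral_restrict_space)
qed

lemma bump_le_1: "r > 0 \<Longrightarrow> a < b \<Longrightarrow> 0 \<le> bump a b r x \<and> bump a b r x \<le> 1"
  by (auto simp: bump_eq)

lemma bump_tendsto_1:
  assumes "a < x" "x < b"
  shows "(\<lambda>n. bump a b (real (Suc n)) x) \<longlonglongrightarrow> 1"
proof -
  have "(\<lambda>n. exp (- ((1/(x - a) + 1/(b - x)) * inverse (real (Suc n))))) \<longlonglongrightarrow> exp (- ((1/(x - a) + 1/(b - x)) * 0))"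
    by (intro tendsto_intros LIMSEQ_inverse_real_of_nat)
  then show ?thesis using assms by (simp add: bump_eq divide_inverse)
qed

text \<open>The sum 1/(x - a) + 1/(b - x) equals (b - a) / ((x - a) (b - x)), and the product in the
  denominator increases up to the midpoint.\<close>

lemma bump_mono:
  assumes "a < x" "x \<le> y" "y \<le> (a + b) / 2" "r > 0"
  shows "bump a b r x \<le> bump a b r y"
proof -
  have "(x - a) * (b - x) \<le> (y - a) * (b - y)"
  proof -
    have "0 \<le> (y - x) * (a + b - x - y)" using assms by (intro mult_nonneg_nonneg) auto
    then show ?thesis by (simp add: algebra_simps)
  qed
  moreover have "0 < (x - a) * (b - x)" "x < b" "y < b" using assms by auto
  ultimately have "(b - a) / ((y - a) * (b - y)) \<le> (b - a) / ((x - a) * (b - x))"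
    using assms by (intro divide_left_mono mult_pos_pos) auto
  moreover have "1/(z - a) + 1/(b - z) = (b - a) / ((z - a) * (b - z))" if "a < z" "z < b" for z
    using that by (simp add: field_simps)
  ultimately have "1/(y - a) + 1/(b - y) \<le> 1/(x - a) + 1/(b - x)"
    using assms \<open>x < b\<close> \<open>y < b\<close> by (metis order_less_le_trans)
  then have "(1/(y - a) + 1/(b - y)) / r \<le> (1/(x - a) + 1/(b - x)) / r"
    using assms by (intro divide_right_mono) auto
  then show ?thesis using assms \<open>x < b\<close> \<open>y < b\<close> by (simp add: bump_eq)
qed

lemma bump_left: "bump a b r a = 0"
  by (simp add: bump_def flat_exp_def)

lemma bump_reflect: "bump (- b) (- a) r (- x) = bump a b r x"
  by (simp add: bump_def mult.commute)

lemma bump_deriv_nonneg: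
  assumes "a < x" "x < (a + b) / 2" "r > 0"
  shows "0 \<le> deriv (bump a b r) x"
proof (rule mono_on_imp_deriv_nonneg[where A="{a<..<(a+b)/2}" and f="bump a b r"])
  show "mono_on {a<..<(a + b) / 2} (bump a b r)" using bump_mono assms(3) by (auto intro!: mono_onI)
  show "(bump a b r has_real_derivative deriv (bump a b r) x) (at x)"
    by (rule test_function_deriv bump_smooth)+
qed (use assms in auto)

lemma bump_deriv_integral_tendsto:
  fixes f :: "real \<Rightarrow> 'b::euclidean_space"
  assumes "a < b" "continuous_on {a..b} f"
  shows "(\<lambda>n. integral {a..(a+b)/2} (\<lambda>x. deriv (bump a b (real (Suc n))) x *\<^sub>R f x)) \<longlonglongrightarrow> f a"
proof (rule integral_derivative_concentrating[where \<rho>="\<lambda>n. bump a b (real (Suc n))"])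
  fix n show "continuous_on {a..(a + b) / 2} (deriv (bump a b (real (Suc n))))"
    by (intro continuous_at_imp_continuous_on ballI test_function_deriv bump_smooth)
qed (use assms in \<open>auto intro: continuous_on_subset test_function_deriv bump_smooth bump_deriv_nonneg bump_tendsto_1 simp: bump_left simp del: of_nat_Suc\<close>)

text \<open>The mass of the derivative gathers at a with weight 1 from the left half and at b with
  weight -1 from the right half. The right half is the left half of the reflected bump.\<close>

lemma bump_deriv_integral_tendsto':
  fixes f :: "real \<Rightarrow> 'b::euclidean_space"
  assumes "a < b" "continuous_on {a..b} f"
  shows "(\<lambda>n. integral {a..b} (\<lambda>x. deriv (bump a b (real (Suc n))) x *\<^sub>R f x)) \<longlonglongrightarrow> f a - f b"
proof -
  define c where "c = (a + b)/2"
  have c: "a \<le> c" "c \<le> b" using assms by (auto simp: c_def)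
  have dm: "deriv (bump (- b) (- a) r) (- x) = - deriv (bump a b r) x" for r x
  proof -
    have "((\<lambda>x. bump (- b) (- a) r (- x)) has_field_derivative deriv (bump (- b) (- a) r) (- x) * (- 1)) (at x)"
      by (rule DERIV_chain2[OF test_function_deriv(1)[OF bump_smooth]]) (auto intro!: derivative_eq_intros)
    then have "(bump a b r has_field_derivative deriv (bump (- b) (- a) r) (- x) * (- 1)) (at x)"
      by (simp add: bump_reflect)
    then show ?thesis using DERIV_imp_deriv by fastforce
  qed
  have "continuous_on {- b..- a} (\<lambda>x. f (- x))"
    by (rule continuous_on_compose2[OF assms(2)]) (auto intro!: continuous_intros)
  then have "(\<lambda>n. integral {- b..(- b + - a)/2} (\<lambda>x. deriv (bump (- b) (- a) (real (Suc n))) x *\<^sub>R f (- x))) \<longlonglongrightarrow> f (- (- b))"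
    using assms(1) by (intro bump_deriv_integral_tendsto) auto
  moreover have "integral {- b..(- b + - a)/2} (\<lambda>x. deriv (bump (- b) (- a) r) x *\<^sub>R f (- x))
      = - integral {c..b} (\<lambda>x. deriv (bump a b r) x *\<^sub>R f x)" for r
  proof -
    have "(- b + - a)/2 = - c" by (simp add: c_def field_simps)
    then have "integral {- b..(- b + - a)/2} (\<lambda>x. deriv (bump (- b) (- a) r) x *\<^sub>R f (- x))
       = integral {- b..- c} (\<lambda>x. (\<lambda>y. - (deriv (bump a b r) y *\<^sub>R f y)) (- x))"
      using dm[of r "- x" for x] by (simp add: minus_equation_iff)
    also have "\<dots> = integral {c..b} (\<lambda>y. - (deriv (bump a b r) y *\<^sub>R f y))"
      by (rule HK_reflect_real)
    finally show ?thesis by simp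
  qed
  ultimately have 2: "(\<lambda>n. integral {c..b} (\<lambda>x. deriv (bump a b (real (Suc n))) x *\<^sub>R f x)) \<longlonglongrightarrow> - f b"
    using tendsto_minus by fastforce
  have "integral {a..c} (\<lambda>x. deriv (bump a b r) x *\<^sub>R f x) + integral {c..b} (\<lambda>x. deriv (bump a b r) x *\<^sub>R f x)
     = integral {a..b} (\<lambda>x. deriv (bump a b r) x *\<^sub>R f x)" for r
    by (intro HK_combine c integrable_continuous_real continuous_intros assms
       continuous_at_imp_continuous_on ballI test_function_deriv bump_smooth)
  then show ?thesis
    using tendsto_add[OF bump_deriv_integral_tendsto[OF assms, folded c_def] 2] by simp
qed

text \<open>Testing with bumps that tend to the indicator of the open interval: the left side tends
  to f a - f b, the right side to minus the integral of g by dominated convergence. Continuity of f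
  is what gives the endpoint values.\<close>

lemma weak_derivative_antideriv:
  fixes f :: "real \<Rightarrow> 'b::euclidean_space"
  assumes U: "open U" and f: "continuous_on U f" and w: "weak_derivative U f g"
  shows "antideriv_on U f g"
  unfolding antideriv_on_def
proof (intro allI impI conjI; (elim conjE)?)
  fix a b assume ab: "a \<le> b" "{a..b} \<subseteq> U"
  have gi: "integrable (lebesgue_on {a..b}) g"
    using w ab by (auto simp: weak_derivative_def locally_integrable_on_def)
  then show ga: "g absolutely_integrable_on {a..b}"
    by (simp add: set_integrable_def integrable_restrict_space)
  show "f b - f a = integral {a..b} g"
  proof (cases "a = b")
    case False
    then have ab': "a < b" using ab by simp
    have fc: "continuous_on {a..b} f" using f ab(2) continuous_on_subset by blast
    have Us: "U \<in> sets lebesgue" using U by (simp add: borel_open)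
    define \<phi> where "\<phi> n = bump a b (real (Suc n))" for n
    have out: "x \<in> U - {a..b} \<Longrightarrow> \<phi> n x = 0" "x \<in> U - {a..b} \<Longrightarrow> deriv (\<phi> n) x = 0" for n x
    proof -
      assume x: "x \<in> U - {a..b}"
      then show "\<phi> n x = 0" by (auto simp: \<phi>_def bump_eq)
      have "(\<phi> n has_field_derivative 0) (at x)"
        by (rule has_field_derivative_transform_within_open[of "\<lambda>x. 0" _ _ "- {a..b}"])
          (use x in \<open>auto simp: \<phi>_def bump_eq\<close>)
      then show "deriv (\<phi> n) x = 0" by (rule DERIV_imp_deriv)
    qed
    have "(\<integral>x. deriv (\<phi> n) x *\<^sub>R f x \<partial>lebesgue_on U) = - (\<integral>x. \<phi> n x *\<^sub>R g x \<partial>lebesgue_on U)" for n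
      using w bump_test_function[OF ab'] ab by (auto simp: weak_derivative_def \<phi>_def)
    then have eq: "(\<integral>x. deriv (\<phi> n) x *\<^sub>R f x \<partial>lebesgue_on {a..b}) = - (\<integral>x. \<phi> n x *\<^sub>R g x \<partial>lebesgue_on {a..b})" for n
      using out ab Us by (subst (asm) (1 2) integral_lebesgue_on_subset(2)[of "{a..b}" U]) auto
    have \<phi>c: "continuous_on A (\<phi> n)" "continuous_on A (deriv (\<phi> n))" for n A
      unfolding \<phi>_def by (intro continuous_at_imp_continuous_on ballI test_function_deriv bump_smooth)+
    have "(\<integral>x. deriv (\<phi> n) x *\<^sub>R f x \<partial>lebesgue_on {a..b}) = integral {a..b} (\<lambda>x. deriv (\<phi> n) x *\<^sub>R f x)" for n
    proof (rule lebesgue_integral_eq_integral)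
      have "(\<lambda>x. deriv (\<phi> n) x *\<^sub>R f x) absolutely_integrable_on {a..b}"
        by (intro absolutely_integrable_continuous_real continuous_intros fc \<phi>c)
      then show "integrable (lebesgue_on {a..b}) (\<lambda>x. deriv (\<phi> n) x *\<^sub>R f x)"
        by (simp add: set_integrable_def integrable_restrict_space)
    qed auto
    then have "(\<lambda>n. \<integral>x. deriv (\<phi> n) x *\<^sub>R f x \<partial>lebesgue_on {a..b}) \<longlonglongrightarrow> f a - f b"
      using bump_deriv_integral_tendsto'[OF ab' fc] by (simp add: \<phi>_def)
    moreover have "(\<lambda>n. \<integral>x. \<phi> n x *\<^sub>R g x \<partial>lebesgue_on {a..b}) \<longlonglongrightarrow> (\<integral>x. g x \<partial>lebesgue_on {a..b})"
    proof (rule integral_dominated_convergence[where w="\<lambda>x. norm (g x)"])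
      have "{a,b} \<in> null_sets lebesgue" by (simp add: negligible_iff_null_sets[symmetric])
      then have "AE x in lebesgue. x \<notin> {a,b}" by (rule AE_not_in)
      then have "AE x in lebesgue. x \<in> {a..b} \<longrightarrow> (\<lambda>n. \<phi> n x *\<^sub>R g x) \<longlonglongrightarrow> g x"
      proof eventually_elim
        case (elim x)
        then show ?case using tendsto_scaleR[OF bump_tendsto_1[of a x b] tendsto_const[of "g x"]] by (auto simp: \<phi>_def)
      qed
      then show "AE x in lebesgue_on {a..b}. (\<lambda>n. \<phi> n x *\<^sub>R g x) \<longlonglongrightarrow> g x"
        by (simp add: AE_restrict_space_iff)
      show "AE x in lebesgue_on {a..b}. norm (\<phi> n x *\<^sub>R g x) \<le> norm (g x)" for n
        using bump_le_1[of "real (Suc n)" a b] ab' by (intro AE_I2) (auto simp: \<phi>_def mult_left_le_one_le)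
      show "(\<lambda>x. \<phi> n x *\<^sub>R g x) \<in> borel_measurable (lebesgue_on {a..b})" for n
        using gi continuous_imp_measurable_on_sets_lebesgue[OF \<phi>c(1), of "{a..b}"] by (intro borel_measurable_scaleR) auto
    qed (use gi in auto)
    ultimately have "f a - f b = - (\<integral>x. g x \<partial>lebesgue_on {a..b})"
      using LIMSEQ_unique[OF _ tendsto_minus] by (simp add: eq)
    then show ?thesis using lebesgue_integral_eq_integral[OF gi] by (simp add: algebra_simps)
  qed simp
qed

text \<open>Finitely many closed intervals inside U cover K.\<close>

lemma absolutely_integrable_on_compact:
  fixes h :: "real \<Rightarrow> 'b::euclidean_space"
  assumes U: "open U" and h: "\<And>x y. \<lbrakk>x \<le> y; {x..y} \<subseteq> U\<rbrakk> \<Longrightarrow> h absolutely_integrable_on {x..y}"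
    and K: "compact K" "K \<subseteq> U"
  shows "h absolutely_integrable_on K"
proof -
  have "\<exists>e>0. cball z e \<subseteq> U" if "z \<in> K" for z using U K that open_contains_cball by blast
  then obtain e where e: "\<And>z. z \<in> K \<Longrightarrow> e z > 0 \<and> cball z (e z) \<subseteq> U" by metis
  have "K \<subseteq> (\<Union>z\<in>K. ball z (e z))" using e by force
  then obtain F where F: "F \<subseteq> K" "finite F" "K \<subseteq> (\<Union>z\<in>F. ball z (e z))"
    using compactE_image[OF K(1), of K "\<lambda>z. ball z (e z)"] by auto
  have "h absolutely_integrable_on (\<Union>z\<in>F. cball z (e z))"
  proof (rule set_integrable_UN[OF F(2)])
    fix z assume "z \<in> F"
    then show "h absolutely_integrable_on cball z (e z)"
      using h[of "z - e z" "z + e z"] e[of z] F(1) by (auto simp: cball_eq_atLeastAtMost)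
  qed auto
  then show ?thesis
  proof (rule set_integrable_subset)
    show "K \<subseteq> (\<Union>z\<in>F. cball z (e z))"
      by (rule order_trans[OF F(3) UN_mono[OF order_refl ball_subset_cball]])
    show "K \<in> sets lebesgue" using K(1) by (simp add: lmeasurable_compact fmeasurableD)
  qed
qed

lemma absolutely_integrable_on_iff_integrable:
  fixes h :: "'a::euclidean_space \<Rightarrow> 'b::euclidean_space"
  assumes "S \<in> sets lebesgue"
  shows "h absolutely_integrable_on S \<longleftrightarrow> integrable (lebesgue_on S) h"
  using assms by (simp add: set_integrable_def integrable_restrict_space)

lemma locally_integrable_onI:
  fixes h :: "real \<Rightarrow> 'b::euclidean_space"
  assumes "open U" "\<And>x y. \<lbrakk>x \<le> y; {x..y} \<subseteq> U\<rbrakk> \<Longrightarrow> h absolutely_integrable_on {x..y}"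
  shows "locally_integrable_on h U"
  unfolding locally_integrable_on_def
proof (intro allI impI; elim conjE)
  fix K assume K: "compact K" "K \<subseteq> U"
  have "K \<in> sets lebesgue" using K(1) by (simp add: lmeasurable_compact fmeasurableD)
  then show "integrable (lebesgue_on K) h"
    using absolutely_integrable_on_compact[OF assms K] by (simp add: absolutely_integrable_on_iff_integrable)
qed

lemma antideriv_on_isCont:
  assumes "open U" "antideriv_on U f g" "z \<in> U"
  shows "isCont f z"
  using ac_at_isCont antideriv_on_ac_at assms by blast

lemma test_function_ac_at:
  assumes "\<And>j x. (deriv ^^ j) \<phi> field_differentiable (at x)"
  shows "ac_at (\<phi> :: real \<Rightarrow> real) z"
proof (rule antideriv_on_ac_at[OF open_UNIV _ UNIV_I])
  show "antideriv_on UNIV \<phi> (deriv \<phi>)"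
    unfolding antideriv_on_def
  proof (intro allI impI conjI)
    fix x y :: real assume xy: "x \<le> y \<and> {x..y} \<subseteq> UNIV"
    show "deriv \<phi> absolutely_integrable_on {x..y}"
      by (intro absolutely_integrable_continuous_real continuous_at_imp_continuous_on ballI test_function_deriv assms)
    show "\<phi> y - \<phi> x = integral {x..y} (deriv \<phi>)"
      using xy test_function_deriv(1)[OF assms]
      by (intro integral_unique[symmetric] fundamental_theorem_of_calculus)
        (auto simp: has_real_derivative_iff_has_vector_derivative has_vector_derivative_at_within)
  qed
qed

text \<open>Integration by parts: \<phi> f, extended by zero, is absolutely continuous on the whole
  line with compact support, so its derivative has integral zero.\<close>

lemma antideriv_weak_derivative:
  fixes f :: "real \<Rightarrow> 'b::euclidean_space"
  assumes U: "open U" and fg: "antideriv_on U f g"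
  shows "weak_derivative U f g"
  unfolding weak_derivative_def
proof (intro conjI ballI)
  have fc: "continuous_on A f" if "A \<subseteq> U" for A
    using antideriv_on_isCont[OF U fg] that by (intro continuous_at_imp_continuous_on) auto
  have "f absolutely_integrable_on {x..y}" if "x \<le> y" "{x..y} \<subseteq> U" for x y
    using fc that by (intro absolutely_integrable_continuous_real) auto
  then show "locally_integrable_on f U"
    by (intro locally_integrable_onI[OF U])
  show "locally_integrable_on g U"
    by (intro locally_integrable_onI[OF U] antideriv_onD(1)[OF fg])
  fix \<phi> assume \<phi>: "\<phi> \<in> test_functions U"
  define K where "K = closure {x. \<phi> x \<noteq> 0}"
  have K: "compact K" "K \<subseteq> U" and sm: "\<And>j x. (deriv ^^ j) \<phi> field_differentiable (at x)"
    using \<phi> by (auto simp: test_functions_def K_def)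
  have Ks: "K \<in> sets lebesgue" "U \<in> sets lebesgue" using K U by (auto simp: lmeasurable_compact fmeasurableD borel_open)
  have opK: "open (- K)" using K by (simp add: compact_imp_closed open_Compl)
  have \<phi>0: "\<phi> x = 0" if "x \<notin> K" for x using that closure_subset[of "{x. \<phi> x \<noteq> 0}"] unfolding K_def by auto
  have d\<phi>0: "deriv \<phi> x = 0" if "x \<notin> K" for x
  proof (rule DERIV_imp_deriv)
    show "(\<phi> has_field_derivative 0) (at x)"
      by (rule has_field_derivative_transform_within_open[of "\<lambda>x. 0" _ _ "- K"]) (use that opK \<phi>0 in auto)
  qed
  have \<phi>c: "continuous_on A \<phi>" "continuous_on A (deriv \<phi>)" for A
    by (intro continuous_at_imp_continuous_on ballI test_function_deriv sm)+
  have i1: "(\<lambda>x. deriv \<phi> x *\<^sub>R f x) absolutely_integrable_on {x..y}" if "{x..y} \<subseteq> U" for x y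
    by (intro absolutely_integrable_continuous_real continuous_intros fc \<phi>c that)
  have i2: "(\<lambda>x. \<phi> x *\<^sub>R g x) absolutely_integrable_on {x..y}" if "x \<le> y" "{x..y} \<subseteq> U" for x y
  proof (rule absolutely_integrable_bounded_measurable_product[OF bilinear_conv_bounded_bilinear[THEN iffD2, OF bounded_bilinear_scaleR]])
    show "\<phi> \<in> borel_measurable (lebesgue_on {x..y})"
      by (rule continuous_imp_measurable_on_sets_lebesgue[OF \<phi>c(1)]) auto
    show "bounded (\<phi> ` {x..y})" by (intro compact_imp_bounded compact_continuous_image \<phi>c compact_Icc)
  qed (use antideriv_onD(1)[OF fg that] in auto)
  note I1 = absolutely_integrable_on_compact[OF U i1 K]
  note I2 = absolutely_integrable_on_compact[OF U i2 K]
  \<comment> \<open>f is arbitrary outside U, so the product is cut off there; its derivative lives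
    on the compact K, where both terms are integrable.\<close>
  define F where "F x = (if x \<in> U then \<phi> x *\<^sub>R f x else 0)" for x
  define P where "P x = (if x \<in> K then deriv \<phi> x *\<^sub>R f x + \<phi> x *\<^sub>R g x else 0)" for x
  have "ac_at F z" for z
  proof (cases "z \<in> U")
    case True
    have "ac_at (\<lambda>x. \<phi> x *\<^sub>R f x) z"
      by (intro ac_at_bilinear[OF bounded_bilinear_scaleR] test_function_ac_at sm antideriv_on_ac_at[OF U fg True])
    then show ?thesis by (rule ac_at_cong[OF _ U True]) (simp add: F_def)
  next
    case False
    show ?thesis
      by (rule ac_at_cong[OF ac_at_const opK]) (use False K \<phi>0 in \<open>auto simp: F_def\<close>)
  qed
  then have AF: "antideriv_on UNIV F (\<lambda>x. vector_derivative F (at x))" by (intro ac_at_antideriv)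
  have ne: "negligible {x \<in> UNIV. vector_derivative F (at x) \<noteq> P x}"
  proof (rule negligible_subset[OF antideriv_on_has_vector_derivative[OF U fg]], rule subsetI, rule ccontr)
    fix x assume x: "x \<in> {x \<in> UNIV. vector_derivative F (at x) \<noteq> P x}" and
      "x \<notin> {x \<in> U. \<not> (f has_vector_derivative g x) (at x)}"
    then have *: "x \<in> U \<Longrightarrow> (f has_vector_derivative g x) (at x)" by simp
    have "(F has_vector_derivative P x) (at x)"
    proof (cases "x \<in> K")
      case True
      then have xU: "x \<in> U" using K by blast
      have "((\<lambda>x. \<phi> x *\<^sub>R f x) has_vector_derivative (\<phi> x *\<^sub>R g x + deriv \<phi> x *\<^sub>R f x)) (at x)"
        by (rule has_vector_derivative_scaleR[OF test_function_deriv(1)[OF sm] *[OF xU]])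
      then have "(F has_vector_derivative (\<phi> x *\<^sub>R g x + deriv \<phi> x *\<^sub>R f x)) (at x)"
        by (rule has_vector_derivative_transform_within_open[OF _ U xU]) (simp add: F_def)
      then show ?thesis using True by (simp add: P_def add.commute)
    next
      case False
      have "((\<lambda>x. 0) has_vector_derivative P x) (at x)" using False by (simp add: P_def)
      then show ?thesis
        by (rule has_vector_derivative_transform_within_open[OF _ opK]) (use False \<phi>0 in \<open>auto simp: F_def\<close>)
    qed
    then show False using x vector_derivative_at by auto
  qed
  have AP: "antideriv_on UNIV F P" by (rule antideriv_on_cong_ae[OF AF ne])
  obtain r where r: "r > 0" "\<And>x. x \<in> K \<Longrightarrow> \<bar>x\<bar> < r"
    using compact_imp_bounded[OF K(1)] by (auto simp: bounded_pos_less)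
  have KI: "K \<subseteq> {-r..r}" using r(2) by (force simp: abs_less_iff)
  have "F r = 0" "F (- r) = 0" using r \<phi>0[of r] \<phi>0[of "- r"] by (force simp: F_def)+
  then have "0 = integral {-r..r} P" using antideriv_onD(3)[OF AP, of "-r" r] r(1) by simp
  also have "\<dots> = integral (K \<inter> {-r..r}) (\<lambda>x. deriv \<phi> x *\<^sub>R f x + \<phi> x *\<^sub>R g x)"
    unfolding P_def by (rule HK_restrict_Int)
  also have "K \<inter> {-r..r} = K" using KI by blast
  also have "integral K (\<lambda>x. deriv \<phi> x *\<^sub>R f x + \<phi> x *\<^sub>R g x) =
    integral K (\<lambda>x. deriv \<phi> x *\<^sub>R f x) + integral K (\<lambda>x. \<phi> x *\<^sub>R g x)"
    using I1 I2 by (intro HK_add) (auto simp: set_lebesgue_integral_eq_integral(1))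
  also have "integral K (\<lambda>x. deriv \<phi> x *\<^sub>R f x) = (\<integral>x. deriv \<phi> x *\<^sub>R f x \<partial>lebesgue_on U)"
    using I1 d\<phi>0 Ks K lebesgue_integral_eq_integral[of K "\<lambda>x. deriv \<phi> x *\<^sub>R f x"]
    by (subst integral_lebesgue_on_subset(2)[of K U]) (auto simp: absolutely_integrable_on_iff_integrable)
  also have "integral K (\<lambda>x. \<phi> x *\<^sub>R g x) = (\<integral>x. \<phi> x *\<^sub>R g x \<partial>lebesgue_on U)"
    using I2 \<phi>0 Ks K lebesgue_integral_eq_integral[of K "\<lambda>x. \<phi> x *\<^sub>R g x"]
    by (subst integral_lebesgue_on_subset(2)[of K U]) (auto simp: absolutely_integrable_on_iff_integrable)
  finally show "(\<integral>x. deriv \<phi> x *\<^sub>R f x \<partial>lebesgue_on U) = - (\<integral>x. \<phi> x *\<^sub>R g x \<partial>lebesgue_on U)"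
    by (simp add: eq_neg_iff_add_eq_0)
qed

text \<open>Measurability is a local matter: g is integrable on each of the countably many rational
  intervals that exhaust U.\<close>

lemma antideriv_on_measurable:
  fixes f :: "real \<Rightarrow> 'b::euclidean_space"
  assumes U: "open U" and fg: "antideriv_on U f g"
  shows "g \<in> borel_measurable (lebesgue_on U)"
proof (rule measurable_piecewise_restrict)
  define C where "C = (\<lambda>(a,b). {a..b::real}) ` {(a,b). a \<in> \<rat> \<and> b \<in> \<rat> \<and> a \<le> b \<and> {a..b} \<subseteq> U}"
  have "{(a,b). a \<in> \<rat> \<and> b \<in> \<rat> \<and> a \<le> b \<and> {a..b} \<subseteq> U} \<subseteq> \<rat> \<times> (\<rat>::real set)" by auto
  then show "countable C" unfolding C_def
    by (intro countable_image) (meson countable_SIGMA countable_rat countable_subset)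
  show "space (lebesgue_on U) \<subseteq> \<Union>C"
  proof
    fix x assume "x \<in> space (lebesgue_on U)"
    then have x: "x \<in> U" by simp
    obtain r where r: "r > 0" "ball x r \<subseteq> U" using U x openE by blast
    obtain p where p: "p \<in> \<rat>" "x - r < p" "p < x" using Rats_dense_in_real[of "x-r" x] r by auto
    obtain q where q: "q \<in> \<rat>" "x < q" "q < x + r" using Rats_dense_in_real[of x "x+r"] r by auto
    have "{p..q} \<subseteq> U" using p q r(2) by (auto simp: dist_real_def subset_iff)
    then have "{p..q} \<in> C" using p q by (auto simp: C_def intro!: image_eqI[of _ _ "(p,q)"])
    then show "x \<in> \<Union>C" using p q by (intro UnionI[of "{p..q}"]) auto
  qed
  fix S assume "S \<in> C"
  then obtain a b where S: "S = {a..b}" "a \<le> b" "{a..b} \<subseteq> U" by (auto simp: C_def)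
  have Us: "U \<in> sets lebesgue" using U by (simp add: borel_open)
  have SU: "S \<inter> U = S" using S by blast
  show "S \<inter> space (lebesgue_on U) \<in> sets (lebesgue_on U)"
    using S Us SU by (simp add: sets_restrict_space_iff)
  have "g absolutely_integrable_on S" using antideriv_onD(1)[OF fg S(2,3)] S(1) by simp
  then have "g \<in> borel_measurable (lebesgue_on S)"
    using S(1) by (simp add: absolutely_integrable_measurable)
  moreover have "restrict_space (lebesgue_on U) S = lebesgue_on S"
    using S(1) Us SU by (subst restrict_restrict_space) (auto simp: Int_commute)
  ultimately show "g \<in> borel_measurable (restrict_space (lebesgue_on U) S)" by simp
qed

section \<open>Symmetric traceless matrices\<close>

lemma tensor_mult_vec: "tensor u v *v x = (v \<bullet> x) *\<^sub>R u"
  by (simp add: tensor_def matrix_vector_mult_def vec_eq_iff inner_vec_def sum_distrib_left mult_ac)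

lemma inner_tensor_right: "A \<bullet> tensor u v = u \<bullet> (A *v v)"
  by (simp add: tensor_def matrix_vector_mult_def inner_vec_def sum_distrib_left mult_ac)

lemma inner_tensor_tensor: "tensor u v \<bullet> tensor x y = (u \<bullet> x) * (v \<bullet> y)"
  by (simp add: inner_tensor_right tensor_mult_vec inner_commute)

lemma norm_tensor: "norm (tensor u v) = norm u * norm v"
  by (simp add: norm_eq_sqrt_inner inner_tensor_tensor real_sqrt_mult)

lemma trace_tensor: "trace (tensor u v) = u \<bullet> v"
  by (simp add: trace_def tensor_def inner_vec_def)

lemma trace_scaleR: "trace (c *\<^sub>R (A :: real^'n^'n)) = c * trace A"
  by (simp add: trace_def sum_distrib_left)

lemma matrix_vector_mult_scaleR_left: "(c *\<^sub>R (A :: real^'n^'m)) *v x = c *\<^sub>R (A *v x)"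
  by (simp add: matrix_vector_mult_def vec_eq_iff sum_distrib_left mult_ac)

lemma symmetric_inner: "transpose A = A \<Longrightarrow> x \<bullet> (A *v y) = (A *v x) \<bullet> (y :: real^'n)"
  by (metis dot_lmul_matrix transpose_matrix_vector)

text \<open>For z = v \<times> w the double product z \<times> (x \<times> z) is x minus its
  z-component; expanding x \<times> z first gives the same vector in terms of v and w.\<close>

lemma orthonormal_expansion:
  fixes v w x :: "real^3"
  assumes "norm v = 1" "norm w = 1" "v \<bullet> w = 0"
  shows "x = (v \<bullet> x) *\<^sub>R v + (w \<bullet> x) *\<^sub>R w + (cross3 v w \<bullet> x) *\<^sub>R cross3 v w"
proof -
  define z where "z = cross3 v w"
  have vv: "v \<bullet> v = 1" "w \<bullet> w = 1" using assms by (simp_all add: norm_eq_1)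
  have "norm z ^ 2 = 1"
    using norm_cross_dot[of v w] assms by (simp add: z_def)
  then have zz: "z \<bullet> z = 1" by (simp add: power2_norm_eq_inner)
  have 1: "cross3 x z = (x \<bullet> w) *\<^sub>R v - (x \<bullet> v) *\<^sub>R w" for x
    unfolding z_def by (rule Lagrange)
  have "cross3 z v = w" "cross3 z w = - v"
    using 1[of v] 1[of w] vv assms(3) cross_skew[of z v] cross_skew[of z w] by (simp_all add: inner_commute)
  moreover have "cross3 z (cross3 x z) = (z \<bullet> z) *\<^sub>R x - (z \<bullet> x) *\<^sub>R z"
    by (rule Lagrange)
  moreover have "cross3 z (cross3 x z) = (x \<bullet> w) *\<^sub>R cross3 z v - (x \<bullet> v) *\<^sub>R cross3 z w"
    unfolding 1 by (simp add: cross_components vec_eq_iff cross3_simps)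
  ultimately show ?thesis using zz by (simp add: z_def algebra_simps inner_commute)
qed

abbreviation deviator :: "real^3 \<Rightarrow> real^3^3" where
  "deviator u \<equiv> tensor u u - (1/3) *\<^sub>R mat 1"

definition biaxial_tensor :: "real \<Rightarrow> real \<Rightarrow> real^3 \<Rightarrow> real^3 \<Rightarrow> real^3^3" where
  "biaxial_tensor s1 s2 v w = s1 *\<^sub>R deviator v + s2 *\<^sub>R deviator w"

lemma biaxial_tensor_mult_vec:
  "biaxial_tensor s1 s2 v w *v x = (s1 * (v \<bullet> x)) *\<^sub>R v + (s2 * (w \<bullet> x)) *\<^sub>R w - ((s1 + s2)/3) *\<^sub>R x"
  by (simp add: biaxial_tensor_def matrix_vector_mult_add_rdistrib matrix_vector_mult_diff_rdistrib
      matrix_vector_mult_scaleR_left tensor_mult_vec algebra_simps flip: scaleR_add_left)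

lemma biaxial_tensor_quadratic:
  "x \<bullet> (biaxial_tensor s1 s2 v w *v x) = s1 * (v \<bullet> x)\<^sup>2 + s2 * (w \<bullet> x)\<^sup>2 - (s1 + s2)/3 * (x \<bullet> x)"
  by (simp add: biaxial_tensor_mult_vec inner_add_right inner_diff_right inner_commute power2_eq_square algebra_simps)

text \<open>Negation exchanges the two directors together with their order parameters, which reduces
  statements about m to statements about n.\<close>

lemma biaxial_tensor_minus: "- biaxial_tensor s1 s2 v w = biaxial_tensor (- s2) (- s1) w v"
  by (simp add: biaxial_tensor_def)

lemma biaxial_tensor_symmetric: "transpose (biaxial_tensor s1 s2 v w) = biaxial_tensor s1 s2 v w"
proof -
  have "biaxial_tensor s1 s2 v w $ i $ j = biaxial_tensor s1 s2 v w $ j $ i" for i j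
    by (auto simp: biaxial_tensor_def tensor_def mat_def mult.commute)
  then show ?thesis by (simp add: transpose_def vec_eq_iff)
qed

lemma biaxial_tensor_trace:
  assumes "s1 \<noteq> 0 \<Longrightarrow> norm v = 1" "s2 \<noteq> 0 \<Longrightarrow> norm w = 1"
  shows "trace (biaxial_tensor s1 s2 v w) = 0"
proof -
  have "trace (s *\<^sub>R deviator v) = 0" if "s \<noteq> 0 \<Longrightarrow> norm v = 1" for s v
    using that by (cases "s = 0") (auto simp: trace_scaleR trace_sub trace_tensor trace_I norm_eq_1 trace_def[of 0])
  then show ?thesis using assms unfolding biaxial_tensor_def trace_add by simp
qed

text \<open>Compare the quadratic forms of both matrices at the two leading directions.\<close>

lemma leading_direction_perturbation:
  assumes "Q = biaxial_tensor s1 s2 v w" "R = biaxial_tensor r1 r2 v' w'"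
    and "0 \<le> s1" "s2 \<le> 0" "0 \<le> r1" "r2 \<le> 0"
    and "norm v = 1" "v \<bullet> w = 0" "norm v' = 1" "v' \<bullet> w' = 0"
  shows "s1 * norm (tensor v v - tensor v' v') \<le> 2 * norm (Q - R)"
proof -
  define c where "c = v \<bullet> v'"
  have vv: "v \<bullet> v = 1" "v' \<bullet> v' = 1" using assms by (simp_all add: norm_eq_1)
  define D where "D = tensor v v - tensor v' v'"
  have D2: "(norm D)\<^sup>2 = 2 * (1 - c\<^sup>2)"
    unfolding power2_norm_eq_inner
    using vv by (simp add: D_def inner_diff_left inner_diff_right inner_tensor_tensor
        c_def power2_eq_square inner_commute)
  \<comment> \<open>v maximises the quadratic form of Q, and a competitor at cosine c loses at least
    the gap s1 times 1 - c^2; the w-term only adds to the loss.\<close>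
  have "s1 * (1 - c\<^sup>2) \<le> v \<bullet> (Q *v v) - v' \<bullet> (Q *v v')"
  proof -
    have "s2 * (w \<bullet> v')\<^sup>2 \<le> 0" using assms by (simp add: mult_nonpos_nonneg)
    then show ?thesis using assms vv by (simp add: biaxial_tensor_quadratic c_def algebra_simps inner_commute)
  qed
  moreover have "0 \<le> v' \<bullet> (R *v v') - v \<bullet> (R *v v)"
  proof -
    have "c\<^sup>2 \<le> 1" using D2 zero_le_power2[of "norm D"] by simp
    then have "r1 * c\<^sup>2 \<le> r1 * 1" using assms by (intro mult_left_mono)
    moreover have "r2 * (w' \<bullet> v)\<^sup>2 \<le> 0" using assms by (simp add: mult_nonpos_nonneg)
    ultimately show ?thesis using assms vv by (simp add: biaxial_tensor_quadratic c_def algebra_simps inner_commute)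
  qed
  ultimately have "s1 * (1 - c\<^sup>2) \<le> (Q - R) \<bullet> D"
    by (simp add: D_def inner_diff_right inner_tensor_right matrix_vector_mult_diff_rdistrib)
  also have "\<dots> \<le> norm (Q - R) * norm D" by (rule norm_cauchy_schwarz)
  \<comment> \<open>As |D|^2 = 2 (1 - c^2), one power of |D| can be cancelled; this is the origin of
    the factor 2.\<close>
  finally have "norm D * (s1 * norm D) \<le> norm D * (2 * norm (Q - R))"
    using arg_cong[OF D2, of "\<lambda>x. s1 * x"] by (simp add: power2_eq_square algebra_simps)
  then show ?thesis
    by (cases "norm D = 0") (auto simp: D_def[symmetric])
qed

text \<open>With c = v \<bullet> w the two squares are 2 (1 - c) and 2 (1 - c) (1 + c); the
  condition 0 \<le> c means that the nearer of the two signs has been taken.\<close>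

lemma norm_diff_le_tensor_diff:
  fixes v w :: "real^3"
  assumes "norm v = 1" "norm w = 1" "0 \<le> v \<bullet> w"
  shows "norm (v - w) \<le> norm (tensor v v - tensor w w)"
proof (rule power2_le_imp_le)
  define c where "c = v \<bullet> w"
  have vv: "v \<bullet> v = 1" "w \<bullet> w = 1" using assms by (simp_all add: norm_eq_1)
  have c: "0 \<le> c" "c \<le> 1" using assms norm_cauchy_schwarz[of v w] by (auto simp: c_def)
  have "(norm (v - w))\<^sup>2 = 2 * (1 - c)"
    using vv by (simp add: power2_norm_eq_inner inner_diff_left inner_diff_right c_def inner_commute)
  also have "\<dots> \<le> 2 * ((1 - c) * (1 + c))" using c by (intro mult_left_mono) (auto simp: mult_le_cancel_left1)
  also have "\<dots> = (norm (tensor v v - tensor w w))\<^sup>2"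
    unfolding power2_norm_eq_inner
    using vv by (simp add: inner_diff_left inner_diff_right inner_tensor_tensor
        c_def power2_eq_square inner_commute algebra_simps)
  finally show "(norm (v - w))\<^sup>2 \<le> (norm (tensor v v - tensor w w))\<^sup>2" .
qed simp

section \<open>Extremal eigenvalues of a symmetric matrix\<close>

definition lmax :: "real^3^3 \<Rightarrow> real" where
  "lmax Q = (SUP v\<in>sphere 0 1. v \<bullet> (Q *v v))"

lemma lmax_attained:
  obtains v where "norm v = 1" "v \<bullet> (Q *v v) = lmax Q" "\<And>x. x \<bullet> (Q *v x) \<le> lmax Q * (x \<bullet> x)"
proof -
  have cont: "continuous_on (sphere 0 1) (\<lambda>v. v \<bullet> (Q *v v))"
    by (intro continuous_intros linear_continuous_on matrix_vector_mul_bounded_linear)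
  have ne: "sphere 0 1 \<noteq> ({} :: (real^3) set)" by simp
  obtain v where v: "v \<in> sphere 0 1" "\<And>w. w \<in> sphere 0 1 \<Longrightarrow> w \<bullet> (Q *v w) \<le> v \<bullet> (Q *v v)"
    using continuous_attains_sup[OF compact_sphere ne cont] by blast
  have eq: "lmax Q = v \<bullet> (Q *v v)"
    unfolding lmax_def using v by (intro cSup_eq_maximum) auto
  have "x \<bullet> (Q *v x) \<le> lmax Q * (x \<bullet> x)" for x
  proof (cases "x = 0")
    case False
    define y where "y = (1 / norm x) *\<^sub>R x"
    have x: "x = norm x *\<^sub>R y" and y: "y \<in> sphere 0 1" using False by (auto simp: y_def)
    have "x \<bullet> (Q *v x) = (norm x)\<^sup>2 * (y \<bullet> (Q *v y))"
      by (subst (1 2) x) (simp add: matrix_vector_mult_scaleR power2_eq_square)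
    also have "\<dots> \<le> (norm x)\<^sup>2 * lmax Q" using v(2)[OF y] eq by (intro mult_left_mono) auto
    finally show ?thesis by (simp add: power2_norm_eq_inner mult.commute)
  qed simp
  then show thesis using that[of v] v(1) eq by auto
qed

text \<open>A maximiser for one matrix is a competitor for the other, and at a unit vector v the
  quadratic form changes by at most the Frobenius norm of the difference, as v \<otimes> v has norm
  1. No eigenvector has to be followed.\<close>

lemma lmax_lipschitz: "\<bar>lmax Q - lmax R\<bar> \<le> norm (Q - R)"
proof -
  have "lmax Q \<le> lmax R + norm (Q - R)" for Q R
  proof -
    obtain v where v: "norm v = 1" "v \<bullet> (Q *v v) = lmax Q" using lmax_attained .
    have u: "x \<bullet> (R *v x) \<le> lmax R * (x \<bullet> x)" for x using lmax_attained[of R] by metis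
    have "lmax Q = v \<bullet> (R *v v) + (Q - R) \<bullet> tensor v v"
      using v by (simp add: inner_tensor_right matrix_vector_mult_diff_rdistrib inner_diff_right)
    also have "(Q - R) \<bullet> tensor v v \<le> norm (Q - R) * norm (tensor v v)" by (rule norm_cauchy_schwarz)
    finally show ?thesis using u[of v] v by (simp add: norm_tensor norm_eq_1)
  qed
  from this[of Q R] this[of R Q] show ?thesis by (auto simp: norm_minus_commute abs_le_iff)
qed

text \<open>First variation in the direction of the residual w = Q v - l v: a nonzero residual would
  raise the quadratic form above its bound to first order in s.\<close>

lemma maximizer_eigenvector:
  assumes "transpose Q = Q" and v: "v \<bullet> (Q *v v) = l * (v \<bullet> v)" and max: "\<And>x. x \<bullet> (Q *v x) \<le> l * (x \<bullet> x)"
  shows "Q *v v = l *\<^sub>R (v :: real^'n)"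
proof -
  define w where "w = Q *v v - l *\<^sub>R v"
  define c where "c = w \<bullet> (Q *v w) - l * (w \<bullet> w)"
  have ineq: "2 * s * (w \<bullet> w) + s\<^sup>2 * c \<le> 0" for s
  proof -
    have "(v + s *\<^sub>R w) \<bullet> (Q *v (v + s *\<^sub>R w)) - l * ((v + s *\<^sub>R w) \<bullet> (v + s *\<^sub>R w)) \<le> 0" using max by simp
    moreover have "v \<bullet> (Q *v w) = w \<bullet> (Q *v v)" using symmetric_inner[OF assms(1), of v w] by (simp add: inner_commute)
    ultimately have "2 * s * (w \<bullet> (Q *v v) - l * (w \<bullet> v)) + s\<^sup>2 * c \<le> 0"
      using v by (simp add: matrix_vector_right_distrib matrix_vector_mult_scaleR inner_add_left inner_add_right
          c_def power2_eq_square algebra_simps inner_commute)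
    moreover have "w \<bullet> (Q *v v) - l * (w \<bullet> v) = w \<bullet> w" by (simp add: w_def inner_diff_right)
    ultimately show ?thesis by simp
  qed
  have "c \<le> 0" using max[of w] by (simp add: c_def)
  have "w \<bullet> w \<le> 0"
  proof (rule ccontr)
    assume "\<not> w \<bullet> w \<le> 0"
    then have p: "w \<bullet> w > 0" by linarith
    \<comment> \<open>This s satisfies s c = s - w \<bullet> w, hence 2 (w \<bullet> w) + s c = w
      \<bullet> w + s is positive.\<close>
    define s where "s = (w \<bullet> w) / (1 - c)"
    have s: "s > 0" using p \<open>c \<le> 0\<close> by (simp add: s_def)
    have "s * (2 * (w \<bullet> w) + s * c) \<le> 0" using ineq[of s] by (simp add: power2_eq_square algebra_simps)
    then have "2 * (w \<bullet> w) + s * c \<le> 0" using s by (simp add: mult_le_0_iff)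
    moreover have "s * (1 - c) = w \<bullet> w" using \<open>c \<le> 0\<close> by (simp add: s_def)
    ultimately show False using p s by (simp add: algebra_simps)
  qed
  then have "w = 0" using inner_gt_zero_iff[of w] by linarith
  then show ?thesis by (simp add: w_def)
qed

text \<open>For a symmetric traceless matrix \<lambda>2 = - \<lambda>1 - \<lambda>3 and \<lambda>3 =
  - \<open>lmax (- Q)\<close>. So \<open>order1\<close> and \<open>order2\<close> are the gaps
  \<lambda>1 - \<lambda>2 and \<lambda>3 - \<lambda>2 written without the middle eigenvalue, and
  Lipschitz continuity is inherited from \<open>lmax\<close>.\<close>

definition order1 :: "real^3^3 \<Rightarrow> real" where "order1 Q = 2 * lmax Q - lmax (- Q)"
definition order2 :: "real^3^3 \<Rightarrow> real" where "order2 Q = lmax Q - 2 * lmax (- Q)"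

text \<open>Eigenvectors for the two extremal eigenvalues are orthogonal when these differ; their
  cross product is then a third eigenvector, whose eigenvalue is fixed by the trace.\<close>

lemma biaxial_decomposition:
  assumes sym: "transpose Q = Q" and tr: "trace Q = 0"
  obtains v w where "norm v = 1" "norm w = 1" "v \<bullet> w = 0" "0 \<le> order1 Q" "order2 Q \<le> 0"
    "Q = biaxial_tensor (order1 Q) (order2 Q) v w"
proof -
  define l where "l = lmax Q"
  define k where "k = - lmax (- Q)"
  obtain v where v: "norm v = 1" "v \<bullet> (Q *v v) = l" and max: "\<And>x. x \<bullet> (Q *v x) \<le> l * (x \<bullet> x)"
    using lmax_attained unfolding l_def by blast
  have mm: "(- Q) *v x = - (Q *v x)" for x
    using matrix_vector_mult_scaleR_left[of "-1" Q x] by simp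
  obtain w where w: "norm w = 1" "w \<bullet> (Q *v w) = k" and min: "\<And>x. k * (x \<bullet> x) \<le> x \<bullet> (Q *v x)"
    using lmax_attained[of "- Q"] unfolding k_def mm inner_minus_right
    by (metis minus_le_iff minus_minus mult_minus_left neg_equal_iff_equal)
  have vw1: "v \<bullet> v = 1" "w \<bullet> w = 1" using v w by (simp_all add: norm_eq_1)
  have s12: "order1 Q = 2 * l + k" "order2 Q = l + 2 * k" by (simp_all add: order1_def order2_def l_def k_def)
  have Qv: "Q *v v = l *\<^sub>R v" using maximizer_eigenvector[OF sym _ max] v vw1 by simp
  have symm: "transpose (- Q) = - Q" using sym by (simp add: transpose_def vec_eq_iff)
  have "(- Q) *v w = (- k) *\<^sub>R w"
    by (rule maximizer_eigenvector[OF symm]) (use w vw1 min in \<open>auto simp: mm\<close>)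
  then have Qw: "Q *v w = k *\<^sub>R w" by (simp add: mm)
  show thesis
  proof (cases "l = k")
    case True
    \<comment> \<open>A single eigenvalue makes Q a multiple of the identity and the trace forces Q
      = 0, so any orthonormal pair serves.\<close>
    have q: "x \<bullet> (Q *v x) = l * (x \<bullet> x)" for x using max[of x] min[of x] True by simp
    then have Qx: "Q *v x = l *\<^sub>R x" for x using maximizer_eigenvector[of Q x l] sym q by simp
    have Ql: "Q = l *\<^sub>R mat 1" by (simp add: matrix_eq Qx matrix_vector_mult_scaleR_left)
    then have "l * 3 = 0" using tr by (simp add: trace_scaleR trace_I)
    then have l0: "l = 0" by simp
    have "axis 1 1 \<bullet> (axis 2 1 :: real^3) = 0" by (simp add: inner_axis) (simp add: axis_def)
    then show thesis
      by (intro that[of "axis 1 1" "axis 2 1"]) (use l0 True Ql s12 in \<open>auto simp: biaxial_tensor_def\<close>)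
  next
    case False
    have "l * (v \<bullet> w) = k * (v \<bullet> w)" using symmetric_inner[OF sym, of v w, symmetric] unfolding Qv Qw by (simp only: inner_scaleR_left inner_scaleR_right)
    then have vw: "v \<bullet> w = 0" using False by auto
    define z where "z = cross3 v w"
    note ex = orthonormal_expansion[OF v(1) w(1) vw, folded z_def]
    have vz: "v \<bullet> z = 0" "w \<bullet> z = 0" by (simp_all add: z_def dot_cross_self)
    have "norm z ^ 2 = 1" using norm_cross_dot[of v w] v w vw by (simp add: z_def)
    then have zz: "z \<bullet> z = 1" by (simp add: power2_norm_eq_inner)
    define \<mu> where "\<mu> = z \<bullet> (Q *v z)"
    have "v \<bullet> (Q *v z) = 0" "w \<bullet> (Q *v z) = 0"
      using symmetric_inner[OF sym, of v z] symmetric_inner[OF sym, of w z] vz by (simp_all add: Qv Qw)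
    then have Qz: "Q *v z = \<mu> *\<^sub>R z" using ex[of "Q *v z"] by (simp add: \<mu>_def)
    have Qx: "Q *v x = (l * (v \<bullet> x)) *\<^sub>R v + (k * (w \<bullet> x)) *\<^sub>R w + (\<mu> * (z \<bullet> x)) *\<^sub>R z" for x
      by (subst ex[of x]) (simp add: matrix_vector_right_distrib matrix_vector_mult_scaleR Qv Qw Qz mult.commute)
    have "Q = l *\<^sub>R tensor v v + k *\<^sub>R tensor w w + \<mu> *\<^sub>R tensor z z"
      by (simp add: matrix_eq Qx matrix_vector_mult_add_rdistrib matrix_vector_mult_scaleR_left tensor_mult_vec)
    then have "trace Q = l + k + \<mu>" by (simp add: trace_add trace_scaleR trace_tensor vw1 zz)
    then have \<mu>: "\<mu> = - l - k" using tr by simp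
    have "\<mu> \<le> l" "k \<le> \<mu>" using max[of z] min[of z] zz by (simp_all add: \<mu>_def)
    then have s: "0 \<le> order1 Q" "order2 Q \<le> 0" by (simp_all add: s12 \<mu>)
    have "Q *v x = biaxial_tensor (order1 Q) (order2 Q) v w *v x" for x
    proof -
      \<comment> \<open>The isotropic part of the biaxial tensor, -(s1 + s2)/3 times the identity,
        carries the middle eigenvalue \<mu>.\<close>
      have "(order1 Q + order2 Q)/3 = l + k" by (simp add: s12)
      then have "((order1 Q + order2 Q)/3) *\<^sub>R x = (l + k) *\<^sub>R ((v \<bullet> x) *\<^sub>R v + (w \<bullet> x) *\<^sub>R w + (z \<bullet> x) *\<^sub>R z)"
        using ex[of x] by simp
      note A = this
      show ?thesis
        unfolding biaxial_tensor_mult_vec A Qx by (simp add: s12 \<mu> vec_eq_iff algebra_simps)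
    qed
    then have "Q = biaxial_tensor (order1 Q) (order2 Q) v w" by (simp add: matrix_eq)
    then show thesis using that[OF v(1) w(1) vw s] by blast
  qed
qed

lemma order_lipschitz:
  "\<bar>order1 Q - order1 R\<bar> \<le> 3 * norm (Q - R)" "\<bar>order2 Q - order2 R\<bar> \<le> 3 * norm (Q - R)"
  using lmax_lipschitz[of Q R] lmax_lipschitz[of "- Q" "- R"] norm_minus_commute[of Q R]
  unfolding order1_def order2_def by auto

section \<open>Continuous choice of directors\<close>

text \<open>In the half space of z a small distance of projections is a small distance of vectors.
  Both vectors are within 1/2 of z, so within 1 of each other, and |x - y|^2 = 2 - 2 (x \<bullet>
  y).\<close>

lemma nearby_tensors_same_sign:
  fixes x y z :: "real^3"
  assumes "norm x = 1" "norm y = 1" "norm z = 1" "0 \<le> x \<bullet> z" "0 \<le> y \<bullet> z"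
    "norm (tensor x x - tensor z z) < 1/2" "norm (tensor y y - tensor z z) < 1/2"
  shows "0 < x \<bullet> y"
proof -
  have "norm (x - z) < 1/2" "norm (y - z) < 1/2"
    using norm_diff_le_tensor_diff[of x z] norm_diff_le_tensor_diff[of y z] assms by linarith+
  then have "norm (x - y) < 1" using norm_triangle_ineq4[of "x - z" "y - z"] by simp
  then have "(norm (x - y))\<^sup>2 < 1" by (simp add: power_less_one_iff)
  moreover have "(norm (x - y))\<^sup>2 = 2 - 2 * (x \<bullet> y)"
    using assms unfolding power2_norm_eq_inner
    by (simp add: inner_diff_left inner_diff_right norm_eq_1 inner_commute)
  ultimately show ?thesis by linarith
qed

text \<open>v describes a curve of lines by unit vectors of arbitrary sign; a sign lift is a
  continuous lift of that curve from the projective plane to the sphere.\<close>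

definition sign_lift :: "(real \<Rightarrow> real^3) \<Rightarrow> real set \<Rightarrow> (real \<Rightarrow> real^3) \<Rightarrow> bool" where
  "sign_lift v S n \<longleftrightarrow> continuous_on S n \<and> (\<forall>x\<in>S. n x = v x \<or> n x = - v x)"

lemma tensor_minus_minus: "tensor (- v) (- v) = tensor v v"
  by (simp add: tensor_def)

text \<open>Near z the sign is fixed by the half space of v z. The chosen vectors are then at acute
  angles to each other, and continuity passes from the projections to the vectors.\<close>

lemma sign_lift_local:
  assumes v: "\<And>x. x \<in> U \<Longrightarrow> norm (v x) = 1" and cont: "continuous_on U (\<lambda>x. tensor (v x) (v x))" and U: "open U" "z \<in> U"
  obtains e n where "e > 0" "ball z e \<subseteq> U" "sign_lift v (ball z e) n"
proof -
  obtain d where d: "d > 0" "\<And>x. x \<in> U \<Longrightarrow> dist x z < d \<Longrightarrow> norm (tensor (v x) (v x) - tensor (v z) (v z)) < 1/2"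
    using cont[unfolded continuous_on_iff, rule_format, OF U(2), of "1/2"] by (auto simp: dist_norm)
  obtain r where r: "r > 0" "ball z r \<subseteq> U" using U openE by blast
  define e where "e = min d r"
  have e: "e > 0" "ball z e \<subseteq> U" using d(1) r by (auto simp: e_def)
  define n where "n x = (if 0 \<le> v x \<bullet> v z then v x else - v x)" for x
  have n: "n x = v x \<or> n x = - v x" "0 \<le> n x \<bullet> v z" "tensor (n x) (n x) = tensor (v x) (v x)" for x
    by (auto simp: n_def tensor_minus_minus)
  have n1: "norm (n x) = 1" if "x \<in> U" for x using v[OF that] by (simp add: n_def)
  have close: "norm (n x - n y) \<le> norm (tensor (v x) (v x) - tensor (v y) (v y))" if xy: "x \<in> ball z e" "y \<in> ball z e" for x y
  proof -
    have "x \<in> U" "y \<in> U" "dist x z < d" "dist y z < d" using xy e by (auto simp: e_def dist_commute)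
    then have "0 < n x \<bullet> n y"
      using n1 v U(2) n d(2) by (intro nearby_tensors_same_sign[of _ _ "v z"]) auto
    then show ?thesis using norm_diff_le_tensor_diff[of "n x" "n y"] n1 \<open>x \<in> U\<close> \<open>y \<in> U\<close> n(3) by simp
  qed
  have "continuous_on (ball z e) n"
    unfolding continuous_on_iff
  proof (intro ballI allI impI)
    fix x and \<epsilon> :: real assume x: "x \<in> ball z e" "0 < \<epsilon>"
    then obtain \<delta> where "\<delta> > 0" "\<And>y. y \<in> U \<Longrightarrow> dist y x < \<delta> \<Longrightarrow> dist (tensor (v y) (v y)) (tensor (v x) (v x)) < \<epsilon>"
      using cont e unfolding continuous_on_iff by (metis subsetD)
    then have "dist (n y) (n x) < \<epsilon>" if "y \<in> ball z e" "dist y x < \<delta>" for y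
      using close[OF that(1) x(1)] that e by (metis dist_norm order_le_less_trans subsetD)
    then show "\<exists>\<delta>>0. \<forall>y\<in>ball z e. dist y x < \<delta> \<longrightarrow> dist (n y) (n x) < \<epsilon>" using \<open>\<delta> > 0\<close> by blast
  qed
  then show thesis using that[OF e, of n] n(1) by (auto simp: sign_lift_def)
qed

lemma sign_lift_subset: "sign_lift v S n \<Longrightarrow> T \<subseteq> S \<Longrightarrow> sign_lift v T n"
  by (auto simp: sign_lift_def intro: continuous_on_subset)

lemma sign_lift_minus: "sign_lift v S n \<Longrightarrow> sign_lift v S (\<lambda>x. - n x)"
  by (auto simp: sign_lift_def intro!: continuous_on_minus)

text \<open>Bisection: two lifts on adjacent intervals are matched at the common endpoint by
  reversing one of them if necessary.\<close>

lemma sign_lift_interval: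
  assumes v: "\<And>x. x \<in> U \<Longrightarrow> norm (v x) = 1" and cont: "continuous_on U (\<lambda>x. tensor (v x) (v x))" and U: "open U"
    and ab: "a \<le> b" "{a..b} \<subseteq> U"
  shows "\<exists>n. sign_lift v {a..b} n"
  using ab(1)
proof (induction a b rule: Bolzano)
  case (trans p q r)
  then obtain m n where m: "sign_lift v {p..q} m" and n0: "sign_lift v {q..r} n" by blast
  obtain n' where n: "sign_lift v {q..r} n'" "n' q = m q"
  proof (cases "n q = m q")
    case False
    moreover have "m q = v q \<or> m q = - v q" "n q = v q \<or> n q = - v q"
      using m n0 trans(3,4) by (auto simp: sign_lift_def)
    ultimately have "- n q = m q" by auto
    then show thesis using that[of "\<lambda>x. - n x"] sign_lift_minus[OF n0] by simp
  qed (use n0 that in auto)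
  define k where "k x = (if x \<le> q then m x else n' x)" for x
  have "continuous_on ({p..q} \<union> {q..r}) k"
    unfolding k_def by (rule continuous_on_cases) (use m n in \<open>auto simp: sign_lift_def\<close>)
  moreover have "{p..q} \<union> {q..r} = {p..r}" using trans by auto
  ultimately show ?case using m n(1) by (intro exI[of _ k]) (auto simp: sign_lift_def k_def)
next
  case (local z)
  then have "z \<in> U" using ab by auto
  then obtain e n where e: "e > 0" "ball z e \<subseteq> U" "sign_lift v (ball z e) n"
    using sign_lift_local[OF v cont U] by metis
  have "sign_lift v {p..q} n" if "p \<le> z" "z \<le> q" "q - p < e" for p q
    using that by (intro sign_lift_subset[OF e(3)]) (auto simp: dist_real_def)
  then show ?case using e(1) by blast
qed

text \<open>m \<bullet> n is continuous with values 1 and -1 only, hence constant on a connected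
  set.\<close>

lemma sign_lift_unique:
  assumes "\<And>x. x \<in> S \<Longrightarrow> norm (v x) = 1" "connected S" "sign_lift v S m" "sign_lift v S n"
    "p \<in> S" "m p = n p" "x \<in> S"
  shows "m x = n x"
proof -
  have val: "m y \<bullet> n y = (if m y = n y then 1 else - 1)" if "y \<in> S" for y
  proof -
    have 1: "v y \<bullet> v y = 1" using assms(1)[OF that] by (simp add: norm_eq_1)
    have ne: "v y \<noteq> - v y"
    proof
      assume "v y = - v y"
      then have "v y \<bullet> v y = (- v y) \<bullet> v y" by (rule arg_cong)
      then show False using 1 by simp
    qed
    have "m y = v y \<or> m y = - v y" "n y = v y \<or> n y = - v y"
      using assms(3,4) that by (simp_all add: sign_lift_def)
    then show ?thesis using 1 ne ne[symmetric] by (elim disjE) simp_all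
  qed
  have "continuous_on S (\<lambda>y. m y \<bullet> n y)"
    using assms(3,4) by (intro continuous_intros) (auto simp: sign_lift_def)
  moreover have "finite ((\<lambda>y. m y \<bullet> n y) ` S)"
    by (rule finite_subset[of _ "{1, -1}"]) (use val in auto)
  ultimately have "(\<lambda>y. m y \<bullet> n y) constant_on S"
    using continuous_finite_range_constant[OF assms(2)] by blast
  then have "m x \<bullet> n x = m p \<bullet> n p" using assms(5,7) by (auto simp: constant_on_def)
  then show ?thesis using val[OF assms(5)] val[OF assms(7)] assms(6) by (auto split: if_splits)
qed

text \<open>Lifts normalised at a base point p exist on every compact interval of U containing p and
  agree on overlaps by uniqueness. Evaluating at x the lift on the interval between p and x
  therefore gives a global lift.\<close>

lemma sign_lift_connected:
  assumes v: "\<And>x. x \<in> U \<Longrightarrow> norm (v x) = 1" and cont: "continuous_on U (\<lambda>x. tensor (v x) (v x))"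
    and U: "open U" "connected U"
  shows "\<exists>n. sign_lift v U n"
proof (cases "U = {}")
  case True
  then show ?thesis by (simp add: sign_lift_def)
next
  case False
  then obtain p where p: "p \<in> U" by blast
  define I where "I x = {min p x..max p x}" for x
  have sub: "{a..b} \<subseteq> U" if "a \<in> U" "b \<in> U" for a b
    using U(2) that connected_contains_Icc by blast
  have I: "I x \<subseteq> U" "p \<in> I x" "x \<in> I x" "connected (I x)" if "x \<in> U" for x
    using sub[of "min p x" "max p x"] p that by (auto simp: I_def min_def max_def)
  have norml: "\<exists>n. sign_lift v {a..b} n \<and> n p = v p" if ab: "a \<in> U" "b \<in> U" "a \<le> p" "p \<le> b" for a b
  proof -
    obtain n where n: "sign_lift v {a..b} n"
      using sign_lift_interval[OF v cont U(1) _ sub[OF ab(1,2)]] ab by auto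
    have "n p = v p \<or> - n p = v p" using n ab by (auto simp: sign_lift_def)
    then show ?thesis using n sign_lift_minus[OF n] by blast
  qed
  have "\<exists>n. sign_lift v (I x) n \<and> n p = v p" if "x \<in> U" for x
    unfolding I_def using p that by (intro norml) (auto simp: min_def max_def)
  then obtain N where N: "\<And>x. x \<in> U \<Longrightarrow> sign_lift v (I x) (N x) \<and> N x p = v p" by metis
  define n where "n x = N x x" for x
  have pm: "n x = v x \<or> n x = - v x" if "x \<in> U" for x
    using N[OF that] I[OF that] by (auto simp: sign_lift_def n_def)
  have "isCont n x" if x: "x \<in> U" for x
  proof -
    obtain e where e: "e > 0" "cball x e \<subseteq> U" using U(1) x open_contains_cball by blast
    define a b where "a = min p (x - e)" and "b = max p (x + e)"
    have "x - e \<in> U" "x + e \<in> U" using e by (auto simp: dist_real_def subset_iff)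
    then have ab: "a \<in> U" "b \<in> U" "a \<le> p" "p \<le> b" "a < x" "x < b" using p e(1) by (auto simp: a_def b_def min_def max_def)
    \<comment> \<open>x is an endpoint of its own interval \<open>I x\<close>; continuity at x is
      seen by comparison with a lift on a larger interval that has x in its interior.\<close>
    obtain L where L: "sign_lift v {a..b} L" "L p = v p" using norml[OF ab(1-4)] by blast
    have "n y = L y" if y: "y \<in> {a..b}" for y
    proof -
      have yU: "y \<in> U" using y sub ab by blast
      have Isub: "I y \<subseteq> {a..b}" using y ab by (auto simp: I_def)
      show ?thesis
        unfolding n_def
        by (rule sign_lift_unique[of "I y" v _ _ p])
          (use I[OF yU] v N[OF yU] L Isub in \<open>auto intro: sign_lift_subset\<close>)
    qed
    then have "continuous_on {a..b} n" using L(1) by (metis (no_types, lifting) continuous_on_cong sign_lift_def)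
    then show "isCont n x" using ab by (intro continuous_on_interior[of "{a..b}"]) auto
  qed
  then have "continuous_on U n" by (intro continuous_at_imp_continuous_on) auto
  then show ?thesis using pm by (auto simp: sign_lift_def)
qed

text \<open>Components of an open set are open, so independent choices of sign on them do not
  interfere with continuity.\<close>

theorem sign_lift_open:
  assumes v: "\<And>x. x \<in> U \<Longrightarrow> norm (v x) = 1" and cont: "continuous_on U (\<lambda>x. tensor (v x) (v x))" and U: "open U"
  shows "\<exists>n. sign_lift v U n"
proof -
  have "\<exists>n. sign_lift v C n" if "C \<in> components U" for C
  proof (rule sign_lift_connected)
    show "continuous_on C (\<lambda>x. tensor (v x) (v x))" using cont continuous_on_subset in_components_subset[OF that] by blast
  qed (use that v in_components_subset[OF that] open_components[OF U that] in_components_connected[OF that] in auto)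
  then obtain N where N: "\<And>C. C \<in> components U \<Longrightarrow> sign_lift v C (N C)" by metis
  define n where "n x = N (connected_component_set U x) x" for x
  have eq: "n y = N C y" if "C \<in> components U" "y \<in> C" for C y
  proof -
    have "connected_component_set U y = C"
      using that by (metis components_iff connected_component_eq)
    then show ?thesis by (simp add: n_def)
  qed
  have "isCont n x \<and> (n x = v x \<or> n x = - v x)" if x: "x \<in> U" for x
  proof -
    define C where "C = connected_component_set U x"
    have C: "C \<in> components U" "x \<in> C" using x by (auto simp: C_def components_iff)
    have "continuous_on C n" using N[OF C(1)] eq[OF C(1)] by (metis (no_types, lifting) continuous_on_cong sign_lift_def)
    then have "isCont n x" using C open_components[OF U C(1)] continuous_on_eq_continuous_at by blast
    then show ?thesis using N[OF C(1)] eq[OF C(1)] C(2) by (auto simp: sign_lift_def)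
  qed
  then have "sign_lift v U n" by (auto simp: sign_lift_def intro!: continuous_at_imp_continuous_on)
  then show ?thesis by blast
qed

section \<open>Sobolev functions on the line\<close>

text \<open>Valid for arbitrary functions: Lebesgue measure is complete, so a function equal almost
  everywhere to a nonmeasurable one is nonmeasurable, and then both integrals are 0. Energies can
  thus be compared through their densities alone.\<close>

lemma integral_lebesgue_on_cong_AE:
  fixes f g :: "'a::euclidean_space \<Rightarrow> 'b::euclidean_space"
  assumes S: "S \<in> sets lebesgue" and ae: "AE x in lebesgue_on S. f x = g x"
  shows "integral\<^sup>L (lebesgue_on S) f = integral\<^sup>L (lebesgue_on S) g"
proof -
  let ?f = "\<lambda>x. indicator S x *\<^sub>R f x" and ?g = "\<lambda>x. indicator S x *\<^sub>R g x"
  have ae1: "AE x in lebesgue. ?f x = ?g x"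
  proof -
    have "AE x in lebesgue. x \<in> S \<longrightarrow> f x = g x" using ae S by (simp add: AE_restrict_space_iff)
    then show ?thesis by eventually_elim (auto simp: indicator_def)
  qed
  then have ae2: "AE x in lebesgue. ?g x = ?f x" by eventually_elim (rule sym)
  have "integral\<^sup>L lebesgue ?f = integral\<^sup>L lebesgue ?g"
  proof (cases "?f \<in> borel_measurable lebesgue")
    case True
    then show ?thesis using borel_measurable_AE[OF True ae1] ae1 by (intro integral_cong_AE)
  next
    case False
    then have "\<not> integrable lebesgue ?f" "\<not> integrable lebesgue ?g"
      using borel_measurable_AE[OF _ ae2] borel_measurable_integrable by blast+
    then show ?thesis by (simp add: not_integrable_integral_eq)
  qed
  then show ?thesis using S by (simp add: integral_restrict_space)
qed

lemma AE_lebesgue_on_iff: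
  assumes "S \<in> sets lebesgue"
  shows "(AE x in lebesgue_on S. P x) \<longleftrightarrow> negligible {x\<in>S. \<not> P x}"
proof -
  have "(AE x in lebesgue_on S. P x) \<longleftrightarrow> (AE x in lebesgue. x \<in> S \<longrightarrow> P x)"
    using assms by (simp add: AE_restrict_space_iff)
  also have "\<dots> \<longleftrightarrow> (\<exists>N\<in>null_sets lebesgue. {x. \<not> (x \<in> S \<longrightarrow> P x)} \<subseteq> N)"
    by (simp add: eventually_ae_filter)
  also have "{x. \<not> (x \<in> S \<longrightarrow> P x)} = {x\<in>S. \<not> P x}" by auto
  also have "(\<exists>N\<in>null_sets lebesgue. {x\<in>S. \<not> P x} \<subseteq> N) \<longleftrightarrow> negligible {x\<in>S. \<not> P x}"
    by (metis negligible_iff_null_sets negligible_subset order_refl)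
  finally show ?thesis .
qed

lemma open_lebesgue: "open U \<Longrightarrow> U \<in> sets lebesgue"
  by (simp add: borel_open)

lemma AE_open_subset:
  assumes "open U" "open V" "U \<subseteq> V"
  shows "(AE x in lebesgue_on U. P x) \<longleftrightarrow> (AE x in lebesgue_on V. x \<in> U \<longrightarrow> P x)"
proof -
  have "{x\<in>U. \<not> P x} = {x\<in>V. \<not> (x \<in> U \<longrightarrow> P x)}" using assms by auto
  then show ?thesis using assms by (simp add: AE_lebesgue_on_iff open_lebesgue)
qed

lemma antideriv_on_AE:
  assumes "open U" "antideriv_on U f g"
  shows "AE x in lebesgue_on U. (f has_vector_derivative g x) (at x)"
  using antideriv_on_has_vector_derivative[OF assms] assms(1) by (simp add: AE_lebesgue_on_iff open_lebesgue)

lemma antideriv_on_continuous: "open U \<Longrightarrow> antideriv_on U f g \<Longrightarrow> continuous_on U f"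
  using antideriv_on_isCont by (intro continuous_at_imp_continuous_on) blast

lemma wderiv_antideriv:
  assumes "open U" "continuous_on U f" "weak_derivative U f g"
  shows "antideriv_on U f (wderiv U f)"
proof -
  have "weak_derivative U f (wderiv U f)" unfolding wderiv_def by (rule someI[of "weak_derivative U f", OF assms(3)])
  then show ?thesis using weak_derivative_antideriv assms by blast
qed

lemma antideriv_on_AE_unique:
  assumes "open U" "antideriv_on U f g" "antideriv_on U f h"
  shows "AE x in lebesgue_on U. g x = h x"
  using antideriv_on_AE[OF assms(1,2)] antideriv_on_AE[OF assms(1,3)]
  by eventually_elim (rule vector_derivative_unique_at)

lemma L2_on_bound:
  fixes g :: "real \<Rightarrow> 'b::euclidean_space" and h :: "real \<Rightarrow> 'c::euclidean_space"
  assumes "L2_on U h" "g \<in> borel_measurable (lebesgue_on U)" "AE x in lebesgue_on U. norm (g x) \<le> C * norm (h x)"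
  shows "L2_on U g"
  unfolding L2_on_def
proof
  show "integrable (lebesgue_on U) (\<lambda>x. (norm (g x))\<^sup>2)"
  proof (rule Bochner_Integration.integrable_bound)
    show "integrable (lebesgue_on U) (\<lambda>x. C\<^sup>2 * (norm (h x))\<^sup>2)"
      using assms(1) by (simp add: L2_on_def)
    show "(\<lambda>x. (norm (g x))\<^sup>2) \<in> borel_measurable (lebesgue_on U)" using assms(2) by simp
    show "AE x in lebesgue_on U. norm ((norm (g x))\<^sup>2) \<le> norm (C\<^sup>2 * (norm (h x))\<^sup>2)"
      using assms(3)
    proof eventually_elim
      case (elim x)
      have "(norm (g x))\<^sup>2 \<le> (C * norm (h x))\<^sup>2" by (rule power_mono[OF elim]) simp
      then show ?case by (simp add: power_mult_distrib)
    qed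
  qed
qed (fact assms)

lemma L2_on_add:
  fixes f g :: "real \<Rightarrow> 'b::euclidean_space"
  assumes f: "L2_on U f" and g: "L2_on U g"
  shows "L2_on U (\<lambda>x. f x + g x)"
  unfolding L2_on_def
proof
  show m: "(\<lambda>x. f x + g x) \<in> borel_measurable (lebesgue_on U)" using f g by (auto simp: L2_on_def)
  show "integrable (lebesgue_on U) (\<lambda>x. (norm (f x + g x))\<^sup>2)"
  proof (rule Bochner_Integration.integrable_bound)
    show "integrable (lebesgue_on U) (\<lambda>x. 2 * (norm (f x))\<^sup>2 + 2 * (norm (g x))\<^sup>2)"
      using f g by (auto simp: L2_on_def)
    show "(\<lambda>x. (norm (f x + g x))\<^sup>2) \<in> borel_measurable (lebesgue_on U)" using m by simp
    show "AE x in lebesgue_on U. norm ((norm (f x + g x))\<^sup>2) \<le> norm (2 * (norm (f x))\<^sup>2 + 2 * (norm (g x))\<^sup>2)"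
    proof (rule AE_I2)
      fix x
      have "(norm (f x + g x))\<^sup>2 \<le> (norm (f x) + norm (g x))\<^sup>2"
        by (intro power_mono norm_triangle_ineq norm_ge_zero)
      also have "\<dots> \<le> 2 * (norm (f x))\<^sup>2 + 2 * (norm (g x))\<^sup>2"
        using sum_squares_bound[of "norm (f x)" "norm (g x)"] by (simp add: power2_sum)
      finally show "norm ((norm (f x + g x))\<^sup>2) \<le> norm (2 * (norm (f x))\<^sup>2 + 2 * (norm (g x))\<^sup>2)" by simp
    qed
  qed
qed

lemma L2_on_subset:
  assumes "L2_on U f" "K \<subseteq> U" "K \<in> sets lebesgue" "U \<in> sets lebesgue"
  shows "L2_on K f"
  unfolding L2_on_def
proof
  show "f \<in> borel_measurable (lebesgue_on K)"
    using assms(1) by (intro measurable_restrict_mono[OF _ assms(2)]) (simp add: L2_on_def)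
  have "(\<lambda>x. (norm (f x))\<^sup>2) absolutely_integrable_on U"
    using assms by (simp add: L2_on_def absolutely_integrable_on_iff_integrable)
  then show "integrable (lebesgue_on K) (\<lambda>x. (norm (f x))\<^sup>2)"
    unfolding absolutely_integrable_on_iff_integrable[OF assms(3), symmetric]
    by (rule set_integrable_subset[OF _ assms(3,2)])
qed

text \<open>On bounded intervals square integrability suffices because |h| \<le> 1 + |h|^2.\<close>

lemma L2_on_absolutely_integrable:
  fixes h :: "real \<Rightarrow> 'b::euclidean_space"
  assumes "L2_on U h" "{u..v} \<subseteq> U" "U \<in> sets lebesgue"
  shows "h absolutely_integrable_on {u..v}"
proof (rule measurable_bounded_by_integrable_imp_absolutely_integrable)
  have L: "L2_on {u..v} h" using L2_on_subset[OF assms(1,2) _ assms(3)] by simp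
  then show "h \<in> borel_measurable (lebesgue_on {u..v})" by (simp add: L2_on_def)
  have "(\<lambda>x. (norm (h x))\<^sup>2) absolutely_integrable_on {u..v}"
    using L by (simp add: L2_on_def absolutely_integrable_on_iff_integrable)
  then show "(\<lambda>x. 1 + (norm (h x))\<^sup>2) integrable_on {u..v}"
    by (intro Henstock_Kurzweil_Integration.integrable_add) (auto simp: set_lebesgue_integral_eq_integral(1))
  show "norm (h x) \<le> 1 + (norm (h x))\<^sup>2" for x
  proof -
    have "2 * norm (h x) \<le> 1 + (norm (h x))\<^sup>2" using sum_squares_bound[of 1 "norm (h x)"] by simp
    moreover have "norm (h x) \<ge> 0" by simp
    ultimately show ?thesis by linarith
  qed
qed simp

text \<open>\<open>wderiv\<close> is some weak derivative, not necessarily the square integrable one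
  granted by \<open>W12\<close>; uniqueness almost everywhere carries the bound over.\<close>

lemma W12D:
  assumes U: "open U" and f: "f \<in> W12 U"
  shows "antideriv_on U f (wderiv U f)" "L2_on U (wderiv U f)" "L2_on U f" "continuous_on U f"
proof -
  obtain g where g: "weak_derivative U f g" "L2_on U g" and c: "continuous_on U f"
    and L: "L2_on U f" using f by (auto simp: W12_def)
  show w: "antideriv_on U f (wderiv U f)" using wderiv_antideriv[OF U c g(1)] .
  have "AE x in lebesgue_on U. norm (wderiv U f x) \<le> 1 * norm (g x)"
    using antideriv_on_AE_unique[OF U w weak_derivative_antideriv[OF U c g(1)]] by eventually_elim simp
  then show "L2_on U (wderiv U f)" by (rule L2_on_bound[OF g(2) antideriv_on_measurable[OF U w]])
  show "L2_on U f" "continuous_on U f" by fact+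
qed

lemma W12I:
  assumes "open U" "antideriv_on U f g" "L2_on U f" "L2_on U g"
  shows "f \<in> W12 U"
  using assms antideriv_weak_derivative[OF assms(1,2)] antideriv_on_continuous[OF assms(1,2)] unfolding W12_def by blast

lemma W12_locD:
  assumes U: "open U" and f: "f \<in> W12_loc U"
  shows "antideriv_on U f (wderiv U f)" "continuous_on U f"
  using f wderiv_antideriv[OF U] by (auto simp: W12_loc_def)

lemma continuous_on_compact_L2:
  fixes f :: "real \<Rightarrow> 'b::euclidean_space"
  assumes "compact K" "continuous_on K f"
  shows "L2_on K f"
proof -
  obtain B where B: "\<And>x. x \<in> K \<Longrightarrow> norm (f x) \<le> B"
    using compact_imp_bounded[OF compact_continuous_image[OF assms(2,1)]] by (auto simp: bounded_iff)
  show ?thesis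
  proof (rule L2_on_bound)
  have K: "K \<in> lmeasurable" using assms(1) by (rule lmeasurable_compact)
  then have "integrable lebesgue (indicat_real K)" by (simp add: lmeasurable_iff_integrable)
  then have "integrable (lebesgue_on K) (\<lambda>x. 1 :: real)" using K by (subst integrable_restrict_space) auto
  then show "L2_on K (\<lambda>x. 1 :: real)" by (simp add: L2_on_def)
  show "f \<in> borel_measurable (lebesgue_on K)" using K by (intro continuous_imp_measurable_on_sets_lebesgue assms) auto
  show "AE x in lebesgue_on K. norm (f x) \<le> B * norm (1 :: real)" using B by (intro AE_I2) simp
  qed
qed

lemma W12_locI:
  assumes U: "open U" "antideriv_on U f g" and L: "\<And>K. \<lbrakk>compact K; K \<subseteq> U\<rbrakk> \<Longrightarrow> L2_on K g"
  shows "f \<in> W12_loc U"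
  unfolding W12_loc_def mem_Collect_eq
proof (intro conjI exI[of _ g] allI impI; (elim conjE)?)
  show c: "continuous_on U f" by (rule antideriv_on_continuous[OF U])
  show "weak_derivative U f g" by (rule antideriv_weak_derivative[OF U])
  fix K assume K: "compact K" "K \<subseteq> U"
  show "L2_on K f" using continuous_on_compact_L2[OF K(1) continuous_on_subset[OF c K(2)]] .
  show "L2_on K g" by (rule L[OF K])
qed

lemma open_nonzero_set:
  fixes s :: "'a::topological_space \<Rightarrow> 'b::t1_space"
  assumes "open U" "continuous_on U s"
  shows "open (U - {x. s x = c})"
proof -
  have "open (s -` (- {c}) \<inter> U)" using assms continuous_on_open_vimage by blast
  moreover have "s -` (- {c}) \<inter> U = U - {x. s x = c}" by auto
  ultimately show ?thesis by simp
qed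

lemma W12_lipschitz_image:
  fixes Q :: "real \<Rightarrow> 'a::euclidean_space" and f :: "real \<Rightarrow> 'b::euclidean_space"
  assumes U: "open U" and Q: "Q \<in> W12 U"
    and lip: "\<And>x y. \<lbrakk>x \<in> U; y \<in> U\<rbrakk> \<Longrightarrow> norm (f x - f y) \<le> C * norm (Q x - Q y)"
    and bd: "\<And>x. x \<in> U \<Longrightarrow> norm (f x) \<le> C * norm (Q x)"
  shows "f \<in> W12 U"
proof -
  note QD = W12D[OF U Q]
  let ?g = "\<lambda>x. vector_derivative f (at x)"
  have f: "antideriv_on U f ?g"
    by (intro ac_at_antideriv ac_at_lipschitz_image[OF antideriv_on_ac_at[OF U QD(1)] U _ lip])
  have "L2_on U f"
  proof (rule L2_on_bound[OF QD(3)])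
    show "f \<in> borel_measurable (lebesgue_on U)"
      by (intro continuous_imp_measurable_on_sets_lebesgue antideriv_on_continuous[OF U f] open_lebesgue U)
    show "AE x in lebesgue_on U. norm (f x) \<le> C * norm (Q x)" using bd by (intro AE_I2) simp
  qed
  moreover have "AE x in lebesgue_on U. norm (?g x) \<le> C * norm (wderiv U Q x)"
    using antideriv_on_AE[OF U f] antideriv_on_AE[OF U QD(1)] AE_space
  proof eventually_elim
    case (elim x)
    then show ?case using lip by (intro vector_derivative_norm_le[OF elim(1,2) U]) auto
  qed
  then have "L2_on U ?g" by (rule L2_on_bound[OF QD(2) antideriv_on_measurable[OF U f]])
  ultimately show ?thesis using W12I[OF U f] by blast
qed

lemma W12_add:
  assumes U: "open U" and f: "f \<in> W12 U" and g: "g \<in> W12 U"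
  shows "(\<lambda>x. f x + g x) \<in> W12 U"
proof (rule W12I[OF U])
  note fD = W12D[OF U f] and gD = W12D[OF U g]
  show "antideriv_on U (\<lambda>x. f x + g x) (\<lambda>x. wderiv U f x + wderiv U g x)"
    unfolding antideriv_on_def
  proof (intro allI impI conjI; elim conjE)
    fix x y :: real assume xy: "x \<le> y" "{x..y} \<subseteq> U"
    note a = antideriv_onD[OF fD(1) xy] and b = antideriv_onD[OF gD(1) xy]
    show "(\<lambda>x. wderiv U f x + wderiv U g x) absolutely_integrable_on {x..y}" using a(1) b(1) by (rule set_integral_add)
    show "f y + g y - (f x + g x) = integral {x..y} (\<lambda>x. wderiv U f x + wderiv U g x)"
      using a b by (simp add: HK_add)
  qed
qed (intro L2_on_add W12D[OF U f] W12D[OF U g])+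

lemma W12_minus:
  assumes U: "open U" and f: "f \<in> W12 U"
  shows "(\<lambda>x. - f x) \<in> W12 U"
  by (rule W12_lipschitz_image[OF U f, where C=1]) (auto simp: norm_minus_commute)

lemma wderiv_AE:
  assumes "open U" "f \<in> W12 U"
  shows "AE x in lebesgue_on U. (f has_vector_derivative wderiv U f x) (at x)"
  using antideriv_on_AE[OF assms(1) W12D(1)[OF assms]] .

section \<open>Scalar order parameters and directors in Sobolev spaces\<close>

lemma norm_vgrad: "norm (vgrad k U n x) = norm (wderiv U n x)"
proof -
  have "vgrad k U n x \<bullet> vgrad k U n x = wderiv U n x \<bullet> wderiv U n x"
    by (simp add: vgrad_def pd_def inner_vec_def if_distrib[of "\<lambda>z. z $ _"] if_distrib[of "\<lambda>z. z * _"] cong: if_cong)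
  then show ?thesis by (simp add: norm_eq_sqrt_inner)
qed

text \<open>\<open>pert\<close> makes the projections continuous where s is positive, so v has a
  sign lift n there. Near each point the values of n are at acute angles, hence increments of n are
  bounded by 2 / s times those of Q.\<close>

lemma W12_director:
  fixes Q :: "real \<Rightarrow> real^3^3" and v :: "real \<Rightarrow> real^3"
  assumes \<Omega>: "open \<Omega>" and Q: "Q \<in> W12 \<Omega>" and s: "continuous_on \<Omega> s" "\<And>x. x \<in> \<Omega> \<Longrightarrow> 0 \<le> s x"
    and v: "\<And>x. x \<in> \<Omega> \<Longrightarrow> norm (v x) = 1"
    and pert: "\<And>x y. \<lbrakk>x \<in> \<Omega>; y \<in> \<Omega>\<rbrakk> \<Longrightarrow> s x * norm (tensor (v x) (v x) - tensor (v y) (v y)) \<le> 2 * norm (Q x - Q y)"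
    and U_def: "U = \<Omega> - {x. s x = 0}"
  obtains n where "\<And>x. x \<in> U \<Longrightarrow> n x = v x \<or> n x = - v x" "n \<in> W12_loc U"
    "AE x in lebesgue_on \<Omega>. (s x)\<^sup>2 * (norm (wderiv U n x))\<^sup>2 \<le> 4 * (norm (wderiv \<Omega> Q x))\<^sup>2"
proof -
  have U: "open U" "U \<subseteq> \<Omega>" unfolding U_def using open_nonzero_set[OF \<Omega> s(1)] by auto
  have spos: "0 < s x" if "x \<in> U" for x using that s(2)[of x] by (auto simp: U_def)
  note QD = W12D[OF \<Omega> Q]
  have pert': "norm (tensor (v x) (v x) - tensor (v y) (v y)) \<le> 2 / s x * norm (Q x - Q y)" if "x \<in> U" "y \<in> U" for x y
    using pert[of x y] that U spos[of x] by (simp add: subset_iff field_simps)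
  \<comment> \<open>With x fixed the factor 2 / s x is a constant, and continuity of Q at x is
    enough.\<close>
  have cont: "continuous_on U (\<lambda>x. tensor (v x) (v x))"
    unfolding continuous_on_def
  proof
    fix x assume x: "x \<in> U"
    have "((\<lambda>y. 2 / s x * norm (Q x - Q y)) \<longlongrightarrow> 2 / s x * norm (Q x - Q x)) (at x within U)"
      using QD(4) x U(2) by (intro tendsto_intros) (auto simp: continuous_on_def intro: tendsto_within_subset)
    then have lim: "((\<lambda>y. 2 / s x * norm (Q x - Q y)) \<longlongrightarrow> 0) (at x within U)" by simp
    have "((\<lambda>y. tensor (v x) (v x) - tensor (v y) (v y)) \<longlongrightarrow> 0) (at x within U)"
      by (rule Lim_null_comparison[OF _ lim]) (use pert' x in \<open>auto simp: eventually_at_filter\<close>)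
    then have "((\<lambda>y. tensor (v x) (v x) - (tensor (v x) (v x) - tensor (v y) (v y))) \<longlongrightarrow> tensor (v x) (v x) - 0) (at x within U)"
      by (intro tendsto_intros)
    then show "((\<lambda>y. tensor (v y) (v y)) \<longlongrightarrow> tensor (v x) (v x)) (at x within U)" by simp
  qed
  obtain n where n: "sign_lift v U n" using sign_lift_open[of U v] v cont U by blast
  then have nc: "continuous_on U n" and nv: "\<And>x. x \<in> U \<Longrightarrow> n x = v x \<or> n x = - v x" by (auto simp: sign_lift_def)
  have n1: "norm (n x) = 1" "tensor (n x) (n x) = tensor (v x) (v x)" if "x \<in> U" for x
    using nv[OF that] v[of x] that U by (auto simp: tensor_minus_minus)
  have nQ: "norm (n x - n y) \<le> 2 / s x * norm (Q x - Q y)" if "x \<in> U" "y \<in> U" "0 \<le> n x \<bullet> n y" for x y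
    using norm_diff_le_tensor_diff[of "n x" "n y"] n1 pert'[of x y] that by auto
  \<comment> \<open>Neighbourhoods on which the sign of n is consistent and s stays above half its
    value, so that \<open>nQ\<close> applies with one constant.\<close>
  have nearby: "\<exists>W. open W \<and> x \<in> W \<and> W \<subseteq> U \<and> (\<forall>y\<in>W. \<forall>z\<in>W. 0 \<le> n y \<bullet> n z) \<and> (\<forall>y\<in>W. s x / 2 \<le> s y)" if x: "x \<in> U" for x
  proof -
    have "open (n -` ball (n x) (1/2) \<inter> U)"
      by (rule continuous_on_open_vimage[OF U(1), THEN iffD1, OF nc, rule_format, OF open_ball])
    moreover have "open (s -` {s x / 2<..} \<inter> U)"
      by (rule continuous_on_open_vimage[OF U(1), THEN iffD1, OF continuous_on_subset[OF s(1) U(2)], rule_format, OF open_greaterThan])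
    moreover have "n -` ball (n x) (1/2) \<inter> U = {y\<in>U. norm (n y - n x) < 1/2}" "s -` {s x / 2<..} \<inter> U = {y\<in>U. s x / 2 < s y}"
      by (auto simp: dist_norm norm_minus_commute)
    ultimately have opn: "open {y\<in>U. norm (n y - n x) < 1/2}" "open {y\<in>U. s x / 2 < s y}" by simp_all
    define W where "W = {y\<in>U. norm (n y - n x) < 1/2} \<inter> {y\<in>U. s x / 2 < s y}"
    have "0 \<le> n y \<bullet> n z" if "y \<in> W" "z \<in> W" for y z
    proof -
      have "norm (n y - n z) < 1"
        using that norm_triangle_ineq4[of "n y - n x" "n z - n x"] by (auto simp: W_def)
      then have "(norm (n y - n z))\<^sup>2 < 1" by (simp add: power_less_one_iff)
      moreover have "(norm (n y - n z))\<^sup>2 = 2 - 2 * (n y \<bullet> n z)"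
        using n1 that unfolding power2_norm_eq_inner
        by (simp add: inner_diff_left inner_diff_right norm_eq_1 inner_commute W_def)
      ultimately show ?thesis by linarith
    qed
    then show ?thesis using opn x spos[OF x] by (intro exI[of _ W]) (auto simp: W_def)
  qed
  let ?g = "\<lambda>x. vector_derivative n (at x)"
  have "ac_at n x" if x: "x \<in> U" for x
  proof -
    obtain W where W: "open W" "x \<in> W" "W \<subseteq> U" "\<And>y z. y \<in> W \<Longrightarrow> z \<in> W \<Longrightarrow> 0 \<le> n y \<bullet> n z" "\<And>y. y \<in> W \<Longrightarrow> s x / 2 \<le> s y"
      using nearby[OF x] by blast
    show ?thesis
    proof (rule ac_at_lipschitz_image[OF antideriv_on_ac_at[OF \<Omega> QD(1)] W(1,2)])
      show "x \<in> \<Omega>" using x U by blast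
      fix y z assume yz: "y \<in> W" "z \<in> W"
      have "norm (n y - n z) \<le> 2 / s y * norm (Q y - Q z)" using nQ[of y z] yz W by blast
      also have "\<dots> \<le> 2 / (s x / 2) * norm (Q y - Q z)"
        using W(5)[OF yz(1)] spos[OF x] by (intro mult_right_mono divide_left_mono) auto
      finally show "norm (n y - n z) \<le> 2 / (s x / 2) * norm (Q y - Q z)" .
    qed
  qed
  then have ng: "antideriv_on U n ?g" by (rule ac_at_antideriv)
  have bound: "AE x in lebesgue_on U. s x * norm (?g x) \<le> 2 * norm (wderiv \<Omega> Q x)"
  proof -
    have "AE x in lebesgue_on U. (Q has_vector_derivative wderiv \<Omega> Q x) (at x)"
      using wderiv_AE[OF \<Omega> Q] unfolding AE_open_subset[OF U(1) \<Omega> U(2)] by eventually_elim simp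
    then show ?thesis using antideriv_on_AE[OF U(1) ng] AE_space
    proof eventually_elim
      case (elim x)
      then have x: "x \<in> U" by simp
      then obtain W where W: "open W" "x \<in> W" "W \<subseteq> U" "\<And>y z. y \<in> W \<Longrightarrow> z \<in> W \<Longrightarrow> 0 \<le> n y \<bullet> n z"
        using nearby[OF x] by blast
      \<comment> \<open>\<open>pert\<close> involves s at one of the two points only, so the
        derivative bound keeps 2 / s x, without the halving of s in the local Lipschitz
        constant.\<close>
      have "norm (?g x) \<le> 2 / s x * norm (wderiv \<Omega> Q x)"
      proof (rule vector_derivative_norm_le[OF elim(2,1) W(1,2)])
        fix y assume "y \<in> W"
        then show "norm (n y - n x) \<le> 2 / s x * norm (Q y - Q x)"
          using nQ[of x y] W x by (auto simp: norm_minus_commute)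
      qed
      then show ?case using spos[OF x] by (simp add: field_simps)
    qed
  qed
  have W: "n \<in> W12_loc U"
  proof (rule W12_locI[OF U(1) ng])
    fix K assume K: "compact K" "K \<subseteq> U"
    show "L2_on K ?g"
    proof (cases "K = {}")
      case True
      then show ?thesis by (simp add: L2_on_def space_empty_iff[symmetric] measurable_def integrable_iff_bounded nn_integral_empty)
    next
      case False
      \<comment> \<open>The minimum of s on K is positive, which allows the weight to be divided out
        there.\<close>
      obtain z where z: "z \<in> K" "\<And>x. x \<in> K \<Longrightarrow> s z \<le> s x"
        using continuous_attains_inf[OF K(1) False, of s] continuous_on_subset[OF s(1), of K] K U by blast
      have Ks: "K \<in> sets lebesgue" using K(1) by (simp add: lmeasurable_compact fmeasurableD)
      show ?thesis
      proof (rule L2_on_bound)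
        show "L2_on K (wderiv \<Omega> Q)" using L2_on_subset[OF QD(2) _ Ks] K U \<Omega> by (auto simp: open_lebesgue)
        show "?g \<in> borel_measurable (lebesgue_on K)"
          by (rule measurable_restrict_mono[OF antideriv_on_measurable[OF U(1) ng] K(2)])
        have "AE x in lebesgue. x \<in> U \<longrightarrow> s x * norm (?g x) \<le> 2 * norm (wderiv \<Omega> Q x)"
          using bound U(1) by (simp add: AE_restrict_space_iff open_lebesgue)
        then have "AE x in lebesgue. x \<in> K \<longrightarrow> norm (?g x) \<le> 2 / s z * norm (wderiv \<Omega> Q x)"
        proof eventually_elim
          case (elim x)
          show ?case
          proof
            assume x: "x \<in> K"
            then have "s z * norm (?g x) \<le> s x * norm (?g x)" using z(2) by (intro mult_right_mono) auto
            also have "\<dots> \<le> 2 * norm (wderiv \<Omega> Q x)" using elim x K by blast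
            finally show "norm (?g x) \<le> 2 / s z * norm (wderiv \<Omega> Q x)"
              using spos[of z] z(1) K by (simp add: field_simps subset_iff)
          qed
        qed
        then show "AE x in lebesgue_on K. norm (?g x) \<le> 2 / s z * norm (wderiv \<Omega> Q x)"
          using Ks by (simp add: AE_restrict_space_iff)
      qed
    qed
  qed
  have "AE x in lebesgue_on U. (s x)\<^sup>2 * (norm (wderiv U n x))\<^sup>2 \<le> 4 * (norm (wderiv \<Omega> Q x))\<^sup>2"
    using bound antideriv_on_AE_unique[OF U(1) W12_locD(1)[OF U(1) W] ng] AE_space
  proof eventually_elim
    case (elim x)
    have "(s x * norm (wderiv U n x))\<^sup>2 \<le> (2 * norm (wderiv \<Omega> Q x))\<^sup>2"
      using elim spos[of x] by (intro power_mono) auto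
    then show ?case by (simp add: power_mult_distrib)
  qed
  then have "AE x in lebesgue_on \<Omega>. x \<in> U \<longrightarrow> (s x)\<^sup>2 * (norm (wderiv U n x))\<^sup>2 \<le> 4 * (norm (wderiv \<Omega> Q x))\<^sup>2"
    unfolding AE_open_subset[OF U(1) \<Omega> U(2)] .
  \<comment> \<open>Outside U the factor s x is zero, whatever value the weak derivative of n
    takes.\<close>
  then have "AE x in lebesgue_on \<Omega>. (s x)\<^sup>2 * (norm (wderiv U n x))\<^sup>2 \<le> 4 * (norm (wderiv \<Omega> Q x))\<^sup>2"
    using AE_space by eventually_elim (auto simp: U_def)
  then show thesis using that[OF nv W] by blast
qed

text \<open>At zeros of s nothing is claimed about n and n' themselves; the derivative formula
  remains meaningful there because s and s' both vanish.\<close>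

abbreviation regular_at :: "(real \<Rightarrow> real) \<Rightarrow> real \<Rightarrow> (real \<Rightarrow> real^3) \<Rightarrow> real^3 \<Rightarrow> real \<Rightarrow> bool" where
  "regular_at s s' n n' x \<equiv> (s x = 0 \<longrightarrow> s' = 0) \<and>
     (s x \<noteq> 0 \<longrightarrow> n x \<bullet> n x = 1 \<and> n x \<bullet> n' = 0 \<and> (n has_vector_derivative n') (at x)) \<and>
     ((\<lambda>x. s x *\<^sub>R deviator (n x)) has_vector_derivative
        s' *\<^sub>R deviator (n x) + s x *\<^sub>R (tensor n' (n x) + tensor (n x) n')) (at x)"

text \<open>On intervals inside U the product rule bounds the increments of A by the integral of h.
  An interval meeting a zero of s is cut there, and |A| \<le> 2 s reduces it to increments of s,
  which the same h dominates. So A is absolutely continuous although n may oscillate near the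
  zeros.\<close>

lemma W12_director_part:
  fixes s :: "real \<Rightarrow> real" and n :: "real \<Rightarrow> real^3"
  assumes \<Omega>: "open \<Omega>" and s: "s \<in> W12 \<Omega>" "\<And>x. x \<in> \<Omega> \<Longrightarrow> 0 \<le> s x"
    and U_def: "U = \<Omega> - {x. s x = 0}"
    and n: "n \<in> W12_loc U" "\<And>x. x \<in> U \<Longrightarrow> norm (n x) = 1"
    and fin: "(\<integral>\<^sup>+x. ennreal ((s x)\<^sup>2 * (norm (wderiv U n x))\<^sup>2) \<partial>lebesgue_on \<Omega>) < \<infinity>"
  defines "A \<equiv> \<lambda>x. s x *\<^sub>R deviator (n x)"
  shows "A \<in> W12 \<Omega>"
    and "AE x in lebesgue_on \<Omega>. regular_at s (wderiv \<Omega> s x) n (wderiv U n x) x"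
proof -
  note sD = W12D[OF \<Omega> s(1)]
  have U: "open U" "U \<subseteq> \<Omega>" unfolding U_def using open_nonzero_set[OF \<Omega> sD(4)] by auto
  note nD = W12_locD[OF U(1) n(1)]
  define P where "P x = tensor (n x) (n x) - (1/3) *\<^sub>R (mat 1 :: real^3^3)" for x
  define s' where "s' = wderiv \<Omega> s"
  define n' where "n' = wderiv U n"
  define D where "D x = s' x *\<^sub>R P x + s x *\<^sub>R (tensor (n' x) (n x) + tensor (n x) (n' x))" for x
  have A_def': "A x = s x *\<^sub>R P x" for x by (simp add: A_def P_def)
  have bbt: "bounded_bilinear (tensor :: real^3 \<Rightarrow> real^3 \<Rightarrow> real^3^3)"
  proof
    show "\<exists>K. \<forall>a b. norm (tensor a b :: real^3^3) \<le> norm a * norm b * K"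
      by (intro exI[of _ 1]) (simp add: norm_tensor)
  qed (auto simp: tensor_def vec_eq_iff algebra_simps)
  \<comment> \<open>A crude bound: the projection contributes 1 and a third of the identity at most
    1.\<close>
  have nP: "norm (P x) \<le> 2" if "x \<in> U" for x
  proof -
    have "norm (mat 1 :: real^3^3) ^ 2 = 3"
      by (simp add: power2_norm_eq_inner inner_vec_def mat_def sum_3)
    then have "norm (mat 1 :: real^3^3) \<le> 3" by (simp add: power2_le_imp_le)
    then show ?thesis
      using norm_triangle_ineq4[of "tensor (n x) (n x)" "(1/3) *\<^sub>R (mat 1 :: real^3^3)"] n(2)[OF that]
      by (simp add: P_def norm_tensor)
  qed
  have nA: "norm (A x) \<le> 2 * norm (s x)" if "x \<in> \<Omega>" for x
    using nP[of x] that mult_left_mono[of "norm (P x)" 2 "\<bar>s x\<bar>"] by (cases "x \<in> U") (auto simp: A_def' U_def mult.commute)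
  have acU: "ac_at A x" if x: "x \<in> U" for x
  proof -
    have "ac_at n x" "ac_at s x" using antideriv_on_ac_at[OF U(1) nD(1) x] antideriv_on_ac_at[OF \<Omega> sD(1)] x U by auto
    then have "ac_at (\<lambda>x. s x *\<^sub>R (tensor (n x) (n x) + (- (1/3) *\<^sub>R mat 1))) x"
      by (intro ac_at_bilinear[OF bounded_bilinear_scaleR] ac_at_add ac_at_bilinear[OF bbt] ac_at_const)
    then show ?thesis by (simp add: A_def)
  qed
  have sAE: "AE x in lebesgue_on \<Omega>. (s has_vector_derivative s' x) (at x)"
    unfolding s'_def by (rule wderiv_AE[OF \<Omega> s(1)])
  have nAE: "AE x in lebesgue_on \<Omega>. x \<in> U \<longrightarrow> (n has_vector_derivative n' x) (at x)"
    using antideriv_on_AE[OF U(1) nD(1)] unfolding AE_open_subset[OF U(1) \<Omega> U(2)] n'_def .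
  have pointwise: "AE x in lebesgue_on \<Omega>. (s x = 0 \<longrightarrow> s' x = 0) \<and>
      (s x \<noteq> 0 \<longrightarrow> n x \<bullet> n x = 1 \<and> n x \<bullet> n' x = 0 \<and> (n has_vector_derivative n' x) (at x)) \<and>
      (A has_vector_derivative D x) (at x)"
    using sAE nAE AE_space
  proof eventually_elim
    case (elim x)
    then have x: "x \<in> \<Omega>" by simp
    show ?case
    proof (cases "x \<in> U")
      case True
      then have nd: "(n has_vector_derivative n' x) (at x)" using elim by blast
      have "((\<lambda>x. n x \<bullet> n x) has_vector_derivative (n x \<bullet> n' x + n' x \<bullet> n x)) (at x)"
        using bounded_bilinear.has_vector_derivative[OF bounded_bilinear_inner nd nd] .
      moreover have "((\<lambda>x. n x \<bullet> n x) has_vector_derivative 0) (at x)"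
        by (rule has_vector_derivative_transform_within_open[of "\<lambda>x. 1", OF _ U(1) True]) (use n(2) in \<open>auto simp: norm_eq_1\<close>)
      ultimately have "n x \<bullet> n' x + n' x \<bullet> n x = 0" by (rule vector_derivative_unique_at)
      then have nn: "n x \<bullet> n' x = 0" by (simp add: inner_commute)
      have "((\<lambda>x. tensor (n x) (n x)) has_vector_derivative (tensor (n x) (n' x) + tensor (n' x) (n x))) (at x)"
        using bounded_bilinear.has_vector_derivative[OF bbt nd nd] .
      then have "(P has_vector_derivative (tensor (n x) (n' x) + tensor (n' x) (n x))) (at x)"
        unfolding P_def by (auto intro!: derivative_eq_intros)
      from bounded_bilinear.has_vector_derivative[OF bounded_bilinear_scaleR elim(1) this]
      have "(A has_vector_derivative D x) (at x)" unfolding A_def'[abs_def] D_def by (simp add: add.commute)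
      then show ?thesis using True nd nn n(2)[OF True] by (auto simp: U_def norm_eq_1)
    next
      case False
      then have s0: "s x = 0" using x by (simp add: U_def)
      obtain d where d: "d > 0" "ball x d \<subseteq> \<Omega>" using \<Omega> x openE by blast
      have "s' x = 0"
      proof (rule DERIV_local_min[OF _ d(1)])
        show "(s has_field_derivative s' x) (at x)" using elim(1) by (simp add: has_real_derivative_iff_has_vector_derivative)
        show "\<forall>y. \<bar>x - y\<bar> < d \<longrightarrow> s x \<le> s y" using s(2) d s0 by (auto simp: dist_real_def subset_iff)
      qed
      \<comment> \<open>Since s and s' vanish at x, s y is o(y - x), and A inherits this through |A|
        \<le> 2 |s|.\<close>
      have "((\<lambda>y. norm (s y - s x - (y - x) *\<^sub>R s' x) / norm (y - x)) \<longlongrightarrow> 0) (at x)"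
        using elim(1) by (simp add: has_vector_derivative_def has_derivative_iff_norm)
      then have lim: "((\<lambda>y. 2 * (norm (s y) / norm (y - x))) \<longlongrightarrow> 2 * 0) (at x)"
        using \<open>s' x = 0\<close> s0 by (intro tendsto_intros) simp
      have "((\<lambda>y. norm (A y - A x - (y - x) *\<^sub>R 0) / norm (y - x)) \<longlongrightarrow> 0) (at x)"
      proof (rule Lim_null_comparison[OF _ lim[simplified]])
        have "\<forall>\<^sub>F y in at x. y \<in> \<Omega>" using \<Omega> x eventually_at_topological by blast
        then show "\<forall>\<^sub>F y in at x. norm (norm (A y - A x - (y - x) *\<^sub>R 0) / norm (y - x)) \<le> 2 * \<bar>s y\<bar> / \<bar>y - x\<bar>"
        proof eventually_elim
          case (elim y)
          then show ?case using nA[of y] s0 by (simp add: A_def' divide_right_mono)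
        qed
      qed
      then have "(A has_vector_derivative 0) (at x)"
        unfolding has_vector_derivative_def has_derivative_iff_norm by simp
      then show ?thesis using s0 \<open>s' x = 0\<close> by (simp add: D_def)
    qed
  qed
  then show "AE x in lebesgue_on \<Omega>. regular_at s (wderiv \<Omega> s x) n (wderiv U n x) x"
    unfolding A_def D_def P_def s'_def n'_def .
  \<comment> \<open>The weak derivative of n is arbitrary outside U. The cutoff makes k measurable
    and leaves the product unchanged on \<Omega>, as s vanishes off U.\<close>
  define k where "k x = (if x \<in> U then \<bar>s x\<bar> * norm (n' x) else 0)" for x
  have km: "k \<in> borel_measurable (lebesgue_on \<Omega>)"
  proof -
    have "s \<in> borel_measurable (lebesgue_on U)"
      using continuous_on_subset[OF sD(4) U(2)] by (intro continuous_imp_measurable_on_sets_lebesgue open_lebesgue U)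
    moreover have "n' \<in> borel_measurable (lebesgue_on U)" unfolding n'_def by (rule antideriv_on_measurable[OF U(1) nD(1)])
    ultimately have "(\<lambda>x. \<bar>s x\<bar> * norm (n' x)) \<in> borel_measurable (lebesgue_on U)" by measurable
    then have "k \<in> borel_measurable lebesgue"
      unfolding k_def using U(1) by (subst borel_measurable_if) (auto simp: open_lebesgue)
    then show ?thesis by (rule measurable_restrict_space1)
  qed
  have k2: "(k x)\<^sup>2 = (s x)\<^sup>2 * (norm (n' x))\<^sup>2" if "x \<in> \<Omega>" for x
    using that by (auto simp: k_def U_def power_mult_distrib)
  have kL: "L2_on \<Omega> k"
    unfolding L2_on_def
  proof
    show "integrable (lebesgue_on \<Omega>) (\<lambda>x. (norm (k x))\<^sup>2)"
    proof (rule integrableI_bounded)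
      have "(\<integral>\<^sup>+x. ennreal (norm ((norm (k x))\<^sup>2)) \<partial>lebesgue_on \<Omega>) = (\<integral>\<^sup>+x. ennreal ((s x)\<^sup>2 * (norm (n' x))\<^sup>2) \<partial>lebesgue_on \<Omega>)"
        using k2 by (intro nn_integral_cong) simp
      then show "(\<integral>\<^sup>+x. ennreal (norm ((norm (k x))\<^sup>2)) \<partial>lebesgue_on \<Omega>) < \<infinity>" using fin by (simp add: n'_def)
    qed (use km in simp)
  qed (fact km)
  define h where "h x = 2 * norm (s' x) + 2 * k x" for x
  have h0: "0 \<le> h x" for x by (simp add: h_def k_def)
  have hL: "L2_on \<Omega> h"
  proof -
    have "L2_on \<Omega> (\<lambda>x. 2 * norm (s' x))" "L2_on \<Omega> (\<lambda>x. 2 * k x)"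
      using sD(2) kL by (auto intro!: L2_on_bound[where C=2] AE_I2 simp: s'_def L2_on_def)
    then show ?thesis unfolding h_def by (rule L2_on_add)
  qed
  have hi: "h absolutely_integrable_on {u..v}" if "{u..v} \<subseteq> \<Omega>" for u v
    using L2_on_absolutely_integrable[OF hL that] \<Omega> by (simp add: open_lebesgue)
  have Dh: "AE x in lebesgue_on \<Omega>. norm (D x) \<le> h x"
    using pointwise AE_space
  proof eventually_elim
    case (elim x)
    show ?case
    proof (cases "x \<in> U")
      case True
      have "norm (D x) \<le> norm (s' x *\<^sub>R P x) + norm (s x *\<^sub>R (tensor (n' x) (n x) + tensor (n x) (n' x)))"
        unfolding D_def by (rule norm_triangle_ineq)
      also have "\<dots> \<le> \<bar>s' x\<bar> * 2 + \<bar>s x\<bar> * (norm (n' x) + norm (n' x))"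
        using nP[OF True] n(2)[OF True] norm_triangle_ineq[of "tensor (n' x) (n x)" "tensor (n x) (n' x)"]
        by (simp add: norm_tensor add_mono mult_left_mono)
      also have "\<dots> = h x" using True by (simp add: h_def k_def)
      finally show ?thesis .
    next
      case False
      then have "D x = 0" using elim by (simp add: U_def D_def)
      then show ?thesis using h0 by simp
    qed
  qed
  have inc: "norm (A v - A u) \<le> integral {u..v} h" if uv: "u \<le> v" "{u..v} \<subseteq> \<Omega>" for u v
  proof (cases "{u..v} \<subseteq> U")
    case True
    have AU: "antideriv_on U A (\<lambda>x. vector_derivative A (at x))" by (rule ac_at_antideriv[OF acU])
    have "AE x in lebesgue_on U. D x = vector_derivative A (at x)"
      using pointwise unfolding AE_open_subset[OF U(1) \<Omega> U(2)] by eventually_elim (auto simp: vector_derivative_at)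
    then have "negligible {x\<in>U. vector_derivative A (at x) \<noteq> D x}"
      using U(1) unfolding AE_lebesgue_on_iff[OF open_lebesgue[OF U(1)]] by (simp add: eq_commute)
    then have AD: "antideriv_on U A D" by (rule antideriv_on_cong_ae[OF AU])
    have "norm (A v - A u) \<le> integral {u..v} (\<lambda>x. norm (D x))" by (rule antideriv_on_norm_le[OF AD uv(1) True])
    also have "\<dots> \<le> integral {u..v} h"
    proof -
      \<comment> \<open>D is dominated by h only almost everywhere; replacing it by zero on the
        exceptional null set makes the bound pointwise.\<close>
      define N where "N = {x\<in>\<Omega>. \<not> norm (D x) \<le> h x}"
      have N: "negligible N" using Dh \<Omega> unfolding N_def by (simp add: AE_lebesgue_on_iff open_lebesgue)
      have "integral {u..v} (\<lambda>x. norm (D x)) = integral {u..v} (\<lambda>x. if x \<in> N then 0 else norm (D x))"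
        by (rule integral_spike[OF N]) auto
      also have "\<dots> \<le> integral {u..v} h"
      proof (rule integral_le)
        have "(\<lambda>x. norm (D x)) absolutely_integrable_on {u..v}" using antideriv_onD(1)[OF AD uv(1) True] by (rule set_integrable_norm)
        then show "(\<lambda>x. if x \<in> N then 0 else norm (D x)) integrable_on {u..v}"
          by (intro integrable_spike[OF set_lebesgue_integral_eq_integral(1) N]) auto
        show "h integrable_on {u..v}" using hi[OF uv(2)] by (rule set_lebesgue_integral_eq_integral(1))
        show "(if x \<in> N then 0 else norm (D x)) \<le> h x" if "x \<in> {u..v}" for x
          using h0 that uv by (auto simp: N_def)
      qed
      finally show ?thesis .
    qed
    finally show ?thesis .
  next
    case False
    then have "\<exists>z\<in>{u..v}. s z = 0" using uv by (auto simp: U_def)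
    then obtain z where z: "z \<in> {u..v}" "s z = 0" by blast
    have int: "h integrable_on {p..q}" "(\<lambda>x. norm (s' x)) integrable_on {p..q}" if "p \<le> q" "{p..q} \<subseteq> \<Omega>" for p q
    proof -
      show "h integrable_on {p..q}" using hi[OF that(2)] by (rule set_lebesgue_integral_eq_integral(1))
      show "(\<lambda>x. norm (s' x)) integrable_on {p..q}"
        unfolding s'_def by (rule set_lebesgue_integral_eq_integral(1)[OF set_integrable_norm[OF antideriv_onD(1)[OF sD(1) that]]])
    qed
    have sz: "2 * norm (s q - s p) \<le> integral {p..q} h" if pq: "p \<le> q" "{p..q} \<subseteq> \<Omega>" for p q
    proof -
      have "2 * norm (s q - s p) \<le> 2 * integral {p..q} (\<lambda>x. norm (s' x))"
        using antideriv_on_norm_le[OF sD(1) pq] by (simp add: s'_def)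
      also have "\<dots> = integral {p..q} (\<lambda>x. 2 * norm (s' x))" by simp
      also have "\<dots> \<le> integral {p..q} h"
        using int[OF pq] by (intro integral_le integrable_on_mult_right) (auto simp: h_def k_def)
      finally show ?thesis .
    qed
    have sub: "u \<le> z" "z \<le> v" "{u..z} \<subseteq> \<Omega>" "{z..v} \<subseteq> \<Omega>" using z uv by auto
    \<comment> \<open>Each end value of A is estimated by the increment of s from the zero
      z.\<close>
    have "norm (A v - A u) \<le> norm (A v) + norm (A u)" by (rule norm_triangle_ineq4)
    also have "\<dots> \<le> 2 * norm (s v - s z) + 2 * norm (s z - s u)"
      using nA[of u] nA[of v] uv z(2) by (simp add: subset_iff)
    also have "\<dots> \<le> integral {z..v} h + integral {u..z} h"
      using sz sub by (intro add_mono) auto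
    also have "\<dots> = integral {u..v} h"
      using HK_combine[OF sub(1,2) int(1)[OF uv]] by simp
    finally show ?thesis .
  qed
  have A1: "antideriv_on \<Omega> A (\<lambda>x. vector_derivative A (at x))"
    by (intro ac_at_antideriv, rule ac_atI[OF \<Omega>, where h=h]) (use h0 hi inc in auto)
  have "AE x in lebesgue_on \<Omega>. norm (vector_derivative A (at x)) \<le> 1 * norm (h x)"
    using pointwise Dh by eventually_elim (auto simp: vector_derivative_at)
  then have 2: "L2_on \<Omega> (\<lambda>x. vector_derivative A (at x))"
    by (rule L2_on_bound[OF hL antideriv_on_measurable[OF \<Omega> A1]])
  have "L2_on \<Omega> A"
  proof (rule L2_on_bound[OF sD(3)])
    show "A \<in> borel_measurable (lebesgue_on \<Omega>)"
      by (intro continuous_imp_measurable_on_sets_lebesgue antideriv_on_continuous[OF \<Omega> A1] open_lebesgue \<Omega>)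
    show "AE x in lebesgue_on \<Omega>. norm (A x) \<le> 2 * norm (s x)" using nA by (intro AE_I2) simp
  qed
  then show "A \<in> W12 \<Omega>" using W12I[OF \<Omega> A1 _ 2] by blast
qed

section \<open>The energy densities\<close>

text \<open>The curl of a matrix field depending on the coordinate along \<open>e\<close> only.\<close>

definition row_cross :: "real^3 \<Rightarrow> real^3^3 \<Rightarrow> real^3^3" where
  "row_cross e A = (\<chi> i. cross3 e (A $ i))"

lemma levi_civita_cross3: "(\<Sum>b\<in>UNIV. levi_civita j k b * y $ b) = cross3 (axis k 1) y $ j"
  using exhaust_3[of j] exhaust_3[of k]
  by (elim disjE) (simp_all add: levi_civita_def cross3_def sum_3 axis_def)

lemma vcurl_eq: "vcurl k U n x = cross3 (axis k 1) (wderiv U n x)"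
proof -
  have "(\<Sum>a\<in>UNIV. \<Sum>b\<in>UNIV. levi_civita j a b * pd k U a n x $ b) = (\<Sum>b\<in>UNIV. levi_civita j k b * wderiv U n x $ b)" for j
    using exhaust_3[of k] by (elim disjE) (simp_all add: pd_def sum_3)
  then show ?thesis by (simp add: vcurl_def vec_eq_iff levi_civita_cross3)
qed

lemma mcurl_eq: "mcurl k U Q x = row_cross (axis k 1) (wderiv U Q x)"
proof -
  have "(\<Sum>a\<in>UNIV. \<Sum>b\<in>UNIV. levi_civita j a b * pd k U a Q x $ i $ b) = (\<Sum>b\<in>UNIV. levi_civita j k b * wderiv U Q x $ i $ b)" for i j
    using exhaust_3[of k] by (elim disjE) (simp_all add: pd_def sum_3)
  then show ?thesis by (simp add: mcurl_def vec_eq_iff levi_civita_cross3 row_cross_def)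
qed

lemma vgrad_left_mult: "m v* vgrad k U n x = (m \<bullet> wderiv U n x) *\<^sub>R axis k 1"
  by (simp add: vec_eq_iff vector_matrix_mult_def vgrad_def pd_def axis_def inner_vec_def mult.commute)

lemma norm_sgrad: "norm (sgrad k U s x) = \<bar>wderiv U s x\<bar>"
proof -
  have "sgrad k U s x = wderiv U s x *\<^sub>R axis k 1"
    by (simp add: sgrad_def pd_def vec_eq_iff axis_def)
  then show ?thesis by simp
qed

lemma sum_pd: "(\<Sum>j\<in>UNIV. (norm (pd k U j Q x))\<^sup>2) = (norm (wderiv U Q x))\<^sup>2"
  using exhaust_3[of k] by (elim disjE) (simp_all add: pd_def sum_3)

lemma row_cross_add: "row_cross e (A + B) = row_cross e A + row_cross e B"
  and row_cross_diff: "row_cross e (A - B) = row_cross e A - row_cross e B"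
  and row_cross_scaleR: "row_cross e (c *\<^sub>R A) = c *\<^sub>R row_cross e A"
  by (simp_all add: row_cross_def vec_eq_iff cross_add_right cross_mult_right Cross3.right_diff_distrib)

lemma row_cross_tensor: "row_cross e (tensor u v) = tensor u (cross3 e v)"
  by (simp add: row_cross_def tensor_def vec_eq_iff cross3_simps)

lemma inner_mat1_tensor: "mat 1 \<bullet> tensor u v = u \<bullet> v"
  by (simp add: inner_tensor_right)

lemma inner_row_cross_mat1: "tensor u u \<bullet> row_cross e (mat 1) = 0" "mat 1 \<bullet> row_cross e (mat 1) = 0"
  by (simp_all add: row_cross_def tensor_def inner_vec_def sum_3 mat_def cross3_simps algebra_simps)

lemma orthogonal_unit_exists:
  obtains v :: "real^3" where "norm v = 1" "u \<bullet> v = 0"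
proof -
  obtain w :: "real^3" where w: "w \<noteq> 0" "orthogonal u w"
    using orthogonal_to_vector_exists[of u] by auto
  then show thesis using that[of "(1 / norm w) *\<^sub>R w"] by (simp add: orthogonal_def)
qed

text \<open>The primed variables stand for derivatives in the direction of \<open>e\<close>.\<close>

lemma integrand_identity:
  fixes n m n' m' e :: "real^3" and s1 s2 s1' s2' t :: real
  assumes nn: "n \<bullet> n = 1" and mm: "m \<bullet> m = 1" and nm: "n \<bullet> m = 0"
    and nn': "n \<bullet> n' = 0" and mm': "m \<bullet> m' = 0" and nm': "n \<bullet> m' = - (m \<bullet> n')" and e: "e \<bullet> e = 1"
  defines "Q \<equiv> biaxial_tensor s1 s2 n m"
  defines "Q' \<equiv> (s1' *\<^sub>R deviator n + s1 *\<^sub>R (tensor n' n + tensor n n'))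
       + (s2' *\<^sub>R deviator m + s2 *\<^sub>R (tensor m' m + tensor m m'))"
  shows "(norm Q')\<^sup>2 = 2 * s1\<^sup>2 * (norm n')\<^sup>2 + 2 * s2\<^sup>2 * (norm m')\<^sup>2 - 2 * s1 * s2 * ((m \<bullet> n')\<^sup>2 + (n \<bullet> m')\<^sup>2)
      + 1/3 * (s1' - s2')\<^sup>2 + 1/3 * (s1'\<^sup>2 + s2'\<^sup>2)" (is ?grad)
    and "Q \<bullet> row_cross e Q' = s1\<^sup>2 * (n \<bullet> cross3 e n') + s2\<^sup>2 * (m \<bullet> cross3 e m')
      + s1 * s2 * ((m \<bullet> n') * (e \<bullet> cross3 n m) + (n \<bullet> m') * (e \<bullet> cross3 m n))" (is ?curl)
    and "3 * (norm Q)\<^sup>2 = 2 * s1\<^sup>2 + 2 * s2\<^sup>2 - 2 * s1 * s2" (is ?norm)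
    and "(norm ((m \<bullet> n') *\<^sub>R e - t *\<^sub>R cross3 n m))\<^sup>2 = (m \<bullet> n')\<^sup>2 - 2 * t * (m \<bullet> n') * (e \<bullet> cross3 n m) + t\<^sup>2"
    and "(norm ((n \<bullet> m') *\<^sub>R e - t *\<^sub>R cross3 m n))\<^sup>2 = (n \<bullet> m')\<^sup>2 - 2 * t * (n \<bullet> m') * (e \<bullet> cross3 m n) + t\<^sup>2"
proof -
  have sym: "n' \<bullet> n = 0" "m' \<bullet> m = 0" "m \<bullet> n = 0" "m' \<bullet> n = - (m \<bullet> n')" "n' \<bullet> m = m \<bullet> n'"
    using nn' mm' nm nm' by (simp_all add: inner_commute)
  have I3: "mat 1 \<bullet> (mat 1 :: real^3^3) = 3" by (simp add: inner_vec_def mat_def sum_3)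
  note inn = inner_tensor_tensor inner_mat1_tensor inner_mat1_tensor[unfolded inner_commute[of "mat 1"]] I3 nn mm nm nn' mm' nm' sym
  show ?grad
    unfolding power2_norm_eq_inner Q'_def
    by (simp add: inner_add_left inner_add_right inner_diff_left inner_diff_right inn power2_eq_square algebra_simps)
  show ?norm
    unfolding power2_norm_eq_inner Q_def biaxial_tensor_def
    by (simp add: inner_add_left inner_add_right inner_diff_left inner_diff_right inn power2_eq_square algebra_simps)
  \<comment> \<open>Symmetries of the scalar triple product bring the mixed terms to a common
    form.\<close>
  have cr: "n \<bullet> cross3 e n = 0" "m \<bullet> cross3 e m = 0" "n' \<bullet> cross3 e n = - (n \<bullet> cross3 e n')" "m' \<bullet> cross3 e m = - (m \<bullet> cross3 e m')"
    "m \<bullet> cross3 e n = e \<bullet> cross3 n m" "n \<bullet> cross3 e m = e \<bullet> cross3 m n"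
    by (simp_all add: cross3_def inner_vec_def sum_3 algebra_simps)
  show ?curl
    unfolding Q'_def Q_def biaxial_tensor_def
    by (simp add: row_cross_add row_cross_diff row_cross_scaleR row_cross_tensor inner_row_cross_mat1
        inner_add_left inner_add_right inner_diff_left inner_diff_right inn cr power2_eq_square algebra_simps)
  have c1: "(norm (cross3 n m))\<^sup>2 = 1" "(norm (cross3 m n))\<^sup>2 = 1"
    using norm_cross_dot[of n m] norm_cross_dot[of m n] nn mm nm sym by (simp_all add: power_mult_distrib power2_norm_eq_inner)
  have "(norm (a *\<^sub>R e - t *\<^sub>R w))\<^sup>2 = a\<^sup>2 - 2 * t * a * (e \<bullet> w) + t\<^sup>2" if "(norm w)\<^sup>2 = 1" for a and w :: "real^3"
    using that e unfolding power2_norm_eq_inner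
    by (simp add: inner_diff_left inner_diff_right inner_commute power2_eq_square algebra_simps)
  then show "(norm ((m \<bullet> n') *\<^sub>R e - t *\<^sub>R cross3 n m))\<^sup>2 = (m \<bullet> n')\<^sup>2 - 2 * t * (m \<bullet> n') * (e \<bullet> cross3 n m) + t\<^sup>2"
    and "(norm ((n \<bullet> m') *\<^sub>R e - t *\<^sub>R cross3 m n))\<^sup>2 = (n \<bullet> m')\<^sup>2 - 2 * t * (n \<bullet> m') * (e \<bullet> cross3 m n) + t\<^sup>2"
    using c1 by blast+
qed

section \<open>The bulk energy in terms of the order parameters\<close>

lemma tensor_mult_tensor: "tensor u v ** tensor x y = (v \<bullet> x) *\<^sub>R tensor u y"
  by (simp add: tensor_def matrix_matrix_mult_def vec_eq_iff inner_vec_def sum_distrib_left sum_distrib_right mult_ac)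

lemma matrix_mult_add_left: "(A + B) ** C = A ** C + B ** (C :: real^'n^'n)"
  by (simp add: matrix_matrix_mult_def vec_eq_iff sum.distrib algebra_simps)

lemma matrix_mult_scaleR: "(c *\<^sub>R A) ** B = c *\<^sub>R (A ** (B :: real^'n^'n))" "A ** (c *\<^sub>R B) = c *\<^sub>R (A ** B)"
  by (simp_all add: matrix_matrix_mult_def vec_eq_iff sum_distrib_left mult_ac)

text \<open>For orthonormal n and m the combinations of n \<otimes> n, m \<otimes> m and the
  identity are closed under products, so powers of the tensor are computed on three coefficients.
  The diagonal matrices D yield the same traces from the eigenvalues.\<close>

lemma bulk_biaxial_tensor:
  assumes nn: "n \<bullet> n = 1" and mm: "m \<bullet> m = 1" and nm: "n \<bullet> m = 0"
  shows "bulk a b c (biaxial_tensor s1 s2 n m) = bulk_scalar a b c s1 s2"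
proof -
  define \<tau> where "\<tau> = (s1 + s2)/3"
  define M where "M x y z = x *\<^sub>R tensor n n + y *\<^sub>R tensor m m + z *\<^sub>R (mat 1 :: real^3^3)" for x y z
  have mn: "m \<bullet> n = 0" using nm by (simp add: inner_commute)
  have Q: "biaxial_tensor s1 s2 n m = M s1 s2 (- \<tau>)"
    by (simp add: biaxial_tensor_def M_def \<tau>_def algebra_simps add_divide_distrib)
  have mult: "M x y z ** M p q r = M (x * p + x * r + z * p) (y * q + y * r + z * q) (z * r)" for x y z p q r
    by (simp add: M_def matrix_add_ldistrib matrix_mult_add_left matrix_mult_scaleR tensor_mult_tensor nn mm nm mn
        algebra_simps)
  have tr: "trace (M x y z) = x + y + 3 * z" for x y z
    by (simp add: M_def trace_add trace_scaleR trace_tensor trace_I nn mm)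
  define D where "D x y z = (\<chi> i j. if i = j then (vector [x, y, z] :: real^3) $ i else 0)" for x y z :: real
  have Dmult: "D x y z ** D p q r = D (x * p) (y * q) (z * r)" for x y z p q r
    by (simp add: D_def matrix_matrix_mult_def vec_eq_iff forall_3 sum_3)
  have Dtr: "trace (D x y z) = x + y + z" for x y z by (simp add: D_def trace_def sum_3)
  have B: "bulk_scalar a b c s1 s2 = bulk a b c (D ((2 * s1 - s2) / 3) ((2 * s2 - s1) / 3) (- (s1 + s2) / 3))"
    by (simp add: bulk_scalar_def D_def Let_def)
  define q where "q = ((2 * s1 - s2) / 3)\<^sup>2 + ((2 * s2 - s1) / 3)\<^sup>2 + ((s1 + s2) / 3)\<^sup>2"
  have t2: "trace (biaxial_tensor s1 s2 n m ** biaxial_tensor s1 s2 n m) = q"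
    unfolding Q mult tr \<tau>_def q_def by (simp add: power2_eq_square field_simps)
  have t2': "trace (D ((2 * s1 - s2) / 3) ((2 * s2 - s1) / 3) (- (s1 + s2) / 3) ** D ((2 * s1 - s2) / 3) ((2 * s2 - s1) / 3) (- (s1 + s2) / 3)) = q"
    unfolding Dmult Dtr q_def by (simp add: power2_eq_square field_simps)
  have t3: "trace (biaxial_tensor s1 s2 n m ** biaxial_tensor s1 s2 n m ** biaxial_tensor s1 s2 n m)
     = ((2 * s1 - s2) / 3)^3 + ((2 * s2 - s1) / 3)^3 - ((s1 + s2) / 3)^3"
    unfolding Q mult tr \<tau>_def by (simp add: power3_eq_cube field_simps)
  have t3': "trace (D ((2 * s1 - s2) / 3) ((2 * s2 - s1) / 3) (- (s1 + s2) / 3) ** D ((2 * s1 - s2) / 3) ((2 * s2 - s1) / 3) (- (s1 + s2) / 3)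
       ** D ((2 * s1 - s2) / 3) ((2 * s2 - s1) / 3) (- (s1 + s2) / 3))
     = ((2 * s1 - s2) / 3)^3 + ((2 * s2 - s1) / 3)^3 - ((s1 + s2) / 3)^3"
    unfolding Dmult Dtr by (simp add: power3_eq_cube field_simps)
  show ?thesis unfolding B bulk_def t2 t2' t3 t3' ..
qed

section \<open>Equivalence of the two problems\<close>

lemma corresponding_iff:
  "corresponding \<Omega> Q (n, m, s1, s2) \<longleftrightarrow> (\<forall>x\<in>\<Omega>. Q x = biaxial_tensor (s1 x) (s2 x) (n x) (m x))"
  by (simp add: corresponding_def biaxial_tensor_def)

lemma minus_nonzero_set: "\<Omega> - {x. - s x = 0} = \<Omega> - {x. s x = (0::real)}"
  by auto

lemma order_le: "\<bar>order1 Q\<bar> \<le> 3 * norm Q" "\<bar>order2 Q\<bar> \<le> 3 * norm Q"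
proof -
  obtain v :: "real^3" where "v \<bullet> (0 *v v) = lmax 0" using lmax_attained[of 0] by metis
  then have "lmax 0 = 0" by simp
  then show "\<bar>order1 Q\<bar> \<le> 3 * norm Q" "\<bar>order2 Q\<bar> \<le> 3 * norm Q"
    using order_lipschitz[of Q 0] by (simp_all add: order1_def order2_def)
qed

lemma LdG_to_BE:
  assumes \<Omega>: "open \<Omega>" and Q: "Q \<in> LdG_admissible \<Omega>"
  shows "\<exists>p\<in>BE_admissible k \<Omega>. corresponding \<Omega> Q p"
proof -
  have QW: "Q \<in> W12 \<Omega>" and sym: "\<And>x. x \<in> \<Omega> \<Longrightarrow> transpose (Q x) = Q x \<and> trace (Q x) = 0"
    using Q by (auto simp: LdG_admissible_def)
  define s1 s2 where "s1 x = order1 (Q x)" and "s2 x = order2 (Q x)" for x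
  \<comment> \<open>v and w are arbitrary pointwise choices; regularity enters later through their
    projections.\<close>
  have "\<forall>x. \<exists>v w. x \<in> \<Omega> \<longrightarrow> norm v = 1 \<and> norm w = 1 \<and> v \<bullet> w = 0 \<and> 0 \<le> s1 x \<and> s2 x \<le> 0 \<and> Q x = biaxial_tensor (s1 x) (s2 x) v w"
    unfolding s1_def s2_def using sym biaxial_decomposition by metis
  then obtain v w where vw: "\<And>x. x \<in> \<Omega> \<Longrightarrow> norm (v x) = 1 \<and> norm (w x) = 1 \<and> v x \<bullet> w x = 0 \<and> 0 \<le> s1 x \<and> s2 x \<le> 0
      \<and> Q x = biaxial_tensor (s1 x) (s2 x) (v x) (w x)" by metis
  have s1W: "s1 \<in> W12 \<Omega>" and s2W: "s2 \<in> W12 \<Omega>"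
    using order_lipschitz order_le
    by (intro W12_lipschitz_image[OF \<Omega> QW, where C=3]; simp add: s1_def s2_def)+
  obtain n where n: "\<And>x. x \<in> \<Omega> - {x. s1 x = 0} \<Longrightarrow> n x = v x \<or> n x = - v x" "n \<in> W12_loc (\<Omega> - {x. s1 x = 0})"
    "AE x in lebesgue_on \<Omega>. (s1 x)\<^sup>2 * (norm (wderiv (\<Omega> - {x. s1 x = 0}) n x))\<^sup>2 \<le> 4 * (norm (wderiv \<Omega> Q x))\<^sup>2"
  proof (rule W12_director[OF \<Omega> QW W12D(4)[OF \<Omega> s1W]])
    fix x y assume xy: "x \<in> \<Omega>" "y \<in> \<Omega>"
    show "s1 x * norm (tensor (v x) (v x) - tensor (v y) (v y)) \<le> 2 * norm (Q x - Q y)"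
      by (rule leading_direction_perturbation) (use vw[OF xy(1)] vw[OF xy(2)] in auto)
  qed (use vw in auto)
  obtain m where m: "\<And>x. x \<in> \<Omega> - {x. s2 x = 0} \<Longrightarrow> m x = w x \<or> m x = - w x" "m \<in> W12_loc (\<Omega> - {x. s2 x = 0})"
    "AE x in lebesgue_on \<Omega>. (- s2 x)\<^sup>2 * (norm (wderiv (\<Omega> - {x. s2 x = 0}) m x))\<^sup>2 \<le> 4 * (norm (wderiv \<Omega> Q x))\<^sup>2"
  \<comment> \<open>For -Q the leading direction is w and the leading order parameter is
    -s2.\<close>
  proof (rule W12_director[OF \<Omega> QW W12D(4)[OF \<Omega> W12_minus[OF \<Omega> s2W]], unfolded minus_nonzero_set])
    fix x y assume xy: "x \<in> \<Omega>" "y \<in> \<Omega>"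
    have "- s2 x * norm (tensor (w x) (w x) - tensor (w y) (w y)) \<le> 2 * norm (- Q x - - Q y)"
      by (rule leading_direction_perturbation)
        (use vw[OF xy(1)] vw[OF xy(2)] in \<open>auto simp: biaxial_tensor_minus inner_commute\<close>)
    then show "- s2 x * norm (tensor (w x) (w x) - tensor (w y) (w y)) \<le> 2 * norm (Q x - Q y)"
      by (simp add: norm_minus_commute)
  qed (use vw in auto)
  have "corresponding \<Omega> Q (n, m, s1, s2)"
    unfolding corresponding_iff
  proof
    fix x assume x: "x \<in> \<Omega>"
    \<comment> \<open>The sign chosen for a director drops out of its projection.\<close>
    have "tensor (n x) (n x) = tensor (v x) (v x)" if "s1 x \<noteq> 0"
      using n(1)[of x] x that by (auto simp: tensor_minus_minus)
    moreover have "tensor (m x) (m x) = tensor (w x) (w x)" if "s2 x \<noteq> 0"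
      using m(1)[of x] x that by (auto simp: tensor_minus_minus)
    ultimately show "Q x = biaxial_tensor (s1 x) (s2 x) (n x) (m x)"
      using vw[OF x] by (cases "s1 x = 0"; cases "s2 x = 0") (simp_all add: biaxial_tensor_def)
  qed
  moreover have "(n, m, s1, s2) \<in> BE_admissible k \<Omega>"
  proof -
    let ?f = "\<lambda>x. (s1 x)\<^sup>2 * (norm (vgrad k (\<Omega> - {x. s1 x = 0}) n x))\<^sup>2 + (s2 x)\<^sup>2 * (norm (vgrad k (\<Omega> - {x. s2 x = 0}) m x))\<^sup>2"
    have "(\<integral>\<^sup>+x. ennreal (?f x) \<partial>lebesgue_on \<Omega>) \<le> (\<integral>\<^sup>+x. ennreal (8 * (norm (wderiv \<Omega> Q x))\<^sup>2) \<partial>lebesgue_on \<Omega>)"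
    proof (rule nn_integral_mono_AE)
      \<comment> \<open>8 = 4 + 4, one share for each director.\<close>
      show "AE x in lebesgue_on \<Omega>. ennreal (?f x) \<le> ennreal (8 * (norm (wderiv \<Omega> Q x))\<^sup>2)"
        using n(3) m(3) by eventually_elim (intro ennreal_leI, simp add: norm_vgrad)
    qed
    also have "\<dots> < \<infinity>"
    proof -
      have "integrable (lebesgue_on \<Omega>) (\<lambda>x. 8 * (norm (wderiv \<Omega> Q x))\<^sup>2)"
        using W12D(2)[OF \<Omega> QW] by (simp add: L2_on_def)
      then show ?thesis unfolding integrable_iff_bounded by simp
    qed
    finally have fin: "(\<integral>\<^sup>+x. ennreal (?f x) \<partial>lebesgue_on \<Omega>) < \<infinity>" .
    have "n x \<in> sphere 0 1" if "x \<in> \<Omega> - {x. s1 x = 0}" for x using n(1)[OF that] vw[of x] that by auto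
    moreover have "m x \<in> sphere 0 1" if "x \<in> \<Omega> - {x. s2 x = 0}" for x using m(1)[OF that] vw[of x] that by auto
    moreover have "n x \<bullet> m x = 0" if "x \<in> \<Omega> - {x. s1 x = 0} - {x. s2 x = 0}" for x
      using n(1)[of x] m(1)[of x] vw[of x] that by auto
    ultimately show ?thesis
      unfolding BE_admissible_def using s1W s2W n(2) m(2) vw fin by blast
  qed
  ultimately show ?thesis by blast
qed

lemma BE_admissibleD:
  assumes "(n, m, s1, s2) \<in> BE_admissible k \<Omega>"
  shows "s1 \<in> W12 \<Omega>" "\<And>x. x \<in> \<Omega> \<Longrightarrow> 0 \<le> s1 x" "n \<in> W12_loc (\<Omega> - {x. s1 x = 0})"
    "\<And>x. x \<in> \<Omega> - {x. s1 x = 0} \<Longrightarrow> norm (n x) = 1"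
    "(\<integral>\<^sup>+x. ennreal ((s1 x)\<^sup>2 * (norm (wderiv (\<Omega> - {x. s1 x = 0}) n x))\<^sup>2) \<partial>lebesgue_on \<Omega>) < \<infinity>"
    "s2 \<in> W12 \<Omega>" "\<And>x. x \<in> \<Omega> \<Longrightarrow> s2 x \<le> 0" "m \<in> W12_loc (\<Omega> - {x. s2 x = 0})"
    "\<And>x. x \<in> \<Omega> - {x. s2 x = 0} \<Longrightarrow> norm (m x) = 1"
    "(\<integral>\<^sup>+x. ennreal ((s2 x)\<^sup>2 * (norm (wderiv (\<Omega> - {x. s2 x = 0}) m x))\<^sup>2) \<partial>lebesgue_on \<Omega>) < \<infinity>"
    "\<And>x. x \<in> \<Omega> - {x. s1 x = 0} \<Longrightarrow> x \<in> \<Omega> - {x. s2 x = 0} \<Longrightarrow> n x \<bullet> m x = 0"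
proof -
  have fin: "(\<integral>\<^sup>+x. ennreal ((s1 x)\<^sup>2 * (norm (wderiv (\<Omega> - {x. s1 x = 0}) n x))\<^sup>2
          + (s2 x)\<^sup>2 * (norm (wderiv (\<Omega> - {x. s2 x = 0}) m x))\<^sup>2) \<partial>lebesgue_on \<Omega>) < \<infinity>"
    using assms unfolding BE_admissible_def norm_vgrad by blast
  show "(\<integral>\<^sup>+x. ennreal ((s1 x)\<^sup>2 * (norm (wderiv (\<Omega> - {x. s1 x = 0}) n x))\<^sup>2) \<partial>lebesgue_on \<Omega>) < \<infinity>"
    "(\<integral>\<^sup>+x. ennreal ((s2 x)\<^sup>2 * (norm (wderiv (\<Omega> - {x. s2 x = 0}) m x))\<^sup>2) \<partial>lebesgue_on \<Omega>) < \<infinity>"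
    by (rule le_less_trans[OF nn_integral_mono fin]; simp add: ennreal_leI)+
qed (use assms in \<open>auto simp: BE_admissible_def\<close>)

text \<open>The part built from m is the part built from n for the nonnegative parameter
  -s2.\<close>

lemma BE_parts:
  assumes \<Omega>: "open \<Omega>" and p: "(n, m, s1, s2) \<in> BE_admissible k \<Omega>"
  defines "U1 \<equiv> \<Omega> - {x. s1 x = 0}" and "U2 \<equiv> \<Omega> - {x. s2 x = 0}"
  shows "(\<lambda>x. s1 x *\<^sub>R deviator (n x)) \<in> W12 \<Omega>" "(\<lambda>x. s2 x *\<^sub>R deviator (m x)) \<in> W12 \<Omega>"
    and "AE x in lebesgue_on \<Omega>. regular_at s1 (wderiv \<Omega> s1 x) n (wderiv U1 n x) x"
    and "AE x in lebesgue_on \<Omega>. regular_at s2 (wderiv \<Omega> s2 x) m (wderiv U2 m x) x"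
proof -
  note pD = BE_admissibleD[OF p]
  show "(\<lambda>x. s1 x *\<^sub>R deviator (n x)) \<in> W12 \<Omega>"
    by (rule W12_director_part(1)[OF \<Omega> pD(1,2) refl pD(3,4,5)])
  show "AE x in lebesgue_on \<Omega>. regular_at s1 (wderiv \<Omega> s1 x) n (wderiv U1 n x) x"
    unfolding U1_def by (rule W12_director_part(2)[OF \<Omega> pD(1,2) refl pD(3,4,5)])
  have s: "(\<lambda>x. - s2 x) \<in> W12 \<Omega>" "\<And>x. x \<in> \<Omega> \<Longrightarrow> 0 \<le> - s2 x" using W12_minus[OF \<Omega> pD(6)] pD(7) by auto
  have U: "U2 = \<Omega> - {x. - s2 x = 0}" by (simp add: U2_def)
  have fin: "(\<integral>\<^sup>+x. ennreal ((- s2 x)\<^sup>2 * (norm (wderiv U2 m x))\<^sup>2) \<partial>lebesgue_on \<Omega>) < \<infinity>"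
    using pD(10) by (simp add: U2_def)
  have part1: "(\<lambda>x. (- s2 x) *\<^sub>R deviator (m x)) \<in> W12 \<Omega>"
    by (rule W12_director_part(1)[OF \<Omega> s U pD(8,9)[folded U2_def] fin])
  have part2: "AE x in lebesgue_on \<Omega>. regular_at (\<lambda>x. - s2 x) (wderiv \<Omega> (\<lambda>x. - s2 x) x) m (wderiv U2 m x) x"
    by (rule W12_director_part(2)[OF \<Omega> s U pD(8,9)[folded U2_def] fin])
  show "(\<lambda>x. s2 x *\<^sub>R deviator (m x)) \<in> W12 \<Omega>" using W12_minus[OF \<Omega> part1] by simp
  show "AE x in lebesgue_on \<Omega>. regular_at s2 (wderiv \<Omega> s2 x) m (wderiv U2 m x) x"
    using part2 wderiv_AE[OF \<Omega> s(1)] wderiv_AE[OF \<Omega> pD(6)]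
  proof eventually_elim
    case (elim x)
    have "((\<lambda>x. - s2 x) has_vector_derivative - wderiv \<Omega> s2 x) (at x)"
      using elim(3) by (rule has_vector_derivative_minus)
    \<comment> \<open>\<open>wderiv\<close> makes unrelated choices for s2 and for -s2; their
      relation is read off at points where both are true derivatives.\<close>
    then have ds: "wderiv \<Omega> (\<lambda>x. - s2 x) x = - wderiv \<Omega> s2 x" using elim(2) by (rule vector_derivative_unique_at[rotated])
    have "((\<lambda>x. - ((- s2 x) *\<^sub>R deviator (m x))) has_vector_derivative
       - (wderiv \<Omega> (\<lambda>x. - s2 x) x *\<^sub>R deviator (m x) +
         (- s2 x) *\<^sub>R (tensor (wderiv U2 m x) (m x) + tensor (m x) (wderiv U2 m x)))) (at x)"
      using elim(1) by (intro has_vector_derivative_minus) blast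
    then have "((\<lambda>x. s2 x *\<^sub>R deviator (m x)) has_vector_derivative wderiv \<Omega> s2 x *\<^sub>R deviator (m x) +
         s2 x *\<^sub>R (tensor (wderiv U2 m x) (m x) + tensor (m x) (wderiv U2 m x))) (at x)"
      unfolding ds by (simp add: add.commute)
    then show ?case using elim(1) ds by simp
  qed
qed

lemma BE_to_LdG:
  assumes \<Omega>: "open \<Omega>" and p: "p \<in> BE_admissible k \<Omega>"
  shows "\<exists>Q\<in>LdG_admissible \<Omega>. corresponding \<Omega> Q p"
proof -
  obtain n m s1 s2 where p': "p = (n, m, s1, s2)" by (cases p)
  note pD = BE_admissibleD[OF p[unfolded p']] and parts = BE_parts[OF \<Omega> p[unfolded p']]
  define Q where "Q x = biaxial_tensor (s1 x) (s2 x) (n x) (m x)" for x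
  have "Q \<in> W12 \<Omega>" using W12_add[OF \<Omega> parts(1,2)] by (simp add: Q_def[abs_def] biaxial_tensor_def)
  \<comment> \<open>A director may fail to be a unit vector only where its order parameter, hence
    its contribution, is zero.\<close>
  moreover have "trace (Q x) = 0" if "x \<in> \<Omega>" for x
    unfolding Q_def using pD(4)[of x] pD(9)[of x] that by (intro biaxial_tensor_trace) auto
  ultimately have "Q \<in> LdG_admissible \<Omega>" by (simp add: LdG_admissible_def Q_def biaxial_tensor_symmetric)
  moreover have "corresponding \<Omega> Q p" by (simp add: p' corresponding_iff Q_def)
  ultimately show ?thesis by blast
qed

text \<open>A director whose order parameter vanishes may be replaced by any unit vector orthogonal to
  the other director, with a derivative preserving the orthogonality to first order.\<close>

lemma frame_completion:
  fixes n n' m m' :: "real^3"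
  assumes "s1 \<noteq> (0::real) \<Longrightarrow> n \<bullet> n = 1 \<and> n \<bullet> n' = 0" "s2 \<noteq> (0::real) \<Longrightarrow> m \<bullet> m = 1 \<and> m \<bullet> m' = 0"
    "s1 \<noteq> 0 \<Longrightarrow> s2 \<noteq> 0 \<Longrightarrow> n \<bullet> m = 0 \<and> n \<bullet> m' = - (m \<bullet> n')"
  obtains N N' M M' where "N \<bullet> N = 1" "M \<bullet> M = 1" "N \<bullet> M = 0" "N \<bullet> N' = 0" "M \<bullet> M' = 0" "N \<bullet> M' = - (M \<bullet> N')"
    "s1 = 0 \<or> N = n \<and> N' = n'" "s2 = 0 \<or> M = m \<and> M' = m'"
proof -
  consider "s1 \<noteq> 0" "s2 \<noteq> 0" | "s1 \<noteq> 0" "s2 = 0" | "s1 = 0" "s2 \<noteq> 0" | "s1 = 0" "s2 = 0" by blast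
  then show thesis
  proof cases
    case 1
    then show thesis using assms by (intro that[of n m n' m']) auto
  next
    case 2
    obtain M where M: "norm M = 1" "n \<bullet> M = 0" using orthogonal_unit_exists .
    \<comment> \<open>The derivative assigned to M is the multiple of n that keeps N \<bullet> M
      zero to first order; being along n, it is orthogonal to M.\<close>
    show thesis
      by (rule that[of n M n' "- (M \<bullet> n') *\<^sub>R n"]) (use assms 2 M in \<open>auto simp: norm_eq_1 inner_commute\<close>)
  next
    case 3
    obtain N where N: "norm N = 1" "m \<bullet> N = 0" using orthogonal_unit_exists .
    show thesis
      by (rule that[of N m "- (N \<bullet> m') *\<^sub>R m" m']) (use assms 3 N in \<open>auto simp: norm_eq_1 inner_commute\<close>)
  next
    case 4
    obtain M :: "real^3" where M: "norm M = 1" "axis 1 1 \<bullet> M = (0::real)" using orthogonal_unit_exists[of "axis 1 1"] .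
    show thesis
      by (rule that[of "axis 1 1" M 0 0]) (use 4 M in \<open>auto simp: norm_eq_1 inner_axis_axis\<close>)
  qed
qed

text \<open>The densities agree at almost every point. At zeros of an order parameter the missing
  director is supplied by \<open>frame_completion\<close>, so that one identity for orthonormal
  frames covers all cases.\<close>

lemma energy_eq:
  assumes \<Omega>: "open \<Omega>" and Q: "Q \<in> LdG_admissible \<Omega>" and p: "p \<in> BE_admissible k \<Omega>" and c: "corresponding \<Omega> Q p"
  shows "I_L t a b c' k \<Omega> Q = I_BE t a b c' k \<Omega> p"
proof -
  obtain n m s1 s2 where p': "p = (n, m, s1, s2)" by (cases p)
  note pp = p[unfolded p']
  note pD = BE_admissibleD[OF pp] and parts = BE_parts[OF \<Omega> pp]
  have QW: "Q \<in> W12 \<Omega>" using Q by (simp add: LdG_admissible_def)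
  have Qeq: "Q x = biaxial_tensor (s1 x) (s2 x) (n x) (m x)" if "x \<in> \<Omega>" for x
    using c that by (simp add: p' corresponding_iff)
  define U1 U2 where "U1 = \<Omega> - {x. s1 x = 0}" and "U2 = \<Omega> - {x. s2 x = 0}"
  have oU: "open (U1 \<inter> U2)"
    unfolding U1_def U2_def using open_nonzero_set[OF \<Omega>] W12D(4)[OF \<Omega>] pD(1,6) by blast
  have dW: "(\<lambda>x. s1 x - s2 x) \<in> W12 \<Omega>" using W12_add[OF \<Omega> pD(1) W12_minus[OF \<Omega> pD(6)]] by simp
  let ?e = "axis k 1 :: real^3"
  have "AE x in lebesgue_on \<Omega>.
     (\<Sum>j\<in>UNIV. (norm (pd k \<Omega> j Q x))\<^sup>2) + 4 * t * (Q x \<bullet> mcurl k \<Omega> Q x)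
          + 3 * t\<^sup>2 * (norm (Q x))\<^sup>2 + bulk a b c' (Q x)
     = 2 * (s1 x)\<^sup>2 * ((norm (vgrad k U1 n x))\<^sup>2 + 2 * t * (n x \<bullet> vcurl k U1 n x) + t\<^sup>2)
        + 2 * (s2 x)\<^sup>2 * ((norm (vgrad k U2 m x))\<^sup>2 + 2 * t * (m x \<bullet> vcurl k U2 m x) + t\<^sup>2)
        + bulk_scalar a b c' (s1 x) (s2 x)
        - 2 * s1 x * s2 x *
            ((norm (m x v* vgrad k U1 n x - t *\<^sub>R cross3 (n x) (m x)))\<^sup>2
             + (norm (n x v* vgrad k U2 m x - t *\<^sub>R cross3 (m x) (n x)))\<^sup>2 - t\<^sup>2)
        + 1 / 3 * (norm (sgrad k \<Omega> (\<lambda>y. s1 y - s2 y) x))\<^sup>2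
        + 1 / 3 * ((norm (sgrad k \<Omega> s1 x))\<^sup>2 + (norm (sgrad k \<Omega> s2 x))\<^sup>2)"
    using parts(3,4) wderiv_AE[OF \<Omega> QW] wderiv_AE[OF \<Omega> dW] wderiv_AE[OF \<Omega> pD(1)] wderiv_AE[OF \<Omega> pD(6)] AE_space
    unfolding U1_def[symmetric] U2_def[symmetric]
  proof eventually_elim
    case (elim x)
    then have x: "x \<in> \<Omega>" by simp
    define n' m' s1' s2' where "n' = wderiv U1 n x" and "m' = wderiv U2 m x" and "s1' = wderiv \<Omega> s1 x" and "s2' = wderiv \<Omega> s2 x"
    note el = elim(1,2)[folded n'_def m'_def s1'_def s2'_def]
    have "((\<lambda>x. s1 x - s2 x) has_vector_derivative s1' - s2') (at x)"
      unfolding s1'_def s2'_def using elim(5,6) by (rule has_vector_derivative_diff)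
    then have ds: "wderiv \<Omega> (\<lambda>y. s1 y - s2 y) x = s1' - s2'" using elim(4) by (rule vector_derivative_unique_at[rotated])
    define D where "D u u' w w' = (s1' *\<^sub>R deviator u + s1 x *\<^sub>R (tensor u' u + tensor u u'))
       + (s2' *\<^sub>R deviator w + s2 x *\<^sub>R (tensor w' w + tensor w w'))" for u u' w w' :: "real^3"
    have "(Q has_vector_derivative D (n x) n' (m x) m') (at x)"
    proof (rule has_vector_derivative_transform_within_open[OF _ \<Omega> x])
      show "((\<lambda>x. s1 x *\<^sub>R deviator (n x) + s2 x *\<^sub>R deviator (m x))
         has_vector_derivative D (n x) n' (m x) m') (at x)"
        unfolding D_def using el by (intro has_vector_derivative_add) blast+
    qed (use Qeq in \<open>simp add: biaxial_tensor_def\<close>)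
    then have dQ: "wderiv \<Omega> Q x = D (n x) n' (m x) m'" using elim(3) by (rule vector_derivative_unique_at[rotated])
    \<comment> \<open>Orthogonality holds on the open set where both directors are defined, so it
      may be differentiated there.\<close>
    have nm: "n x \<bullet> m x = 0 \<and> n x \<bullet> m' = - (m x \<bullet> n')" if "s1 x \<noteq> 0" "s2 x \<noteq> 0"
    proof -
      have xU: "x \<in> U1 \<inter> U2" using that x by (simp add: U1_def U2_def)
      have "((\<lambda>x. n x \<bullet> m x) has_vector_derivative (n x \<bullet> m' + n' \<bullet> m x)) (at x)"
        using bounded_bilinear.has_vector_derivative[OF bounded_bilinear_inner, of n n' x UNIV m m'] el that by blast
      moreover have "((\<lambda>x. n x \<bullet> m x) has_vector_derivative 0) (at x)"
        by (rule has_vector_derivative_transform_within_open[of "\<lambda>x. 0", OF _ oU xU]) (use pD(11) in \<open>auto simp: U1_def U2_def\<close>)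
      ultimately have "n x \<bullet> m' + n' \<bullet> m x = 0" by (rule vector_derivative_unique_at)
      then show ?thesis using pD(11)[of x] xU by (simp add: U1_def U2_def inner_commute)
    qed
    have c1: "n x \<bullet> n x = 1 \<and> n x \<bullet> n' = 0" if "s1 x \<noteq> 0" using el that by blast
    have c2: "m x \<bullet> m x = 1 \<and> m x \<bullet> m' = 0" if "s2 x \<noteq> 0" using el that by blast
    obtain N N' M M' where fr: "N \<bullet> N = 1" "M \<bullet> M = 1" "N \<bullet> M = 0" "N \<bullet> N' = 0" "M \<bullet> M' = 0" "N \<bullet> M' = - (M \<bullet> N')"
      and NM: "s1 x = 0 \<or> N = n x \<and> N' = n'" "s2 x = 0 \<or> M = m x \<and> M' = m'"
      by (rule frame_completion[of "s1 x" "n x" n' "s2 x" "m x" m', OF c1 c2 nm])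
    \<comment> \<open>A replaced director enters Q and its derivative only with the factors s and
      s', both of which are zero.\<close>
    have "s1 x = 0 \<longrightarrow> s1' = 0" "s2 x = 0 \<longrightarrow> s2' = 0" using el by blast+
    then have QD: "Q x = biaxial_tensor (s1 x) (s2 x) N M" "wderiv \<Omega> Q x = D N N' M M'"
      using NM by (auto simp: Qeq[OF x] dQ biaxial_tensor_def D_def)
    have ee: "?e \<bullet> ?e = 1" by (simp add: inner_axis_axis)
    \<comment> \<open>R is the density of \<open>I_BE\<close> as a function of the frame. Every
      occurrence of a director carries its own order parameter as a factor, so R does not see the
      replacement.\<close>
    define R where "R u u' w w' = 2 * (s1 x)\<^sup>2 * ((norm u')\<^sup>2 + 2 * t * (u \<bullet> cross3 ?e u') + t\<^sup>2)
        + 2 * (s2 x)\<^sup>2 * ((norm w')\<^sup>2 + 2 * t * (w \<bullet> cross3 ?e w') + t\<^sup>2)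
        + bulk_scalar a b c' (s1 x) (s2 x)
        - 2 * s1 x * s2 x * ((norm ((w \<bullet> u') *\<^sub>R ?e - t *\<^sub>R cross3 u w))\<^sup>2
             + (norm ((u \<bullet> w') *\<^sub>R ?e - t *\<^sub>R cross3 w u))\<^sup>2 - t\<^sup>2)
        + 1 / 3 * (s1' - s2')\<^sup>2 + 1 / 3 * (s1'\<^sup>2 + s2'\<^sup>2)" for u u' w w'
    have grad: "(norm (D N N' M M'))\<^sup>2 = 2 * (s1 x)\<^sup>2 * (norm N')\<^sup>2 + 2 * (s2 x)\<^sup>2 * (norm M')\<^sup>2
        - 2 * s1 x * s2 x * ((M \<bullet> N')\<^sup>2 + (N \<bullet> M')\<^sup>2) + 1/3 * (s1' - s2')\<^sup>2 + 1/3 * (s1'\<^sup>2 + s2'\<^sup>2)"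
      unfolding D_def by (rule integrand_identity(1)[OF fr ee])
    have curl: "Q x \<bullet> row_cross ?e (D N N' M M') = (s1 x)\<^sup>2 * (N \<bullet> cross3 ?e N') + (s2 x)\<^sup>2 * (M \<bullet> cross3 ?e M')
        + s1 x * s2 x * ((M \<bullet> N') * (?e \<bullet> cross3 N M) + (N \<bullet> M') * (?e \<bullet> cross3 M N))"
      unfolding QD(1) D_def by (rule integrand_identity(2)[OF fr ee])
    have norm: "3 * (norm (Q x))\<^sup>2 = 2 * (s1 x)\<^sup>2 + 2 * (s2 x)\<^sup>2 - 2 * s1 x * s2 x"
      unfolding QD(1) by (rule integrand_identity(3)[OF fr ee])
    note ids = grad curl norm integrand_identity(4,5)[OF fr ee]
    have "(\<Sum>j\<in>UNIV. (norm (pd k \<Omega> j Q x))\<^sup>2) + 4 * t * (Q x \<bullet> mcurl k \<Omega> Q x)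
          + 3 * t\<^sup>2 * (norm (Q x))\<^sup>2 + bulk a b c' (Q x)
       = (norm (D N N' M M'))\<^sup>2 + 4 * t * (Q x \<bullet> row_cross ?e (D N N' M M')) + t\<^sup>2 * (3 * (norm (Q x))\<^sup>2) + bulk_scalar a b c' (s1 x) (s2 x)"
      unfolding sum_pd mcurl_eq QD(2) using bulk_biaxial_tensor[OF fr(1-3)] by (simp add: QD(1))
    \<comment> \<open>Expanding the two squares gives 2 t^2, and the subtracted t^2 leaves the
      single copy that the s1 s2 term of 3 |Q|^2 requires. Their terms linear in t match the mixed
      part of the curl term.\<close>
    also have "\<dots> = R N N' M M'"
      unfolding R_def ids by (simp add: algebra_simps power2_eq_square)
    also have "\<dots> = R (n x) n' (m x) m'"
      using NM unfolding R_def by (elim disjE conjE) simp_all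
    finally show ?case
      unfolding R_def norm_vgrad vcurl_eq vgrad_left_mult norm_sgrad ds n'_def[symmetric] m'_def[symmetric] s1'_def[symmetric] s2'_def[symmetric]
      by (simp only: power2_abs)
  qed
  from integral_lebesgue_on_cong_AE[OF open_lebesgue[OF \<Omega>] this]
  show ?thesis by (simp add: I_L_def I_BE_def p' U1_def U2_def Let_def)
qed

theorem theorem4p4:
  fixes \<Omega> :: "real set" and k :: 3 and t a b c :: real
  assumes "open \<Omega>" and "connected \<Omega>" and "\<Omega> \<noteq> {}" and "bounded \<Omega>"
    and "a < 0" and "c > 0"
  shows "(\<forall>Q\<in>LdG_admissible \<Omega>. \<exists>p\<in>BE_admissible k \<Omega>. corresponding \<Omega> Q p)
    \<and> (\<forall>p\<in>BE_admissible k \<Omega>. \<exists>Q\<in>LdG_admissible \<Omega>. corresponding \<Omega> Q p)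
    \<and> (\<forall>Q\<in>LdG_admissible \<Omega>. \<forall>p\<in>BE_admissible k \<Omega>. corresponding \<Omega> Q p \<longrightarrow>
         I_L t a b c k \<Omega> Q = I_BE t a b c k \<Omega> p \<and>
         (is_arg_min (I_L t a b c k \<Omega>) (\<lambda>Q'. Q' \<in> LdG_admissible \<Omega>) Q \<longleftrightarrow>
          is_arg_min (I_BE t a b c k \<Omega>) (\<lambda>p'. p' \<in> BE_admissible k \<Omega>) p))"
proof (intro conjI ballI impI)
  note to_BE = LdG_to_BE[OF \<open>open \<Omega>\<close>, of _ k] and to_LdG = BE_to_LdG[OF \<open>open \<Omega>\<close>, of _ k]
    and eq = energy_eq[OF \<open>open \<Omega>\<close>, of _ _ k t a b c]
  show "\<exists>p\<in>BE_admissible k \<Omega>. corresponding \<Omega> Q p" if "Q \<in> LdG_admissible \<Omega>" for Q using to_BE[OF that] .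
  show "\<exists>Q\<in>LdG_admissible \<Omega>. corresponding \<Omega> Q p" if "p \<in> BE_admissible k \<Omega>" for p using to_LdG[OF that] .
  fix Q p assume Q: "Q \<in> LdG_admissible \<Omega>" and p: "p \<in> BE_admissible k \<Omega>" and c: "corresponding \<Omega> Q p"
  show I: "I_L t a b c k \<Omega> Q = I_BE t a b c k \<Omega> p" by (rule eq[OF Q p c])
  \<comment> \<open>Every competitor has at least one partner of equal energy in the other class, so
    a strictly better one exists on one side exactly when it exists on the other.\<close>
  have "(\<exists>Q'\<in>LdG_admissible \<Omega>. I_L t a b c k \<Omega> Q' < I_L t a b c k \<Omega> Q) \<longleftrightarrow>
        (\<exists>p'\<in>BE_admissible k \<Omega>. I_BE t a b c k \<Omega> p' < I_BE t a b c k \<Omega> p)"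
    using to_BE to_LdG eq I by metis
  then show "is_arg_min (I_L t a b c k \<Omega>) (\<lambda>Q'. Q' \<in> LdG_admissible \<Omega>) Q \<longleftrightarrow>
      is_arg_min (I_BE t a b c k \<Omega>) (\<lambda>p'. p' \<in> BE_admissible k \<Omega>) p"
    using Q p by (auto simp: is_arg_min_def)
qed

end
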